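(* $\lambda_5(n)=O\big(n\alpha(n)2^{\alpha(n)}\big)$, and $\lambda_5(n,m)=m+O\big(n\alpha(n,m)2^{\alpha(n,m)}\big)$ for all $n,m\ge1$.
   Context: A sequence contains an alternation of length $7$ if there are distinct symbols $a\ne b$ and indices $i_1<\dots<i_7$ whose entries are $a,b,a,b,a,b,a$. $\lambda_5(n)$ is the maximum length of a sequence using at most $n$ distinct symbols with no two consecutive equal entries and no alternation of length $7$. A block is a sequence of pairwise distinct symbols; $\lambda_5(n,m)$ is the maximum length of a sequence using at most $n$ distinct symbols, with no alternation of length 7, that is a concatenation of at most $m$ blocks. Ackermann's function: $a_{1,j}=2^j$, $a_{i,1}=2$ ($i\ge2$), $a_{i,j}=w\cdot a_{i-1,w}$ with $w=a_{i,j-1}$ ($i,j\ge2$); $\alpha(n,m)=\min\{i: a_{i,j}\ge m,\ j=\max\{\lceil n/m\rceil,3\}\}$, $\alpha(n)=\alpha(n,n)$. *)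

theory Defs
  imports Complex_Main "HOL-Library.Sublist"
begin

definition has_alt7 :: "nat list \<Rightarrow> bool" where
  "has_alt7 s \<longleftrightarrow> (\<exists>a b. a \<noteq> b \<and> subseq [a,b,a,b,a,b,a] s)"

definition no_adj_eq :: "nat list \<Rightarrow> bool" where
  "no_adj_eq s \<longleftrightarrow> (\<forall>i. Suc i < length s \<longrightarrow> s ! i \<noteq> s ! Suc i)"

definition lambda5 :: "nat \<Rightarrow> nat" where
  "lambda5 n = Sup {length s | s. card (set s) \<le> n \<and> no_adj_eq s \<and> \<not> has_alt7 s}"

definition is_m_block :: "nat \<Rightarrow> nat list \<Rightarrow> bool" where
  "is_m_block m s \<longleftrightarrow> (\<exists>bs. length bs \<le> m \<and> s = concat bs \<and> (\<forall>b\<in>set bs. distinct b))"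

definition lambda5m :: "nat \<Rightarrow> nat \<Rightarrow> nat" where
  "lambda5m n m = Sup {length s | s. card (set s) \<le> n \<and> is_m_block m s \<and> \<not> has_alt7 s}"

text \<open>Ackermann's function a_{i,j} for i, j >= 1 (values at index 0 are irrelevant).\<close>
fun acker :: "nat \<Rightarrow> nat \<Rightarrow> nat" where
  "acker 0 j = 0"
| "acker (Suc 0) j = 2 ^ j"
| "acker (Suc (Suc i)) 0 = 0"
| "acker (Suc (Suc i)) (Suc 0) = 2"
| "acker (Suc (Suc i)) (Suc (Suc j)) =
     (let w = acker (Suc (Suc i)) (Suc j) in w * acker (Suc i) w)"

definition alpha2 :: "nat \<Rightarrow> nat \<Rightarrow> nat" where
  "alpha2 n m = (let j = max (nat \<lceil>real n / real m\<rceil>) 3 in LEAST i. i \<ge> 1 \<and> acker i j \<ge> m)"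

definition alpha1 :: "nat \<Rightarrow> nat" where
  "alpha1 n = alpha2 n n"

end

theory Submission
  imports Defs
begin

text \<open>
  A blocked sequence is cut into intervals of consecutive blocks. A symbol occurring in one interval
  only is treated recursively; of the others, the occurrences in the first and in the last interval
  avoid alternations one shorter, those in a middle interval two shorter, and the number of
  (symbol, middle interval) incidences is the length of a contracted sequence with one block per
  interval. Recursing on the sides in the column and on the contraction in the row of an
  Ackermann-like function, this gives \<open>O(i)\<close> occurrences per symbol for alternations of length
  5 and \<open>O(2^i)\<close> for length 6. For length 7 it gives only a product of \<open>O(i)\<close> factors, because
  each incidence with a middle interval may expand by a factor \<open>O(i)\<close>.

  The remedy is a labelling of the incidences which depends only on the set of blocks of the single
  symbol. If two symbols have the label \<open>Dove\<close> (or both \<open>Hawk\<close>) in the same block, then somewhere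
  before or somewhere after that block the first symbol occurs before the second one, and also vice
  versa; this leaves no room for an alternation of length 4 when the block is expanded, so the
  expansion costs a factor 2. Only \<open>O(i^3)\<close> incidences per symbol, the tips, are unlabelled and
  expand by \<open>O(i)\<close>; doubling per level then yields \<open>O(i 2^i)\<close>.

  A sequence without adjacent equal entries splits into at most \<open>2n + 1\<close> intervals without
  alternations of length 5. Since the number of labels is bounded, the same classification within
  these intervals reduces the sparse case to the blocked one without losing a factor.
\<close>

section \<open>Alternations and blocks\<close>

text \<open>Why labels depend on block sets alone: contracting changes the sequence but not the set
  of intervals met by a symbol. So labels can be computed in the contraction, and the unlabelled
  incidences are counted there by a recursion of their own. In it the bound for the contraction
  enters without a factor, because a tip leaves at most one tip when expanded; this makes the number
  of tips polynomial in the row.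

  The factor \<open>i\<close> beside \<open>2 ^ i\<close> is not due to the tips, whose cost of
  order \<open>i ^ 4\<close> per row is summable against \<open>2 ^ i\<close>. It comes from the
  first and last intervals, which add a multiple of \<open>mu4\<close>, of order
  \<open>2 ^ i\<close>, in each row.

  The number of blocks needs care in two places. The error grows like \<open>8 ^ j\<close> in the
  column \<open>j\<close>, so the column has to be about the logarithm of Ackermann's second
  argument. In the sparse case, and for \<open>n \<le> m\<close>, the blocks must enter with a small
  constant or with coefficient 1: there positions that repeat their neighbour are deleted, at most
  one per block, and the rest is bounded by its symbols alone.\<close>

text \<open>
  A sequence is a set of positions \<open>E\<close> together with the symbol function \<open>f\<close>, so that subsequences
  are subsets; the division into blocks is a function \<open>\<beta>\<close> on positions.
\<close>

primrec alt :: "(nat \<Rightarrow> 'a) \<Rightarrow> nat \<Rightarrow> 'a \<Rightarrow> 'a \<Rightarrow> nat set \<Rightarrow> bool" where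
  "alt f 0 a b E \<longleftrightarrow> True"
| "alt f (Suc k) a b E \<longleftrightarrow> (\<exists>p\<in>E. f p = a \<and> alt f k b a {r\<in>E. p < r})"

definition alt_free :: "(nat \<Rightarrow> 'a) \<Rightarrow> nat \<Rightarrow> nat set \<Rightarrow> bool" where
  "alt_free f k E \<longleftrightarrow> (\<forall>a b. a \<noteq> b \<longrightarrow> \<not> alt f k a b E)"

definition mono_blocks :: "(nat \<Rightarrow> nat) \<Rightarrow> nat set \<Rightarrow> bool" where
  "mono_blocks \<beta> E \<longleftrightarrow> (\<forall>p\<in>E. \<forall>r\<in>E. p < r \<longrightarrow> \<beta> p \<le> \<beta> r)"

definition blocked :: "(nat \<Rightarrow> 'a) \<Rightarrow> (nat \<Rightarrow> nat) \<Rightarrow> nat set \<Rightarrow> bool" where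
  "blocked f \<beta> E \<longleftrightarrow> mono_blocks \<beta> E \<and> (\<forall>p\<in>E. \<forall>r\<in>E. f p = f r \<and> \<beta> p = \<beta> r \<longrightarrow> p = r)"

lemma alt_mono: "alt f k a b D \<Longrightarrow> D \<subseteq> E \<Longrightarrow> alt f k a b E"
proof (induction k arbitrary: a b D E)
  case (Suc k)
  then obtain p where p: "p \<in> D" "f p = a" "alt f k b a {r\<in>D. p < r}" by auto
  have "alt f k b a {r\<in>E. p < r}"
    by (rule Suc.IH[OF p(3)]) (use Suc.prems(2) in auto)
  then show ?case using p Suc.prems(2) unfolding alt.simps by blast
qed simp

lemma alt_cons:
  assumes "alt f k b a D" "D \<subseteq> E" "z \<in> E" "\<forall>r\<in>D. z < r" "f z = a"
  shows "alt f (Suc k) a b E"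
proof -
  have "D \<subseteq> {r\<in>E. z < r}" using assms(2,4) by blast
  with assms(1) have "alt f k b a {r\<in>E. z < r}" by (rule alt_mono)
  then show ?thesis using assms(3,5) unfolding alt.simps by blast
qed

lemma alt_SucI: "p \<in> E \<Longrightarrow> f p = a \<Longrightarrow> alt f k b a {r\<in>E. p < r} \<Longrightarrow> alt f (Suc k) a b E"
  by auto

lemma alt_3I:
  assumes "x \<in> E" "y \<in> E" "z \<in> E" "x < y" "y < z" "f x = a" "f y = b" "f z = a"
  shows "alt f 3 a b E"
  unfolding numeral_3_eq_3
  by (rule alt_SucI[where p = x], use assms in simp, use assms in simp,
      rule alt_SucI[where p = y], use assms in simp, use assms in simp,
      rule alt_SucI[where p = z], use assms in simp, use assms in simp, simp)

lemma alt_4I: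
  assumes "w \<in> E" "x \<in> E" "y \<in> E" "z \<in> E" "w < x" "x < y" "y < z" "f w = b" "f x = a" "f y = b" "f z = a"
  shows "alt f 4 b a E"
proof -
  have "alt f 3 a b {r\<in>E. w < r}" by (rule alt_3I[where x = x and y = y and z = z]) (use assms in auto)
  then show ?thesis using assms alt_SucI[of w E f b 3 a] by (simp add: eval_nat_numeral)
qed

lemma alt_snoc:
  assumes "alt f k a b D" "D \<subseteq> E" "z \<in> E" "\<forall>r\<in>D. r < z" "f z = (if even k then a else b)"
  shows "alt f (Suc k) a b E"
  using assms
proof (induction k arbitrary: a b D E)
  case (Suc k)
  obtain p where p: "p \<in> D" "f p = a" "alt f k b a {r\<in>D. p < r}" using Suc.prems(1) by auto
  have "alt f (Suc k) b a {r\<in>E. p < r}"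
    by (rule Suc.IH[OF p(3)]) (use Suc.prems p in \<open>auto split: if_splits\<close>)
  then show ?case using p Suc.prems(2) unfolding alt.simps(2)[of f "Suc k"] by blast
qed auto

lemma alt_freeD: "alt_free f k E \<Longrightarrow> a \<noteq> b \<Longrightarrow> \<not> alt f k a b E"
  unfolding alt_free_def by metis

lemma alt_free_mono: "alt_free f k E \<Longrightarrow> D \<subseteq> E \<Longrightarrow> alt_free f k D"
  unfolding alt_free_def by (metis alt_mono)

lemma mono_blocks_mono: "mono_blocks \<beta> E \<Longrightarrow> D \<subseteq> E \<Longrightarrow> mono_blocks \<beta> D"
  unfolding mono_blocks_def by blast

lemma blocked_mono: "blocked f \<beta> E \<Longrightarrow> D \<subseteq> E \<Longrightarrow> blocked f \<beta> D"
  unfolding blocked_def mono_blocks_def by blast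

lemma mono_blocksD: "mono_blocks \<beta> E \<Longrightarrow> p \<in> E \<Longrightarrow> r \<in> E \<Longrightarrow> \<beta> p < \<beta> r \<Longrightarrow> p < r"
  unfolding mono_blocks_def by (metis leD linorder_neqE_nat order_less_irrefl)

lemma alt_both:
  assumes "alt f k a b E" "2 \<le> k"
  shows "(\<exists>p\<in>E. f p = a) \<and> (\<exists>p\<in>E. f p = b)"
proof -
  obtain l where "k = Suc (Suc l)" using assms(2) le_Suc_ex[of 2 k] by auto
  then show ?thesis using assms(1) by auto
qed

text \<open>An alternation \<open>a b ...\<close> in \<open>C\<close> is prolonged to the left by an
  earlier occurrence of \<open>b\<close>. For \<open>k\<close> at least 2 both symbols occur in
  \<open>C\<close>, so the last hypothesis provides that occurrence.\<close>

lemma alt_free_before: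
  assumes "alt_free f (Suc k) E" "C \<subseteq> E" "2 \<le> k"
    and "\<And>p. p \<in> C \<Longrightarrow> \<exists>z\<in>E. f z = f p \<and> (\<forall>r\<in>C. z < r)"
  shows "alt_free f k C"
  unfolding alt_free_def
proof (intro allI impI notI)
  fix a b :: 'a assume ab: "a \<noteq> b" and alt: "alt f k a b C"
  obtain p where "p \<in> C" "f p = b" using alt_both[OF alt assms(3)] by blast
  then obtain z where z: "z \<in> E" "\<forall>r\<in>C. z < r" "f z = b" using assms(4)[of p] by auto
  have "alt f (Suc k) b a E" by (rule alt_cons[OF alt assms(2) z])
  then show False using alt_freeD[OF assms(1)] ab by metis
qed

lemma alt_free_after:
  assumes "alt_free f (Suc k) E" "C \<subseteq> E" "2 \<le> k"
    and "\<And>p. p \<in> C \<Longrightarrow> \<exists>z\<in>E. f z = f p \<and> (\<forall>r\<in>C. r < z)"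
  shows "alt_free f k C"
  unfolding alt_free_def
proof (intro allI impI notI)
  fix a b :: 'a assume ab: "a \<noteq> b" and alt: "alt f k a b C"
  have "\<exists>p\<in>C. f p = (if even k then a else b)"
    using alt_both[OF alt assms(3)] by simp
  then obtain p where "p \<in> C" "f p = (if even k then a else b)" by blast
  then obtain z where z: "z \<in> E" "\<forall>r\<in>C. r < z" "f z = (if even k then a else b)"
    using assms(4)[of p] by auto
  have "alt f (Suc k) a b E" by (rule alt_snoc[OF alt assms(2) z])
  then show False using alt_freeD[OF assms(1)] ab by metis
qed

text \<open>If two positions of one block both repeat earlier symbols, the earlier occurrence of the right
  one lies in an earlier block, which gives an alternation of length 3. Hence each block contains
  at most one repetition; likewise for \<open>card_le_alt_free_4\<close> and occurrences that are neither first
  nor last.\<close>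

lemma card_le_alt_free_3:
  assumes "finite E" "blocked f \<beta> E" "alt_free f 3 E" "\<beta> ` E \<subseteq> {..<m}"
  shows "card E \<le> card (f ` E) + m"
proof -
  define N where "N = {p\<in>E. \<exists>r\<in>E. f r = f p \<and> r < p}"
  have sub: "N \<subseteq> E" by (auto simp: N_def)
  have "inj_on f (E - N)"
    by (rule inj_onI) (auto simp: N_def, metis linorder_neqE_nat)
  then have 1: "card (E - N) \<le> card (f ` E)"
    using assms(1) by (intro card_inj_on_le[of f]) auto
  have *: False if "p \<in> N" "r \<in> N" "\<beta> p = \<beta> r" "p < r" for p r
  proof -
    note h = that
    have ne: "f p \<noteq> f r" using that sub assms(2) unfolding blocked_def by blast
    obtain y where y: "y \<in> E" "f y = f r" "y < r" using h(2) by (auto simp: N_def)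
    have "\<beta> y \<noteq> \<beta> p" using y that sub assms(2) unfolding blocked_def by (metis less_irrefl subsetD)
    moreover have "\<beta> y \<le> \<beta> r" using y that sub assms(2) unfolding blocked_def mono_blocks_def by blast
    ultimately have "\<beta> y < \<beta> p" using that(3) by simp
    then have yp: "y < p" using mono_blocksD assms(2) y(1) that(1) sub unfolding blocked_def by blast
    have "alt f 3 (f r) (f p) E"
      by (rule alt_3I[where x = y and y = p and z = r]) (use y that sub yp in auto)
    then show False using alt_freeD[OF assms(3)] ne by metis
  qed
  have "inj_on \<beta> N"
    by (rule inj_onI) (metis * linorder_neqE_nat)
  then have "card N \<le> card {..<m}"
    using assms(4) sub by (intro card_inj_on_le[of \<beta>]) auto
  moreover have "card E = card (E - N) + card N"
    using sub assms(1) by (simp add: card_Diff_subset card_mono finite_subset)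
  ultimately show ?thesis using 1 by simp
qed

lemma card_le_alt_free_4:
  assumes "finite E" "blocked f \<beta> E" "alt_free f 4 E" "\<beta> ` E \<subseteq> {..<m}"
  shows "card E \<le> 2 * card (f ` E) + m"
proof -
  define N where "N = {p\<in>E. (\<exists>r\<in>E. f r = f p \<and> r < p) \<and> (\<exists>r\<in>E. f r = f p \<and> p < r)}"
  define P where "P = {p\<in>E. \<not> (\<exists>r\<in>E. f r = f p \<and> r < p)}"
  define Q where "Q = {p\<in>E. \<not> (\<exists>r\<in>E. f r = f p \<and> p < r)}"
  have sub: "N \<subseteq> E" by (auto simp: N_def)
  have "inj_on f P"
    by (rule inj_onI) (auto simp: P_def, metis linorder_neqE_nat)
  then have 1: "card P \<le> card (f ` E)"
    using assms(1) by (intro card_inj_on_le[of f]) (auto simp: P_def)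
  have "inj_on f Q"
    by (rule inj_onI) (auto simp: Q_def, metis linorder_neqE_nat)
  then have 2: "card Q \<le> card (f ` E)"
    using assms(1) by (intro card_inj_on_le[of f]) (auto simp: Q_def)
  have *: False if "p \<in> N" "r \<in> N" "\<beta> p = \<beta> r" "p < r" for p r
  proof -
    note h = that
    have pr: "p \<in> E" "r \<in> E" using that sub by auto
    have inj: "x = y" if "x \<in> E" "y \<in> E" "f x = f y" "\<beta> x = \<beta> y" for x y
      using that assms(2) unfolding blocked_def by blast
    have mono: "\<beta> x \<le> \<beta> y" if "x \<in> E" "y \<in> E" "x < y" for x y
      using that assms(2) unfolding blocked_def mono_blocks_def by blast
    have lt: "x < y" if "x \<in> E" "y \<in> E" "\<beta> x < \<beta> y" for x y
      using that mono_blocksD assms(2) unfolding blocked_def by blast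
    have ne: "f p \<noteq> f r" using inj[OF pr] that by auto
    obtain y where y: "y \<in> E" "f y = f r" "y < r" using h(2) by (auto simp: N_def)
    obtain x where x: "x \<in> E" "f x = f p" "p < x" using h(1) by (auto simp: N_def)
    have "\<beta> y < \<beta> p" using mono[OF y(1) pr(2) y(3)] inj[OF y(1) pr(2)] y that(3)
      by (metis le_neq_implies_less less_irrefl)
    then have yp: "y < p" using lt y(1) pr(1) by blast
    have "\<beta> r < \<beta> x" using mono[OF pr(1) x(1) x(3)] inj[OF pr(1) x(1)] x that(3)
      by (metis le_neq_implies_less less_irrefl)
    then have rx: "r < x" using lt x(1) pr(2) by blast
    have "alt f 4 (f r) (f p) E"
      by (rule alt_4I[where w = y and x = p and y = r and z = x]) (use x y yp rx pr that in auto)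
    then show False using alt_freeD[OF assms(3)] ne by metis
  qed
  have "inj_on \<beta> N"
    by (rule inj_onI) (metis * linorder_neqE_nat)
  then have 3: "card N \<le> card {..<m}"
    using assms(4) sub by (intro card_inj_on_le[of \<beta>]) auto
  have "E = N \<union> (P \<union> Q)" by (auto simp: N_def P_def Q_def)
  then have "card E \<le> card N + card (P \<union> Q)" by (metis card_Un_le)
  then have "card E \<le> card N + (card P + card Q)" using card_Un_le[of P Q] by linarith
  with 1 2 3 show ?thesis by simp
qed

section \<open>Counting incidences of symbols with intervals; contraction\<close>

lemma sum_card_symbols:
  fixes \<gamma> :: "nat \<Rightarrow> nat"
  assumes "finite C" "\<gamma> ` C \<subseteq> {..<M}"
  shows "(\<Sum>q<M. card (f ` {p\<in>C. \<gamma> p = q})) = card ((\<lambda>p. (f p, \<gamma> p)) ` C)"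
proof -
  have fin: "finite {p\<in>C. \<gamma> p = q}" for q using assms(1) by simp
  have "(\<Sum>q<M. card (f ` {p\<in>C. \<gamma> p = q})) = card (\<Union>q<M. (\<lambda>p. (f p, \<gamma> p)) ` {p\<in>C. \<gamma> p = q})"
  proof (subst card_UN_disjoint)
    show "(\<Sum>q<M. card (f ` {p \<in> C. \<gamma> p = q})) = (\<Sum>q<M. card ((\<lambda>p. (f p, \<gamma> p)) ` {p \<in> C. \<gamma> p = q}))"
    proof (rule sum.cong)
      fix q
      have "(\<lambda>p. (f p, \<gamma> p)) ` {p \<in> C. \<gamma> p = q} = (\<lambda>a. (a, q)) ` f ` {p \<in> C. \<gamma> p = q}" by force
      then show "card (f ` {p \<in> C. \<gamma> p = q}) = card ((\<lambda>p. (f p, \<gamma> p)) ` {p \<in> C. \<gamma> p = q})"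
        by (simp add: card_image inj_on_def)
    qed simp
  qed (use fin in auto)
  also have "(\<Union>q<M. (\<lambda>p. (f p, \<gamma> p)) ` {p\<in>C. \<gamma> p = q}) = (\<lambda>p. (f p, \<gamma> p)) ` C"
    using assms(2) by auto
  finally show ?thesis .
qed

text \<open>\<open>D\<close> is kept apart from \<open>C\<close> because tips are counted against
  all symbols of an interval, not only against the symbols of the tips.\<close>

lemma card_subset_interval_sum:
  fixes \<gamma> :: "nat \<Rightarrow> nat"
  assumes "finite C" "\<gamma> ` C \<subseteq> {..<M}" "D \<subseteq> C"
    and "\<And>q. card {p\<in>D. \<gamma> p = q} \<le> \<mu> * card (f ` {p\<in>C. \<gamma> p = q}) + c q"
  shows "card D \<le> \<mu> * card ((\<lambda>p. (f p, \<gamma> p)) ` C) + (\<Sum>q<M. c q)"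
proof -
  have fin: "finite {p\<in>D. \<gamma> p = q}" for q
    using assms(1,3) by (auto intro: finite_subset)
  have D: "D = (\<Union>q<M. {p\<in>D. \<gamma> p = q})" using assms(2,3) by auto
  have "card D = (\<Sum>q<M. card {p\<in>D. \<gamma> p = q})"
    by (subst D, rule card_UN_disjoint) (use fin in auto)
  also have "\<dots> \<le> (\<Sum>q<M. \<mu> * card (f ` {p\<in>C. \<gamma> p = q}) + c q)"
    by (intro sum_mono assms(4))
  also have "\<dots> = \<mu> * card ((\<lambda>p. (f p, \<gamma> p)) ` C) + (\<Sum>q<M. c q)"
    unfolding sum_card_symbols[OF assms(1,2), of f, symmetric] by (simp add: sum.distrib sum_distrib_left)
  finally show ?thesis .
qed

lemmas card_interval_sum = card_subset_interval_sum[OF _ _ subset_refl]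

text \<open>Every interval becomes one block. Keeping the earliest position of each symbol makes the
  result a subset of \<open>E\<close>, so that freeness from alternations is inherited.\<close>

definition contract :: "(nat \<Rightarrow> 'a) \<Rightarrow> (nat \<Rightarrow> nat) \<Rightarrow> nat set \<Rightarrow> nat set" where
  "contract f \<gamma> E = {p\<in>E. \<forall>r\<in>E. f r = f p \<and> \<gamma> r = \<gamma> p \<longrightarrow> p \<le> r}"

lemma contract_subset: "contract f \<gamma> E \<subseteq> E"
  by (auto simp: contract_def)

lemma contract_rep:
  assumes "p \<in> E"
  obtains r where "r \<in> contract f \<gamma> E" "f r = f p" "\<gamma> r = \<gamma> p"
proof -
  define r where "r = (LEAST r. r \<in> E \<and> f r = f p \<and> \<gamma> r = \<gamma> p)"
  have r: "r \<in> E \<and> f r = f p \<and> \<gamma> r = \<gamma> p"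
    unfolding r_def by (rule LeastI[of _ p]) (use assms in auto)
  moreover have "r \<le> x" if "x \<in> E" "f x = f r" "\<gamma> x = \<gamma> r" for x
    unfolding r_def by (rule Least_le) (use that r in auto)
  ultimately show ?thesis using that[of r] unfolding contract_def by blast
qed

lemma contract_blocked: "mono_blocks \<gamma> E \<Longrightarrow> blocked f \<gamma> (contract f \<gamma> E)"
  unfolding blocked_def using mono_blocks_mono[OF _ contract_subset]
  by (auto simp: contract_def intro: le_antisym)

lemma contract_image: "(\<lambda>p. (f p, \<gamma> p)) ` contract f \<gamma> E = (\<lambda>p. (f p, \<gamma> p)) ` E"
proof
  show "(\<lambda>p. (f p, \<gamma> p)) ` E \<subseteq> (\<lambda>p. (f p, \<gamma> p)) ` contract f \<gamma> E"
  proof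
    fix z assume "z \<in> (\<lambda>p. (f p, \<gamma> p)) ` E"
    then obtain p where p: "p \<in> E" "z = (f p, \<gamma> p)" by auto
    obtain r where "r \<in> contract f \<gamma> E" "f r = f p" "\<gamma> r = \<gamma> p"
      using contract_rep[OF p(1)] .
    then show "z \<in> (\<lambda>p. (f p, \<gamma> p)) ` contract f \<gamma> E" using p by (intro image_eqI[of _ _ r]) simp_all
  qed
qed (rule image_mono[OF contract_subset])

lemma contract_symbols: "f ` contract f \<gamma> E = f ` E"
proof -
  have "fst ` (\<lambda>p. (f p, \<gamma> p)) ` contract f \<gamma> E = fst ` (\<lambda>p. (f p, \<gamma> p)) ` E" by (simp only: contract_image)
  then show ?thesis by (simp add: image_image)
qed

lemma card_contract: "card (contract f \<gamma> E) = card ((\<lambda>p. (f p, \<gamma> p)) ` E)"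
proof -
  have "inj_on (\<lambda>p. (f p, \<gamma> p)) (contract f \<gamma> E)"
    by (rule inj_onI) (auto simp: contract_def intro: le_antisym)
  then have "card ((\<lambda>p. (f p, \<gamma> p)) ` contract f \<gamma> E) = card (contract f \<gamma> E)" by (rule card_image)
  then show ?thesis by (simp add: contract_image)
qed

section \<open>First, last and middle intervals\<close>

definition has_before :: "(nat \<Rightarrow> 'a) \<Rightarrow> (nat \<Rightarrow> nat) \<Rightarrow> nat set \<Rightarrow> nat \<Rightarrow> bool" where
  "has_before f \<gamma> E p \<longleftrightarrow> (\<exists>r\<in>E. f r = f p \<and> \<gamma> r < \<gamma> p)"

definition has_after :: "(nat \<Rightarrow> 'a) \<Rightarrow> (nat \<Rightarrow> nat) \<Rightarrow> nat set \<Rightarrow> nat \<Rightarrow> bool" where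
  "has_after f \<gamma> E p \<longleftrightarrow> (\<exists>r\<in>E. f r = f p \<and> \<gamma> p < \<gamma> r)"

definition locals :: "(nat \<Rightarrow> 'a) \<Rightarrow> (nat \<Rightarrow> nat) \<Rightarrow> nat set \<Rightarrow> nat set" where
  "locals f \<gamma> E = {p\<in>E. \<not> has_before f \<gamma> E p \<and> \<not> has_after f \<gamma> E p}"

definition firsts :: "(nat \<Rightarrow> 'a) \<Rightarrow> (nat \<Rightarrow> nat) \<Rightarrow> nat set \<Rightarrow> nat set" where
  "firsts f \<gamma> E = {p\<in>E. \<not> has_before f \<gamma> E p \<and> has_after f \<gamma> E p}"

definition lasts :: "(nat \<Rightarrow> 'a) \<Rightarrow> (nat \<Rightarrow> nat) \<Rightarrow> nat set \<Rightarrow> nat set" where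
  "lasts f \<gamma> E = {p\<in>E. has_before f \<gamma> E p \<and> \<not> has_after f \<gamma> E p}"

text \<open>Besides interval numbers, \<open>\<gamma>\<close> can also be the block function itself;
  the class then consists of the positions at which labels are used, neither in the first nor in the
  last block of their symbol.\<close>

definition middles :: "(nat \<Rightarrow> 'a) \<Rightarrow> (nat \<Rightarrow> nat) \<Rightarrow> nat set \<Rightarrow> nat set" where
  "middles f \<gamma> E = {p\<in>E. has_before f \<gamma> E p \<and> has_after f \<gamma> E p}"

definition globals :: "(nat \<Rightarrow> 'a) \<Rightarrow> (nat \<Rightarrow> nat) \<Rightarrow> nat set \<Rightarrow> nat set" where
  "globals f \<gamma> E = {p\<in>E. has_before f \<gamma> E p \<or> has_after f \<gamma> E p}"

lemmas class_defs = locals_def firsts_def lasts_def middles_def globals_def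

lemma class_subset:
  "locals f \<gamma> E \<subseteq> E" "firsts f \<gamma> E \<subseteq> E" "lasts f \<gamma> E \<subseteq> E" "middles f \<gamma> E \<subseteq> E" "globals f \<gamma> E \<subseteq> E"
  "firsts f \<gamma> E \<subseteq> globals f \<gamma> E" "lasts f \<gamma> E \<subseteq> globals f \<gamma> E" "middles f \<gamma> E \<subseteq> globals f \<gamma> E"
  by (auto simp: class_defs)

lemma class_Un: "E = locals f \<gamma> E \<union> (firsts f \<gamma> E \<union> (lasts f \<gamma> E \<union> middles f \<gamma> E))"
  by (auto simp: class_defs)

lemma globals_iff: "p \<in> globals f \<gamma> E \<longleftrightarrow> p \<in> E \<and> (\<exists>r\<in>E. f r = f p \<and> \<gamma> r \<noteq> \<gamma> p)"
  by (auto simp: globals_def has_before_def has_after_def neq_iff)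

lemma globals_symbol: "p \<in> globals f \<gamma> E \<Longrightarrow> r \<in> E \<Longrightarrow> f r = f p \<Longrightarrow> r \<in> globals f \<gamma> E"
  unfolding globals_iff by metis

lemma locals_symbol: "p \<in> locals f \<gamma> E \<Longrightarrow> r \<in> E \<Longrightarrow> f r = f p \<Longrightarrow> r \<in> locals f \<gamma> E \<and> \<gamma> r = \<gamma> p"
proof -
  assume a: "p \<in> locals f \<gamma> E" "r \<in> E" "f r = f p"
  then have "\<gamma> r = \<gamma> p"
    unfolding locals_def has_before_def has_after_def by (metis (mono_tags, lifting) linorder_neqE_nat mem_Collect_eq)
  then show ?thesis using a by (auto simp: locals_def has_before_def has_after_def)
qed

text \<open>A symbol is local or global as a whole. This additivity is why, in the recursions below,
  the factor of the locals is not added to that of the globals.\<close>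

lemma card_symbols_split:
  assumes "finite E"
  shows "card (f ` E) = card (f ` locals f \<gamma> E) + card (f ` globals f \<gamma> E)"
proof -
  have "f ` E = f ` locals f \<gamma> E \<union> f ` globals f \<gamma> E" by (auto simp: class_defs)
  moreover have "f ` locals f \<gamma> E \<inter> f ` globals f \<gamma> E = {}"
  proof -
    have False if pr: "p \<in> locals f \<gamma> E" "r \<in> globals f \<gamma> E" "f p = f r" for p r
    proof -
      have "r \<in> E" using pr(2) by (simp add: globals_def)
      then have "r \<in> locals f \<gamma> E" using locals_symbol[OF pr(1)] pr(3) by simp
      then show False using pr(2) by (simp add: class_defs)
    qed
    then show ?thesis by blast
  qed
  moreover have "finite (f ` locals f \<gamma> E)" "finite (f ` globals f \<gamma> E)"
    using assms class_subset(1,5)[of f \<gamma> E] by (auto intro: finite_subset)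
  ultimately show ?thesis by (simp add: card_Un_disjoint)
qed

lemma card_pairs_unique:
  assumes "\<And>p r. p \<in> C \<Longrightarrow> r \<in> C \<Longrightarrow> f p = f r \<Longrightarrow> \<gamma> p = \<gamma> r"
  shows "card ((\<lambda>p. (f p, \<gamma> p)) ` C) = card (f ` C)"
proof -
  have "inj_on fst ((\<lambda>p. (f p, \<gamma> p)) ` C)"
  proof (rule inj_onI)
    fix x y assume "x \<in> (\<lambda>p. (f p, \<gamma> p)) ` C" "y \<in> (\<lambda>p. (f p, \<gamma> p)) ` C" "fst x = fst y"
    then obtain p r where pr: "p \<in> C" "r \<in> C" "x = (f p, \<gamma> p)" "y = (f r, \<gamma> r)" "f p = f r" by auto
    from assms[OF pr(1,2,5)] show "x = y" using pr(3-5) by simp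
  qed
  then have "card (fst ` (\<lambda>p. (f p, \<gamma> p)) ` C) = card ((\<lambda>p. (f p, \<gamma> p)) ` C)" by (rule card_image)
  then show ?thesis by (simp add: image_image)
qed

lemma card_pairs_locals: "card ((\<lambda>p. (f p, \<gamma> p)) ` locals f \<gamma> E) = card (f ` locals f \<gamma> E)"
proof (rule card_pairs_unique)
  fix p r assume p: "p \<in> locals f \<gamma> E" and r: "r \<in> locals f \<gamma> E" and eq: "f p = f r"
  from r have "r \<in> E" by (simp add: locals_def)
  from locals_symbol[OF p this eq[symmetric]] show "\<gamma> p = \<gamma> r" by simp
qed

lemma card_pairs_firsts:
  assumes "finite E"
  shows "card ((\<lambda>p. (f p, \<gamma> p)) ` firsts f \<gamma> E) \<le> card (f ` globals f \<gamma> E)"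
proof -
  have "card ((\<lambda>p. (f p, \<gamma> p)) ` firsts f \<gamma> E) = card (f ` firsts f \<gamma> E)"
  proof (rule card_pairs_unique)
    fix p r assume "p \<in> firsts f \<gamma> E" "r \<in> firsts f \<gamma> E" "f p = f r"
    then have "\<not> \<gamma> p < \<gamma> r" "\<not> \<gamma> r < \<gamma> p" by (auto simp: firsts_def has_before_def)
    then show "\<gamma> p = \<gamma> r" by simp
  qed
  also have "\<dots> \<le> card (f ` globals f \<gamma> E)"
    using class_subset(5,6)[of f \<gamma> E] assms by (intro card_mono image_mono) (auto intro: finite_subset)
  finally show ?thesis .
qed

lemma card_pairs_lasts:
  assumes "finite E"
  shows "card ((\<lambda>p. (f p, \<gamma> p)) ` lasts f \<gamma> E) \<le> card (f ` globals f \<gamma> E)"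
proof -
  have "card ((\<lambda>p. (f p, \<gamma> p)) ` lasts f \<gamma> E) = card (f ` lasts f \<gamma> E)"
  proof (rule card_pairs_unique)
    fix p r assume "p \<in> lasts f \<gamma> E" "r \<in> lasts f \<gamma> E" "f p = f r"
    then have "\<not> \<gamma> p < \<gamma> r" "\<not> \<gamma> r < \<gamma> p" by (auto simp: lasts_def has_after_def)
    then show "\<gamma> p = \<gamma> r" by simp
  qed
  also have "\<dots> \<le> card (f ` globals f \<gamma> E)"
    using class_subset(5,7)[of f \<gamma> E] assms by (intro card_mono image_mono) (auto intro: finite_subset)
  finally show ?thesis .
qed

text \<open>A global symbol of its first interval recurs after the whole interval, which supplies
  one letter of the alternation from outside.\<close>

lemma alt_free_firsts:
  assumes "mono_blocks \<gamma> E" "alt_free f (Suc k) E" "2 \<le> k"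
  shows "alt_free f k {p\<in>firsts f \<gamma> E. \<gamma> p = q}"
proof (rule alt_free_after[OF assms(2) _ assms(3)])
  fix p assume "p \<in> {p \<in> firsts f \<gamma> E. \<gamma> p = q}"
  then obtain z where "z \<in> E" "f z = f p" "q < \<gamma> z" by (auto simp: firsts_def has_after_def)
  then show "\<exists>z\<in>E. f z = f p \<and> (\<forall>r\<in>{p \<in> firsts f \<gamma> E. \<gamma> p = q}. r < z)"
    using mono_blocksD[OF assms(1)] class_subset(2)[of f \<gamma> E] by (intro bexI[of _ z]) auto
qed (auto simp: class_defs)

lemma alt_free_lasts:
  assumes "mono_blocks \<gamma> E" "alt_free f (Suc k) E" "2 \<le> k"
  shows "alt_free f k {p\<in>lasts f \<gamma> E. \<gamma> p = q}"
proof (rule alt_free_before[OF assms(2) _ assms(3)])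
  fix p assume "p \<in> {p \<in> lasts f \<gamma> E. \<gamma> p = q}"
  then obtain z where "z \<in> E" "f z = f p" "\<gamma> z < q" by (auto simp: lasts_def has_before_def)
  then show "\<exists>z\<in>E. f z = f p \<and> (\<forall>r\<in>{p \<in> lasts f \<gamma> E. \<gamma> p = q}. z < r)"
    using mono_blocksD[OF assms(1)] class_subset(3)[of f \<gamma> E] by (intro bexI[of _ z]) auto
qed (auto simp: class_defs)

lemma alt_free_middles:
  assumes "mono_blocks \<gamma> E" "alt_free f (Suc (Suc k)) E" "2 \<le> k"
  shows "alt_free f k {p\<in>middles f \<gamma> E. \<gamma> p = q}" (is "alt_free f k ?M")
proof -
  \<comment> \<open>One letter is removed on each side. The later letter goes first, and the set has
    to retain the earlier occurrences, since these are used when the letter in front is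
    removed.\<close>
  let ?B = "?M \<union> {p\<in>E. \<gamma> p < q \<and> f p \<in> f ` ?M}"
  have sub: "?B \<subseteq> E" using class_subset(4)[of f \<gamma> E] by auto
  have "alt_free f (Suc k) ?B"
  proof (rule alt_free_after[OF assms(2) sub])
    fix p assume "p \<in> ?B"
    then have "f p \<in> f ` ?M" by auto
    then obtain p' where p': "f p = f p'" "p' \<in> ?M" by (rule imageE)
    then obtain z where z: "z \<in> E" "f z = f p" "q < \<gamma> z" by (auto simp: middles_def has_after_def)
    have "r < z" if "r \<in> ?B" for r
      using mono_blocksD[OF assms(1)] that z(1,3) sub by auto
    then show "\<exists>z\<in>E. f z = f p \<and> (\<forall>r\<in>?B. r < z)" using z by blast
  qed (use assms(3) in simp)
  then show ?thesis
  proof (rule alt_free_before[OF _ _ assms(3)])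
    fix p assume p: "p \<in> ?M"
    then obtain z where z: "z \<in> E" "f z = f p" "\<gamma> z < q" by (auto simp: middles_def has_before_def)
    have "z < r" if "r \<in> ?M" for r
      using mono_blocksD[OF assms(1)] that z(1,3) sub by auto
    moreover have "z \<in> ?B" using z p by auto
    ultimately show "\<exists>z\<in>?B. f z = f p \<and> (\<forall>r\<in>?M. z < r)" using z by blast
  qed auto
qed

section \<open>The recursion for the length\<close>

text \<open>Numbers of blocks are compared with \<open>8 ^ ack_exp i j\<close>. The interval length in row \<open>Suc i\<close> and
  column \<open>Suc j\<close> is \<open>w = 8 ^ k\<close> with \<open>k = ack_exp (Suc i) j\<close>, and the contraction is bounded in row
  \<open>i\<close> and column \<open>k\<close>: the error term \<open>8 ^ k\<close> per interval then is \<open>1\<close> per block.\<close>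

fun ack_exp :: "nat \<Rightarrow> nat \<Rightarrow> nat" where
  "ack_exp 0 j = 1"
| "ack_exp (Suc i) 0 = 1"
| "ack_exp (Suc i) (Suc j) = ack_exp (Suc i) j + ack_exp i (ack_exp (Suc i) j)"

text \<open>The symbol function \<open>f\<close> stays fixed: all recursive calls concern subsets of
  positions, with only the block function changing.\<close>

definition size_bound :: "(nat \<Rightarrow> 'a) \<Rightarrow> nat \<Rightarrow> nat \<Rightarrow> nat \<Rightarrow> nat \<Rightarrow> bool" where
  "size_bound f k \<mu> c m \<longleftrightarrow> (\<forall>E \<beta>. finite E \<longrightarrow> blocked f \<beta> E \<longrightarrow> alt_free f k E \<longrightarrow> \<beta> ` E \<subseteq> {..<m}
     \<longrightarrow> card E \<le> \<mu> * card (f ` E) + c)"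

lemma size_boundD:
  "size_bound f k \<mu> c m \<Longrightarrow> finite E \<Longrightarrow> blocked f \<beta> E \<Longrightarrow> alt_free f k E \<Longrightarrow> \<beta> ` E \<subseteq> {..<m}
     \<Longrightarrow> card E \<le> \<mu> * card (f ` E) + c"
  unfolding size_bound_def by simp

lemma size_bound_weaken:
  assumes "size_bound f k \<mu> c m" "\<mu> \<le> \<mu>'" "c \<le> c'" "m' \<le> m"
  shows "size_bound f k \<mu>' c' m'"
  unfolding size_bound_def
proof (intro allI impI)
  fix E \<beta> assume "finite E" "blocked f \<beta> E" "alt_free f k E" "\<beta> ` E \<subseteq> {..<m'}"
  then have "card E \<le> \<mu> * card (f ` E) + c"
    by (intro size_boundD[OF assms(1)]) (use assms(4) in auto)
  also have "\<dots> \<le> \<mu>' * card (f ` E) + c'" using assms by (intro add_mono mult_right_mono) auto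
  finally show "card E \<le> \<mu>' * card (f ` E) + c'" .
qed

lemma size_bound_3: "size_bound f 3 1 m m"
  unfolding size_bound_def using card_le_alt_free_3 by (metis mult_1)

lemma size_bound_4: "size_bound f 4 2 m m"
  unfolding size_bound_def using card_le_alt_free_4 by metis

lemma size_bound_trivial: "size_bound f k m 0 m"
  unfolding size_bound_def
proof (intro allI impI)
  fix E \<beta> assume E: "finite E" "blocked f \<beta> E" "\<beta> ` E \<subseteq> {..<m}"
  have "inj_on (\<lambda>p. (\<beta> p, f p)) E"
    by (rule inj_onI) (use E(2) in \<open>auto simp: blocked_def\<close>)
  then have "card E \<le> card ({..<m} \<times> f ` E)"
    using E by (intro card_inj_on_le[where f = "\<lambda>p. (\<beta> p, f p)"]) auto
  then show "card E \<le> m * card (f ` E) + 0" by (simp add: card_cartesian_product)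
qed

lemma mono_blocks_div: "mono_blocks \<beta> E \<Longrightarrow> mono_blocks (\<lambda>p. \<beta> p div w) E"
  unfolding mono_blocks_def by (simp add: div_le_mono)

text \<open>Within interval \<open>q\<close> the remainder differs from the block number by a
  constant, so it renumbers the blocks of the interval from 0.\<close>

lemma blocked_mod:
  assumes "blocked f \<beta> E" "\<And>p. p \<in> E \<Longrightarrow> \<beta> p div w = q"
  shows "blocked f (\<lambda>p. \<beta> p mod w) E"
proof -
  have "\<beta> p = w * q + \<beta> p mod w" if "p \<in> E" for p using assms(2)[OF that] by (metis mult_div_mod_eq)
  then show ?thesis using assms(1) unfolding blocked_def mono_blocks_def
    by (metis nat_add_left_cancel_le)
qed

lemma image_div_subset:
  assumes "\<beta> ` E \<subseteq> {..<w * M}" "0 < w"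
  shows "(\<lambda>p. \<beta> p div w) ` E \<subseteq> {..<(M::nat)}"
proof
  fix x assume "x \<in> (\<lambda>p. \<beta> p div w) ` E"
  then obtain p where "x = \<beta> p div w" "p \<in> E" by blast
  moreover from this have "\<beta> p < M * w" using assms(1) by (auto simp: mult.commute)
  ultimately show "x \<in> {..<M}" using assms(2) by (simp add: less_mult_imp_div_less)
qed

section \<open>One step of the recursion\<close>

lemma size_bound_intervals:
  fixes \<beta> :: "nat \<Rightarrow> nat"
  assumes "size_bound f k \<mu> c w" "finite E" "blocked f \<beta> E" "\<beta> ` E \<subseteq> {..<w * M}" "0 < w" "C \<subseteq> E"
    and "\<And>q. alt_free f k {p\<in>C. \<beta> p div w = q}"
  shows "card C \<le> \<mu> * card ((\<lambda>p. (f p, \<beta> p div w)) ` C) + M * c"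
proof -
  have fin: "finite C" using assms(2,6) finite_subset by blast
  have "card C \<le> \<mu> * card ((\<lambda>p. (f p, \<beta> p div w)) ` C) + (\<Sum>q<M. c)"
  proof (rule card_interval_sum[OF fin])
    show "(\<lambda>p. \<beta> p div w) ` C \<subseteq> {..<M}"
      using image_div_subset[OF assms(4,5)] assms(6) by blast
    fix q
    show "card {p\<in>C. \<beta> p div w = q} \<le> \<mu> * card (f ` {p\<in>C. \<beta> p div w = q}) + c"
    proof (rule size_boundD[OF assms(1)])
      show "blocked f (\<lambda>p. \<beta> p mod w) {p\<in>C. \<beta> p div w = q}"
        by (rule blocked_mod[OF blocked_mono[OF assms(3)]]) (use assms(6) in auto)
    qed (use fin assms(5,7) in auto)
  qed
  then show ?thesis by simp
qed

lemma card_pairs_globals: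
  assumes "size_bound f k \<mu> c M" "finite E" "mono_blocks \<gamma> E" "alt_free f k E" "\<gamma> ` E \<subseteq> {..<M}"
  shows "card ((\<lambda>p. (f p, \<gamma> p)) ` globals f \<gamma> E) \<le> \<mu> * card (f ` globals f \<gamma> E) + c"
proof -
  let ?D = "contract f \<gamma> (globals f \<gamma> E)"
  have sub: "?D \<subseteq> E" "globals f \<gamma> E \<subseteq> E"
    using contract_subset[of f \<gamma> "globals f \<gamma> E"] class_subset(5)[of f \<gamma> E] by auto
  have "card ?D \<le> \<mu> * card (f ` ?D) + c"
  proof (rule size_boundD[OF assms(1)])
    show "blocked f \<gamma> ?D" by (rule contract_blocked[OF mono_blocks_mono[OF assms(3) sub(2)]])
    show "alt_free f k ?D" by (rule alt_free_mono[OF assms(4) sub(1)])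
    show "\<gamma> ` ?D \<subseteq> {..<M}" using assms(5) sub(1) by blast
    show "finite ?D" using assms(2) sub(1) finite_subset by blast
  qed
  then show ?thesis by (simp add: card_contract contract_symbols)
qed

lemma size_bound_classes:
  fixes \<beta> :: "nat \<Rightarrow> nat"
  assumes E: "finite E" "blocked f \<beta> E" "alt_free f (Suc (Suc k)) E" "\<beta> ` E \<subseteq> {..<w * M}"
    and "0 < w" "2 \<le> k"
    and loc: "size_bound f (Suc (Suc k)) \<mu>l cl w"
    and fst: "size_bound f (Suc k) \<mu>f cf w"
  shows "card (locals f (\<lambda>p. \<beta> p div w) E) \<le> \<mu>l * card (f ` locals f (\<lambda>p. \<beta> p div w) E) + M * cl"
    and "card (firsts f (\<lambda>p. \<beta> p div w) E) \<le> \<mu>f * card (f ` globals f (\<lambda>p. \<beta> p div w) E) + M * cf"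
    and "card (lasts f (\<lambda>p. \<beta> p div w) E) \<le> \<mu>f * card (f ` globals f (\<lambda>p. \<beta> p div w) E) + M * cf"
proof -
  let ?\<gamma> = "\<lambda>p. \<beta> p div w"
  have mono: "mono_blocks ?\<gamma> E" using E(2) mono_blocks_div unfolding blocked_def by blast
  have "card (locals f ?\<gamma> E) \<le> \<mu>l * card ((\<lambda>p. (f p, ?\<gamma> p)) ` locals f ?\<gamma> E) + M * cl"
    by (rule size_bound_intervals[OF loc E(1,2,4) \<open>0 < w\<close> class_subset(1)])
      (rule alt_free_mono[OF E(3)], auto simp: locals_def)
  then show "card (locals f ?\<gamma> E) \<le> \<mu>l * card (f ` locals f ?\<gamma> E) + M * cl"
    unfolding card_pairs_locals[of f ?\<gamma> E] .
  have "card (firsts f ?\<gamma> E) \<le> \<mu>f * card ((\<lambda>p. (f p, ?\<gamma> p)) ` firsts f ?\<gamma> E) + M * cf"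
    by (rule size_bound_intervals[OF fst E(1,2,4) \<open>0 < w\<close> class_subset(2)])
      (rule alt_free_firsts[OF mono E(3)], use \<open>2 \<le> k\<close> in simp)
  also have "\<dots> \<le> \<mu>f * card (f ` globals f ?\<gamma> E) + M * cf"
    using card_pairs_firsts[OF E(1), of f ?\<gamma>] by simp
  finally show "card (firsts f ?\<gamma> E) \<le> \<mu>f * card (f ` globals f ?\<gamma> E) + M * cf" .
  have "card (lasts f ?\<gamma> E) \<le> \<mu>f * card ((\<lambda>p. (f p, ?\<gamma> p)) ` lasts f ?\<gamma> E) + M * cf"
    by (rule size_bound_intervals[OF fst E(1,2,4) \<open>0 < w\<close> class_subset(3)])
      (rule alt_free_lasts[OF mono E(3)], use \<open>2 \<le> k\<close> in simp)
  also have "\<dots> \<le> \<mu>f * card (f ` globals f ?\<gamma> E) + M * cf"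
    using card_pairs_lasts[OF E(1), of f ?\<gamma>] by simp
  finally show "card (lasts f ?\<gamma> E) \<le> \<mu>f * card (f ` globals f ?\<gamma> E) + M * cf" .
qed

lemma card_classes_le:
  "card E \<le> card (locals f \<gamma> E) + card (firsts f \<gamma> E) + card (lasts f \<gamma> E) + card (middles f \<gamma> E)"
proof -
  have "card E \<le> card (locals f \<gamma> E) + card (firsts f \<gamma> E \<union> (lasts f \<gamma> E \<union> middles f \<gamma> E))"
    by (subst class_Un[of E f \<gamma>]) (rule card_Un_le)
  moreover have "card (firsts f \<gamma> E \<union> (lasts f \<gamma> E \<union> middles f \<gamma> E)) \<le> card (firsts f \<gamma> E) + card (lasts f \<gamma> E \<union> middles f \<gamma> E)"
    by (rule card_Un_le)
  moreover have "card (lasts f \<gamma> E \<union> middles f \<gamma> E) \<le> card (lasts f \<gamma> E) + card (middles f \<gamma> E)"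
    by (rule card_Un_le)
  ultimately show ?thesis by linarith
qed

text \<open>Up to additive errors: only middles multiply factors, as a global symbol has about
  \<open>\<mu>c\<close> incidences and each expands by \<open>\<mu>m\<close>, whereas the firsts and
  the lasts of a symbol lie in one interval each. Since locals and globals have disjoint symbols,
  \<open>\<mu>\<close> has to dominate each factor, not their sum.\<close>

lemma size_bound_rec:
  assumes loc: "size_bound f (Suc (Suc k)) \<mu> cl w"
    and fst: "size_bound f (Suc k) \<mu>f cf w"
    and mid: "size_bound f k \<mu>m cm w"
    and ctr: "size_bound f (Suc (Suc k)) \<mu>c cc M"
    and "2 * \<mu>f + \<mu>m * \<mu>c \<le> \<mu>" "2 \<le> k" "0 < w"
  shows "size_bound f (Suc (Suc k)) \<mu> (M * (cl + 2 * cf + cm) + \<mu>m * cc) (w * M)"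
  unfolding size_bound_def
proof (intro allI impI)
  fix E \<beta> assume E: "finite E" "blocked f \<beta> E" "alt_free f (Suc (Suc k)) E" "\<beta> ` E \<subseteq> {..<w * M}"
  let ?\<gamma> = "\<lambda>p. \<beta> p div w"
  let ?G = "card (f ` globals f ?\<gamma> E)" and ?L = "card (f ` locals f ?\<gamma> E)"
  have mono: "mono_blocks ?\<gamma> E" using E(2) mono_blocks_div unfolding blocked_def by blast
  note cls = size_bound_classes[OF E \<open>0 < w\<close> \<open>2 \<le> k\<close> loc fst]
  have "card (middles f ?\<gamma> E) \<le> \<mu>m * card ((\<lambda>p. (f p, ?\<gamma> p)) ` middles f ?\<gamma> E) + M * cm"
    by (rule size_bound_intervals[OF mid E(1,2,4) \<open>0 < w\<close> class_subset(4)])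
      (rule alt_free_middles[OF mono E(3) \<open>2 \<le> k\<close>])
  also have "card ((\<lambda>p. (f p, ?\<gamma> p)) ` middles f ?\<gamma> E) \<le> card ((\<lambda>p. (f p, ?\<gamma> p)) ` globals f ?\<gamma> E)"
    using class_subset(5,8)[of f ?\<gamma> E] E(1) by (intro card_mono image_mono) (auto intro: finite_subset)
  also have "\<dots> \<le> \<mu>c * ?G + cc"
    by (rule card_pairs_globals[OF ctr E(1) mono E(3) image_div_subset[OF E(4) \<open>0 < w\<close>]])
  finally have "card (middles f ?\<gamma> E) \<le> \<mu>m * (\<mu>c * ?G + cc) + M * cm" by simp
  with cls card_classes_le[of E f ?\<gamma>]
  have "card E \<le> (\<mu> * ?L + M * cl) + (\<mu>f * ?G + M * cf) + (\<mu>f * ?G + M * cf) + (\<mu>m * (\<mu>c * ?G + cc) + M * cm)"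
    by linarith
  also have "\<dots> = \<mu> * ?L + (2 * \<mu>f + \<mu>m * \<mu>c) * ?G + (M * (cl + 2 * cf + cm) + \<mu>m * cc)"
    by (simp add: algebra_simps)
  also have "\<dots> \<le> \<mu> * ?L + \<mu> * ?G + (M * (cl + 2 * cf + cm) + \<mu>m * cc)"
    using assms(5) by (intro add_mono mult_right_mono) auto
  also have "\<dots> = \<mu> * card (f ` E) + (M * (cl + 2 * cf + cm) + \<mu>m * cc)"
    unfolding card_symbols_split[OF E(1), of f ?\<gamma>] by (simp add: algebra_simps)
  finally show "card E \<le> \<mu> * card (f ` E) + (M * (cl + 2 * cf + cm) + \<mu>m * cc)" .
qed

text \<open>\<open>M\<close> is \<open>m\<close> divided by \<open>w\<close>, rounded up; because of
  \<open>w \<le> m\<close> the rounding at most doubles the number of blocks.\<close>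

lemma obtain_intervals:
  assumes "0 < w" "w \<le> m" "m \<le> w * B"
  obtains M :: nat where "m \<le> w * M" "w * M \<le> 2 * m" "M \<le> B"
proof
  define M where "M = (m + (w - 1)) div w"
  have "m + (w - 1) < w * M + w"
    unfolding M_def using assms(1) by (metis add.commute div_mult_mod_eq mod_less_divisor mult.commute nat_add_left_cancel_less)
  then show "m \<le> w * M" by simp
  have "w * M \<le> m + (w - 1)" unfolding M_def by simp
  then show "w * M \<le> 2 * m" using assms(2) by simp
  have "w * M < w * (B + 1)" using \<open>w * M \<le> m + (w - 1)\<close> assms by simp
  then have "M < B + 1" by (simp only: nat_mult_less_cancel_disj)
  then show "M \<le> B" by simp
qed

text \<open>Origin of the base 8: the error has three parts of at most \<open>\<mu> * 8 ^ j\<close>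
  per block, from the locals, from the sides together with the contraction, and from the middles.
  Rounding doubles them, and 6 is at most 8.\<close>

lemma size_bound_step:
  assumes loc: "size_bound f (Suc (Suc k)) \<mu> (\<mu> * 8 ^ j * w) w"
    and fst: "size_bound f (Suc k) \<mu>f (\<mu>f * 8 ^ j * w) w"
    and mid: "size_bound f k \<mu>m w w"
    and ctr: "\<And>M. M \<le> B \<Longrightarrow> size_bound f (Suc (Suc k)) \<mu>c (\<mu>c * w * M) M"
    and "2 * \<mu>f + \<mu>m * \<mu>c \<le> \<mu>" "2 \<le> k" "0 < w" "w \<le> m" "m \<le> w * B" "1 \<le> \<mu>"
  shows "size_bound f (Suc (Suc k)) \<mu> (\<mu> * 8 ^ Suc j * m) m"
proof -
  obtain M where M: "m \<le> w * M" "w * M \<le> 2 * m" "M \<le> B"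
    using obtain_intervals assms by metis
  define c where "c = M * (\<mu> * 8 ^ j * w + 2 * (\<mu>f * 8 ^ j * w) + w) + \<mu>m * (\<mu>c * w * M)"
  have one: "1 \<le> (8::nat) ^ j" by simp
  have "c = (\<mu> * 8 ^ j + 2 * \<mu>f * 8 ^ j + 1 + \<mu>m * \<mu>c) * (w * M)"
    by (simp add: c_def algebra_simps)
  also have "\<dots> \<le> (\<mu> * 8 ^ j + 2 * \<mu>f * 8 ^ j + \<mu> * 8 ^ j + \<mu>m * \<mu>c * 8 ^ j) * (2 * m)"
  proof (rule mult_le_mono[OF _ M(2)])
    have "1 \<le> \<mu> * 8 ^ j" "\<mu>m * \<mu>c * 1 \<le> \<mu>m * \<mu>c * 8 ^ j"
      using mult_le_mono[OF assms(10) one] mult_le_mono2[OF one] by simp_all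
    then show "\<mu> * 8 ^ j + 2 * \<mu>f * 8 ^ j + 1 + \<mu>m * \<mu>c
        \<le> \<mu> * 8 ^ j + 2 * \<mu>f * 8 ^ j + \<mu> * 8 ^ j + \<mu>m * \<mu>c * 8 ^ j" by linarith
  qed
  also have "\<dots> = (\<mu> + (2 * \<mu>f + \<mu>m * \<mu>c) + \<mu>) * (8 ^ j * 2 * m)" by (simp add: algebra_simps)
  also have "\<dots> \<le> (\<mu> + \<mu> + \<mu>) * (8 ^ j * 2 * m)"
    using assms(5) by (intro mult_right_mono add_mono) auto
  also have "\<dots> \<le> \<mu> * 8 ^ Suc j * m" by (simp add: algebra_simps)
  finally have c: "c \<le> \<mu> * 8 ^ Suc j * m" .
  have "size_bound f (Suc (Suc k)) \<mu> c (w * M)"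
    unfolding c_def by (rule size_bound_rec[OF loc fst mid ctr[OF M(3)] assms(5-7)])
  then show ?thesis by (rule size_bound_weaken) (use c M in auto)
qed

text \<open>In row 0 and in column 0 there are at most 8 blocks, and the trivial bound has factor 8,
  whence \<open>base\<close>. The factor \<open>\<mu>m\<close> is the same in all rows: 1 leads to
  linear growth of \<open>\<mu>\<close>, 2 to doubling.\<close>

lemma size_bound_ack_induct:
  assumes base: "\<And>i. 8 \<le> \<mu> i"
    and step: "\<And>i. 2 * \<mu>f (Suc i) + \<mu>m * \<mu> i \<le> \<mu> (Suc i)"
    and fst: "\<And>i j m. m \<le> 8 ^ ack_exp i j \<Longrightarrow> size_bound f (Suc k) (\<mu>f i) (\<mu>f i * 8 ^ j * m) m"
    and mid: "\<And>m. size_bound f k \<mu>m m m" and k: "2 \<le> k"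
  shows "m \<le> 8 ^ ack_exp i j \<Longrightarrow> size_bound f (Suc (Suc k)) (\<mu> i) (\<mu> i * 8 ^ j * m) m"
proof (induction i j arbitrary: m rule: ack_exp.induct)
  case (1 j)
  then show ?case using base[of 0] by (intro size_bound_weaken[OF size_bound_trivial[of f _ m]]) auto
next
  case (2 i)
  then show ?case using base[of "Suc i"] by (intro size_bound_weaken[OF size_bound_trivial[of f _ m]]) auto
next
  case (3 i j)
  define w :: nat where "w = 8 ^ ack_exp (Suc i) j"
  have IH1: "size_bound f (Suc (Suc k)) (\<mu> (Suc i)) (\<mu> (Suc i) * 8 ^ j * m) m" if "m \<le> w" for m
    using 3(1) that unfolding w_def by blast
  show ?case
  proof (cases "m \<le> w")
    case True
    then show ?thesis by (intro size_bound_weaken[OF IH1[OF True]]) auto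
  next
    case False
    show ?thesis
    proof (rule size_bound_step[OF IH1 fst mid _ step k])
      show "w \<le> w" ..
      show "w \<le> 8 ^ ack_exp (Suc i) j" by (simp add: w_def)
      show "m \<le> w * 8 ^ ack_exp i (ack_exp (Suc i) j)" using 3(4) by (simp add: w_def power_add)
      show "size_bound f (Suc (Suc k)) (\<mu> i) (\<mu> i * w * M) M"
        if "M \<le> 8 ^ ack_exp i (ack_exp (Suc i) j)" for M
        using 3(3)[OF that] by (simp add: w_def mult.assoc)
      show "1 \<le> \<mu> (Suc i)" using base[of "Suc i"] by simp
    qed (use False in \<open>auto simp: w_def\<close>)
  qed
qed

section \<open>Factors for alternations of length 5 and 6\<close>

text \<open>The digit in \<open>mu3\<close>, \<open>mu4\<close>, \<open>mu5\<close> is the forbidden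
  length minus 2. The slope 4 is the factor 2 of \<open>size_bound_4\<close>, once for each of the
  two sides.\<close>

fun mu3 :: "nat \<Rightarrow> nat" where "mu3 i = 4 * i + 8"

fun mu4 :: "nat \<Rightarrow> nat" where
  "mu4 0 = 8"
| "mu4 (Suc i) = 2 * mu4 i + 2 * mu3 (Suc i)"

lemma size_bound_5:
  assumes "m \<le> 8 ^ ack_exp i j"
  shows "size_bound f 5 (mu3 i) (mu3 i * 8 ^ j * m) m"
proof -
  have "size_bound f (Suc (Suc 3)) (mu3 i) (mu3 i * 8 ^ j * m) m"
  proof (rule size_bound_ack_induct[where \<mu>f = "\<lambda>_. 2" and \<mu>m = 1, OF _ _ _ _ _ assms])
    show "size_bound f (Suc 3) 2 (2 * 8 ^ j * m) m" for j m
      using size_bound_weaken[OF size_bound_4[of f m], of 2 "2 * 8 ^ j * m" m] by simp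
  qed (use size_bound_3[of f] in auto)
  then show ?thesis by (simp add: eval_nat_numeral)
qed

lemma size_bound_6:
  assumes "m \<le> 8 ^ ack_exp i j"
  shows "size_bound f 6 (mu4 i) (mu4 i * 8 ^ j * m) m"
proof -
  have "8 \<le> mu4 i" for i by (induction i) auto
  then have "size_bound f (Suc (Suc 4)) (mu4 i) (mu4 i * 8 ^ j * m) m"
    by (intro size_bound_ack_induct[where \<mu>f = mu3 and \<mu>m = 2, OF _ _ _ _ _ assms])
      (use size_bound_5 size_bound_4 in auto)
  then show ?thesis by (simp add: eval_nat_numeral)
qed

section \<open>Labels\<close>

text \<open>The argument \<open>X\<close> is the set of blocks in which a symbol occurs and \<open>u \<in> X\<close> is neither its
  minimum nor its maximum. Of the occurrences to which an unlabelled incidence (a tip) expands,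
  one remains a tip: the last one for \<open>DoveTip\<close>, the first one for \<open>HawkTip\<close>. New tips
  arise as the last occurrence in the first interval and the first occurrence in the last one.\<close>

datatype label = Dove | Hawk | DoveTip | HawkTip

fun lab :: "nat \<Rightarrow> nat \<Rightarrow> nat set \<Rightarrow> nat \<Rightarrow> label" where
  "lab 0 j X u = DoveTip"
| "lab (Suc i) 0 X u = DoveTip"
| "lab (Suc i) (Suc j) X u =
    (let k = ack_exp (Suc i) j; w = 8 ^ k; q = u div w; Y = {x\<in>X. x div w = q} in
     if (\<exists>x\<in>X. x div w < q) \<and> (\<exists>x\<in>X. q < x div w) then
       (case lab i k ((\<lambda>x. x div w) ` X) q of
          Dove \<Rightarrow> Dove
        | Hawk \<Rightarrow> Hawk
        | DoveTip \<Rightarrow> (if \<exists>y\<in>Y. u < y then Dove else DoveTip)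
        | HawkTip \<Rightarrow> (if \<exists>y\<in>Y. y < u then Hawk else HawkTip))
     else if \<not> (\<exists>y\<in>Y. u < y) then DoveTip
     else if \<not> (\<exists>y\<in>Y. y < u) then HawkTip
     else lab (Suc i) j ((\<lambda>x. x mod w) ` Y) (u mod w))"

definition sep :: "nat \<Rightarrow> nat set \<Rightarrow> nat set \<Rightarrow> bool" where
  "sep u X Y \<longleftrightarrow> (\<exists>x\<in>X. \<exists>y\<in>Y. x < y \<and> y < u \<or> u < x \<and> x < y)"

text \<open>The tip clauses mirror each other. A tip that turns into a \<open>Dove\<close> has a
  later occurrence in its interval, so it precedes the other symbol after \<open>u\<close>; one that
  turns into a \<open>Hawk\<close> has an earlier occurrence, so it follows the other symbol before
  \<open>u\<close>. Each clause demands the order that is then still missing.\<close>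

definition compat :: "label \<Rightarrow> label \<Rightarrow> nat \<Rightarrow> nat set \<Rightarrow> nat set \<Rightarrow> bool" where
  "compat l l' u X Y \<longleftrightarrow>
     (l = Dove \<and> (l' = Dove \<or> l' = DoveTip) \<or> l = Hawk \<and> l' = Hawk \<longrightarrow> sep u X Y) \<and>
     (l = Hawk \<and> l' = HawkTip \<longrightarrow> sep u Y X)"

lemma div_less_imp_less: "x div w < y div w \<Longrightarrow> x < (y::nat)"
  by (metis div_le_mono not_less)

lemma sep_div:
  assumes "sep (u div w) ((\<lambda>x. x div w) ` X) ((\<lambda>x. x div w) ` Y)"
  shows "sep u X Y"
proof -
  obtain x y where "x \<in> X" "y \<in> Y"
    "x div w < y div w \<and> y div w < u div w \<or> u div w < x div w \<and> x div w < y div w"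
    using assms unfolding sep_def by auto
  then show ?thesis unfolding sep_def using div_less_imp_less by metis
qed

lemma mod_less_imp_less: "x div w = y div w \<Longrightarrow> x mod w < y mod w \<Longrightarrow> x < (y::nat)"
  by (metis mult_div_mod_eq nat_add_left_cancel_less)

lemma sep_mod:
  assumes "sep (u mod w) ((\<lambda>x. x mod w) ` {x\<in>X. x div w = u div w}) ((\<lambda>x. x mod w) ` {x\<in>Y. x div w = u div w})"
  shows "sep u X Y"
proof -
  obtain x y where xy: "x \<in> X" "y \<in> Y" "x div w = u div w" "y div w = u div w"
    "x mod w < y mod w \<and> y mod w < u mod w \<or> u mod w < x mod w \<and> x mod w < y mod w"
    using assms unfolding sep_def by auto
  then have "x < y \<and> y < u \<or> u < x \<and> x < y" using mod_less_imp_less by metis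
  then show ?thesis unfolding sep_def using xy(1,2) by blast
qed

text \<open>The clauses of \<^const>\<open>compat\<close> about tips are what makes the induction work: they are needed
  for those occurrences of a tip that become labelled when it is expanded.\<close>

lemma compat_lab:
  "u \<in> X \<Longrightarrow> u \<in> Y \<Longrightarrow> \<exists>x\<in>X. x < u \<Longrightarrow> \<exists>x\<in>X. u < x \<Longrightarrow> \<exists>y\<in>Y. y < u \<Longrightarrow> \<exists>y\<in>Y. u < y
   \<Longrightarrow> compat (lab i j X u) (lab i j Y u) u X Y"
proof (induction i j arbitrary: X Y u rule: ack_exp.induct)
  case (3 i j)
  define k where "k = ack_exp (Suc i) j"
  define w :: nat where "w = 8 ^ k"
  define q where "q = u div w"
  define S where "S X = {x\<in>X. x div w = q}" for X
  define mid where "mid X \<longleftrightarrow> (\<exists>x\<in>X. x div w < q) \<and> (\<exists>x\<in>X. q < x div w)" for X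
  define up where "up X \<longleftrightarrow> (\<exists>y\<in>S X. u < y)" for X
  define dn where "dn X \<longleftrightarrow> (\<exists>y\<in>S X. y < u)" for X
  have lab: "lab (Suc i) (Suc j) X u =
    (if mid X then
       (case lab i k ((\<lambda>x. x div w) ` X) q of
          Dove \<Rightarrow> Dove
        | Hawk \<Rightarrow> Hawk
        | DoveTip \<Rightarrow> (if up X then Dove else DoveTip)
        | HawkTip \<Rightarrow> (if dn X then Hawk else HawkTip))
     else if \<not> up X then DoveTip
     else if \<not> dn X then HawkTip
     else lab (Suc i) j ((\<lambda>x. x mod w) ` S X) (u mod w))" for X
    unfolding lab.simps Let_def mid_def up_def dn_def S_def q_def w_def k_def by (rule refl)
  have lt: "x div w < y div w \<Longrightarrow> x < y" for x y by (rule div_less_imp_less)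
  have low: "\<exists>x\<in>X. x div w < q" if "\<exists>x\<in>X. x < u" "\<not> dn X" for X
  proof -
    note h = that
    obtain x where "x \<in> X" "x < u" using h(1) by blast
    moreover from this have "x div w \<le> q" unfolding q_def by (simp add: div_le_mono)
    ultimately show ?thesis using h(2) unfolding dn_def S_def by force
  qed
  have high: "\<exists>x\<in>X. q < x div w" if "\<exists>x\<in>X. u < x" "\<not> up X" for X
  proof -
    note h = that
    obtain x where "x \<in> X" "u < x" using h(1) by blast
    moreover from this have "q \<le> x div w" unfolding q_def by (simp add: div_le_mono)
    ultimately show ?thesis using h(2) unfolding up_def S_def by force
  qed
  \<comment> \<open>\<open>F1\<close> and \<open>F2\<close> supply every separation that is not
    inherited: one of the two blocks lies in the interval of \<open>u\<close>, the other in a later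
    or an earlier interval.\<close>
  have F1: "sep u X Y" if up: "up X" and hi: "\<exists>y\<in>Y. q < y div w" for X Y
  proof -
    obtain x where x: "x \<in> X" "x div w = q" "u < x" using up unfolding up_def S_def by blast
    obtain y where y: "y \<in> Y" "q < y div w" using hi by blast
    have "x < y" using lt[of x y] x y by simp
    then show ?thesis using x y unfolding sep_def by blast
  qed
  have F2: "sep u X Y" if dn: "dn Y" and lo: "\<exists>x\<in>X. x div w < q" for X Y
  proof -
    obtain y where y: "y \<in> Y" "y div w = q" "y < u" using dn unfolding dn_def S_def by blast
    obtain x where x: "x \<in> X" "x div w < q" using lo by blast
    have "x < y" using lt[of x y] x y by simp
    then show ?thesis using x y unfolding sep_def by blast
  qed
  have u: "u \<in> S X" "u \<in> S Y" using 3 unfolding S_def q_def by auto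
  consider (mm) "mid X" "mid Y" | (mn) "mid X" "\<not> mid Y" | (nm) "\<not> mid X" "mid Y" | (nn) "\<not> mid X" "\<not> mid Y"
    by blast
  then show ?case
  proof cases
    case mm
    have IH: "compat (lab i k ((\<lambda>x. x div w) ` X) q) (lab i k ((\<lambda>x. x div w) ` Y) q) q
        ((\<lambda>x. x div w) ` X) ((\<lambda>x. x div w) ` Y)"
      unfolding k_def by (rule 3(3)) (use 3 mm in \<open>auto simp: mid_def q_def\<close>)
    \<comment> \<open>\<open>compat\<close> is not symmetric. The swapped hypothesis is for a
      \<open>HawkTip\<close> of \<open>X\<close> that turns into a \<open>Hawk\<close> beside an
      inherited \<open>Hawk\<close> of \<open>Y\<close>.\<close>
    have IH': "compat (lab i k ((\<lambda>x. x div w) ` Y) q) (lab i k ((\<lambda>x. x div w) ` X) q) q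
        ((\<lambda>x. x div w) ` Y) ((\<lambda>x. x div w) ` X)"
      unfolding k_def by (rule 3(3)) (use 3 mm in \<open>auto simp: mid_def q_def\<close>)
    have 1: "sep q ((\<lambda>x. x div w) ` X) ((\<lambda>x. x div w) ` Y) \<Longrightarrow> sep u X Y"
      and 2: "sep q ((\<lambda>x. x div w) ` Y) ((\<lambda>x. x div w) ` X) \<Longrightarrow> sep u Y X"
      unfolding q_def by (rule sep_div, assumption)+
    have 3: "up X \<Longrightarrow> sep u X Y" "dn Y \<Longrightarrow> sep u X Y" "up Y \<Longrightarrow> sep u Y X" "dn X \<Longrightarrow> sep u Y X"
      using mm F1[of X Y] F2[of Y X] F1[of Y X] F2[of X Y] unfolding mid_def by blast+
    show ?thesis using IH IH' 1 2 3 mm unfolding lab compat_def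
      by (cases "lab i k ((\<lambda>x. x div w) ` X) q"; cases "lab i k ((\<lambda>x. x div w) ` Y) q") auto
  next
    case mn
    have 3: "dn Y \<Longrightarrow> sep u X Y" "up Y \<Longrightarrow> sep u Y X"
      using mn F2[of Y X] F1[of Y X] unfolding mid_def by blast+
    \<comment> \<open>Without a later block in its own interval, \<open>Y\<close> reaches a later
      interval, hence no earlier one, and its earlier block is in the interval of \<open>u\<close>.
      So a \<open>DoveTip\<close> of \<open>Y\<close> is separated as well.\<close>
    have "\<not> up Y \<Longrightarrow> dn Y" using low[of Y] high[of Y] mn(2) "3.prems" unfolding mid_def by blast
    then show ?thesis using 3 mn unfolding lab compat_def by auto
  next
    case nm
    have 3: "up X \<Longrightarrow> sep u X Y" "dn X \<Longrightarrow> sep u Y X"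
      using nm F1[of X Y] F2[of X Y] unfolding mid_def by blast+
    then show ?thesis using nm unfolding lab compat_def by auto
  next
    case nn
    have 2: "up X \<Longrightarrow> \<not> up Y \<Longrightarrow> sep u X Y" "dn X \<Longrightarrow> \<not> dn Y \<Longrightarrow> sep u Y X"
      using nn F1[of X Y] F2[of X Y] low[of Y] high[of Y] "3.prems" by blast+
    show ?thesis
    proof (cases "up X \<and> dn X \<and> up Y \<and> dn Y")
      case True
      have strict: "x mod w < y mod w" if "x \<in> S Z" "y \<in> S Z'" "x < y" for x y Z Z'
        using that unfolding S_def by (metis (mono_tags, lifting) mem_Collect_eq mult_div_mod_eq nat_add_left_cancel_less)
      have IH: "compat (lab (Suc i) j ((\<lambda>x. x mod w) ` S X) (u mod w)) (lab (Suc i) j ((\<lambda>x. x mod w) ` S Y) (u mod w))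
          (u mod w) ((\<lambda>x. x mod w) ` S X) ((\<lambda>x. x mod w) ` S Y)"
      proof (rule 3(1))
        show "\<exists>x\<in>(\<lambda>x. x mod w) ` S X. x < u mod w" "\<exists>x\<in>(\<lambda>x. x mod w) ` S X. u mod w < x"
          "\<exists>x\<in>(\<lambda>x. x mod w) ` S Y. x < u mod w" "\<exists>x\<in>(\<lambda>x. x mod w) ` S Y. u mod w < x"
          using True u strict unfolding up_def dn_def by blast+
      qed (use u in auto)
      have "sep (u mod w) ((\<lambda>x. x mod w) ` S X) ((\<lambda>x. x mod w) ` S Y) \<Longrightarrow> sep u X Y"
        "sep (u mod w) ((\<lambda>x. x mod w) ` S Y) ((\<lambda>x. x mod w) ` S X) \<Longrightarrow> sep u Y X"
        unfolding S_def q_def by (rule sep_mod, assumption)+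
      then show ?thesis using IH True nn unfolding lab compat_def by auto
    next
      case False
      then show ?thesis using 2 nn unfolding lab compat_def by auto
    qed
  qed
qed (simp_all add: compat_def)

section \<open>Expanding labelled incidences\<close>

definition bset :: "(nat \<Rightarrow> 'a) \<Rightarrow> (nat \<Rightarrow> nat) \<Rightarrow> nat set \<Rightarrow> 'a \<Rightarrow> nat set" where
  "bset f \<gamma> E a = \<gamma> ` {r\<in>E. f r = a}"

lemma middles_iff:
  "p \<in> middles f \<gamma> E \<longleftrightarrow> p \<in> E \<and> (\<exists>x\<in>bset f \<gamma> E (f p). x < \<gamma> p) \<and> (\<exists>x\<in>bset f \<gamma> E (f p). \<gamma> p < x)"
  unfolding middles_def has_before_def has_after_def bset_def by blast

text \<open>\<open>sep\<close> gives two letters on one side of interval \<open>q\<close>, and the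
  middle position of the symbols gives one on the other side; with four letters inside
  \<open>C\<close> this makes 7.\<close>

lemma alt_free_4_same_label:
  assumes mono: "mono_blocks \<gamma> E" and free: "alt_free f 7 E"
    and C: "C \<subseteq> {p\<in>middles f \<gamma> E. \<gamma> p = q}"
    and l: "\<And>p. p \<in> C \<Longrightarrow> lab i j (bset f \<gamma> E (f p)) q = l" "l = Dove \<or> l = Hawk"
  shows "alt_free f 4 C"
  unfolding alt_free_def
proof (intro allI impI notI)
  fix a b assume ab: "a \<noteq> b" and alt: "alt f 4 a b C"
  obtain p r where p: "p \<in> C" "f p = a" and r: "r \<in> C" "f r = b" using alt_both[OF alt] by auto
  let ?X = "bset f \<gamma> E a" and ?Y = "bset f \<gamma> E b"
  have mem: "q \<in> ?X" "q \<in> ?Y"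
    using p r C unfolding bset_def middles_def by blast+
  have pm: "p \<in> middles f \<gamma> E" "r \<in> middles f \<gamma> E" "\<gamma> p = q" "\<gamma> r = q" using p r C by auto
  have ex: "\<exists>x\<in>?X. x < q" "\<exists>x\<in>?X. q < x" "\<exists>x\<in>?Y. x < q" "\<exists>x\<in>?Y. q < x"
    using pm p r unfolding middles_iff by auto
  have "compat (lab i j ?X q) (lab i j ?Y q) q ?X ?Y" by (rule compat_lab[OF mem ex])
  then have "sep q ?X ?Y" using l(1)[OF p(1)] l(1)[OF r(1)] l(2) p r unfolding compat_def by auto
  then obtain x y where xy: "x \<in> E" "f x = a" "y \<in> E" "f y = b"
    "\<gamma> x < \<gamma> y \<and> \<gamma> y < q \<or> q < \<gamma> x \<and> \<gamma> x < \<gamma> y"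
    unfolding sep_def bset_def by auto
  have sub: "C \<subseteq> E" using C class_subset(4)[of f \<gamma> E] by auto
  have Cq: "\<gamma> c = q" if "c \<in> C" for c using that C by auto
  have lt: "s < t" if "s \<in> E" "t \<in> E" "\<gamma> s < \<gamma> t" for s t using mono_blocksD[OF mono that] .
  have free': "alt_free f (Suc (Suc (Suc 4))) E" using free by simp
  from xy(5) show False
  proof
    \<comment> \<open>The alternation found is a b before the interval, a b a b in it, a after
      it.\<close>
    assume g: "\<gamma> x < \<gamma> y \<and> \<gamma> y < q"
    obtain z where z: "z \<in> E" "f z = a" "q < \<gamma> z" using ex(2) unfolding bset_def by blast
    have lts: "\<forall>r\<in>C. y < r" "\<forall>r\<in>C. x < r" "\<forall>r\<in>C. r < z" "x < y" "x < z" "y < z"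
      using lt xy z g sub Cq by (blast, metis less_trans subsetD, metis subsetD, metis, metis less_trans, metis less_trans)
    have 1: "alt f (Suc 4) b a (insert y C)"
      by (rule alt_cons[OF alt, where z = y]) (use xy lts in auto)
    have 2: "alt f (Suc (Suc 4)) a b (insert x (insert y C))"
      by (rule alt_cons[OF 1, where z = x]) (use xy lts in auto)
    have "alt f (Suc (Suc (Suc 4))) a b E"
      by (rule alt_snoc[OF 2, where z = z]) (use xy z lts sub in auto)
    then show False using alt_freeD[OF free' ab] by contradiction
  next
    \<comment> \<open>The alternation found is b before the interval, a b a b in it, a b after
      it.\<close>
    assume g: "q < \<gamma> x \<and> \<gamma> x < \<gamma> y"
    obtain z where z: "z \<in> E" "f z = b" "\<gamma> z < q" using ex(3) unfolding bset_def by blast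
    have lts: "\<forall>r\<in>C. z < r" "\<forall>r\<in>C. r < x" "\<forall>r\<in>C. r < y" "x < y" "z < x" "z < y"
      using lt xy z g sub Cq by (metis subsetD, metis subsetD, metis less_trans subsetD, metis, metis less_trans, metis less_trans)
    have 1: "alt f (Suc 4) b a (insert z C)"
      by (rule alt_cons[OF alt, where z = z]) (use z lts in auto)
    have 2: "alt f (Suc (Suc 4)) b a (insert x (insert z C))"
      by (rule alt_snoc[OF 1, where z = x]) (use xy z lts in auto)
    have "alt f (Suc (Suc (Suc 4))) b a E"
      by (rule alt_snoc[OF 2, where z = y]) (use xy z lts sub in auto)
    then show False using alt_freeD[OF free' ab[symmetric]] by contradiction
  qed
qed

definition tips :: "(nat \<Rightarrow> 'a) \<Rightarrow> nat \<Rightarrow> nat \<Rightarrow> (nat \<Rightarrow> nat) \<Rightarrow> nat set \<Rightarrow> nat set" where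
  "tips f i j \<gamma> E = {p\<in>middles f \<gamma> E. lab i j (bset f \<gamma> E (f p)) (\<gamma> p) \<in> {DoveTip, HawkTip}}"

text \<open>Contraction retains every incidence of a global symbol, so its set of intervals, and
  with it every label, is unchanged.\<close>

lemma bset_contract_globals:
  assumes "p \<in> globals f \<gamma> E"
  shows "bset f \<gamma> (contract f \<gamma> (globals f \<gamma> E)) (f p) = bset f \<gamma> E (f p)" (is "?A = ?B")
proof
  show "?A \<subseteq> ?B" unfolding bset_def contract_def globals_def by auto
  show "?B \<subseteq> ?A"
  proof
    fix x assume "x \<in> ?B"
    then obtain r where r: "r \<in> E" "f r = f p" "x = \<gamma> r" unfolding bset_def by auto
    have "r \<in> globals f \<gamma> E" by (rule globals_symbol[OF assms r(1,2)])
    then obtain s where "s \<in> contract f \<gamma> (globals f \<gamma> E)" "f s = f r" "\<gamma> s = \<gamma> r" by (rule contract_rep)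
    then show "x \<in> ?A" unfolding bset_def using r by (intro image_eqI[of _ _ s]) simp_all
  qed
qed

lemma card_pairs_tips:
  assumes "finite E" "T \<subseteq> middles f \<gamma> E"
    and "\<And>p. p \<in> T \<Longrightarrow> lab i j (bset f \<gamma> E (f p)) (\<gamma> p) \<in> {DoveTip, HawkTip}"
  shows "card ((\<lambda>p. (f p, \<gamma> p)) ` T) \<le> card (tips f i j \<gamma> (contract f \<gamma> (globals f \<gamma> E)))"
proof -
  let ?D = "contract f \<gamma> (globals f \<gamma> E)"
  have "finite ?D" using assms(1) contract_subset[of f \<gamma> "globals f \<gamma> E"] class_subset(5)[of f \<gamma> E]
    by (meson finite_subset)
  then have fin: "finite (tips f i j \<gamma> ?D)" unfolding tips_def middles_def by simp
  have "(\<lambda>p. (f p, \<gamma> p)) ` T \<subseteq> (\<lambda>p. (f p, \<gamma> p)) ` tips f i j \<gamma> ?D"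
  proof
    fix z assume "z \<in> (\<lambda>p. (f p, \<gamma> p)) ` T"
    then obtain p where p: "p \<in> T" "z = (f p, \<gamma> p)" by auto
    then have pm: "p \<in> middles f \<gamma> E" using assms(2) by auto
    then have pg: "p \<in> globals f \<gamma> E" using class_subset(8)[of f \<gamma> E] by auto
    obtain s where s: "s \<in> ?D" "f s = f p" "\<gamma> s = \<gamma> p" using contract_rep[OF pg] by metis
    have bs: "bset f \<gamma> ?D (f s) = bset f \<gamma> E (f p)" using bset_contract_globals[OF pg] s(2) by simp
    have "s \<in> tips f i j \<gamma> ?D"
      using s bs pm assms(3)[OF p(1)] unfolding tips_def middles_iff by simp
    then show "z \<in> (\<lambda>p. (f p, \<gamma> p)) ` tips f i j \<gamma> ?D"
      using s p by (intro image_eqI[of _ _ s]) simp_all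
  qed
  then show ?thesis using fin card_mono[of "(\<lambda>p. (f p, \<gamma> p)) ` tips f i j \<gamma> ?D"] card_image_le[OF fin, of "\<lambda>p. (f p, \<gamma> p)"]
    by (meson finite_imageI le_trans)
qed

text \<open>The expansion bounds are hypotheses with errors depending on \<open>q\<close>, because
  the lemma serves intervals of equal length as well as the intervals of the sparse case. An
  incidence has one label, so the factor 2 is paid once for \<open>Dove\<close> and
  \<open>Hawk\<close> together.\<close>

lemma card_middles_7:
  fixes \<gamma> :: "nat \<Rightarrow> nat"
  assumes E: "finite E" "mono_blocks \<gamma> E" "alt_free f 7 E" "\<gamma> ` E \<subseteq> {..<M}"
    and four: "\<And>q C. C \<subseteq> {p\<in>E. \<gamma> p = q} \<Longrightarrow> alt_free f 4 C \<Longrightarrow> card C \<le> 2 * card (f ` C) + c q"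
    and five: "\<And>q C. C \<subseteq> {p\<in>E. \<gamma> p = q} \<Longrightarrow> alt_free f 5 C \<Longrightarrow> card C \<le> \<kappa> * card (f ` C) + d q"
  shows "card (middles f \<gamma> E) \<le> 2 * card ((\<lambda>p. (f p, \<gamma> p)) ` globals f \<gamma> E)
     + \<kappa> * card (tips f i j \<gamma> (contract f \<gamma> (globals f \<gamma> E))) + (2 * (\<Sum>q<M. c q) + (\<Sum>q<M. d q))"
proof -
  define L where "L p = lab i j (bset f \<gamma> E (f p)) (\<gamma> p)" for p
  define cls where "cls l = {p\<in>middles f \<gamma> E. L p = l}" for l
  define T where "T = {p\<in>middles f \<gamma> E. L p \<in> {DoveTip, HawkTip}}"
  have finm: "finite (middles f \<gamma> E)" using E(1) by (simp add: middles_def)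
  have fin: "finite (cls l)" for l using finm by (simp add: cls_def)
  have ranM: "\<gamma> ` middles f \<gamma> E \<subseteq> {..<M}" using E(4) by (auto simp: middles_def)
  have ran: "\<gamma> ` cls l \<subseteq> {..<M}" for l using ranM unfolding cls_def by blast
  have lc: "card (cls l) \<le> 2 * card ((\<lambda>p. (f p, \<gamma> p)) ` cls l) + (\<Sum>q<M. c q)"
    if "l = Dove \<or> l = Hawk" for l
  proof (rule card_interval_sum[OF fin ran])
    fix q
    show "card {p\<in>cls l. \<gamma> p = q} \<le> 2 * card (f ` {p\<in>cls l. \<gamma> p = q}) + c q"
    proof (rule four)
      show "alt_free f 4 {p\<in>cls l. \<gamma> p = q}"
        by (rule alt_free_4_same_label[OF E(2,3), where q = q and i = i and j = j and l = l])
          (use that in \<open>auto simp: cls_def L_def\<close>)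
    qed (auto simp: cls_def middles_def)
  qed
  have finT: "finite T" and ranT: "\<gamma> ` T \<subseteq> {..<M}" using finm ranM by (auto simp: T_def)
  have free5: "alt_free f (Suc (Suc 5)) E" using E(3) by simp
  have "card T \<le> \<kappa> * card ((\<lambda>p. (f p, \<gamma> p)) ` T) + (\<Sum>q<M. d q)"
  proof (rule card_interval_sum[OF finT ranT])
    fix q
    show "card {p\<in>T. \<gamma> p = q} \<le> \<kappa> * card (f ` {p\<in>T. \<gamma> p = q}) + d q"
    proof (rule five)
      show "alt_free f 5 {p\<in>T. \<gamma> p = q}"
        by (rule alt_free_mono[OF alt_free_middles[OF E(2) free5, of q]]) (auto simp: T_def)
    qed (auto simp: T_def middles_def)
  qed
  also have "card ((\<lambda>p. (f p, \<gamma> p)) ` T) \<le> card (tips f i j \<gamma> (contract f \<gamma> (globals f \<gamma> E)))"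
    by (rule card_pairs_tips[OF E(1)]) (auto simp: T_def L_def)
  finally have T: "card T \<le> \<kappa> * card (tips f i j \<gamma> (contract f \<gamma> (globals f \<gamma> E))) + (\<Sum>q<M. d q)" by simp
  have "card ((\<lambda>p. (f p, \<gamma> p)) ` cls Dove) + card ((\<lambda>p. (f p, \<gamma> p)) ` cls Hawk)
      = card ((\<lambda>p. (f p, \<gamma> p)) ` cls Dove \<union> (\<lambda>p. (f p, \<gamma> p)) ` cls Hawk)"
    using fin by (intro card_Un_disjoint[symmetric]) (auto simp: cls_def L_def)
  also have "\<dots> \<le> card ((\<lambda>p. (f p, \<gamma> p)) ` globals f \<gamma> E)"
    using E(1) by (intro card_mono) (auto simp: cls_def middles_def globals_def)
  finally have pairs: "card ((\<lambda>p. (f p, \<gamma> p)) ` cls Dove) + card ((\<lambda>p. (f p, \<gamma> p)) ` cls Hawk)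
      \<le> card ((\<lambda>p. (f p, \<gamma> p)) ` globals f \<gamma> E)" .
  have "L p = Dove \<or> L p = Hawk \<or> L p = DoveTip \<or> L p = HawkTip" for p by (cases "L p") auto
  then have "middles f \<gamma> E = cls Dove \<union> (cls Hawk \<union> T)" by (auto simp: cls_def T_def)
  then have "card (middles f \<gamma> E) \<le> card (cls Dove) + (card (cls Hawk) + card T)"
    by (metis card_Un_le add_left_mono le_trans)
  with lc[of Dove] lc[of Hawk] T pairs show ?thesis by (simp add: algebra_simps)
qed

section \<open>The number of tips\<close>

definition tip_bound :: "(nat \<Rightarrow> 'a) \<Rightarrow> nat \<Rightarrow> nat \<Rightarrow> nat \<Rightarrow> nat \<Rightarrow> nat \<Rightarrow> nat \<Rightarrow> bool" where
  "tip_bound f k i j \<phi> c m \<longleftrightarrow> (\<forall>E \<beta>. finite E \<longrightarrow> blocked f \<beta> E \<longrightarrow> alt_free f k E \<longrightarrow> \<beta> ` E \<subseteq> {..<m}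
     \<longrightarrow> card (tips f i j \<beta> E) \<le> \<phi> * card (f ` E) + c)"

lemma tip_boundD:
  "tip_bound f k i j \<phi> c m \<Longrightarrow> finite E \<Longrightarrow> blocked f \<beta> E \<Longrightarrow> alt_free f k E \<Longrightarrow> \<beta> ` E \<subseteq> {..<m}
     \<Longrightarrow> card (tips f i j \<beta> E) \<le> \<phi> * card (f ` E) + c"
  unfolding tip_bound_def by simp

lemma tips_subset: "tips f i j \<beta> E \<subseteq> E"
  unfolding tips_def middles_def by auto

lemma tip_bound_weaken:
  assumes "tip_bound f k i j \<phi> c m" "\<phi> \<le> \<phi>'" "c \<le> c'" "m' \<le> m"
  shows "tip_bound f k i j \<phi>' c' m'"
  unfolding tip_bound_def
proof (intro allI impI)
  fix E \<beta> assume "finite E" "blocked f \<beta> E" "alt_free f k E" "\<beta> ` E \<subseteq> {..<m'}"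
  then have "card (tips f i j \<beta> E) \<le> \<phi> * card (f ` E) + c"
    by (intro tip_boundD[OF assms(1)]) (use assms(4) in auto)
  also have "\<dots> \<le> \<phi>' * card (f ` E) + c'" using assms by (intro add_mono mult_right_mono) auto
  finally show "card (tips f i j \<beta> E) \<le> \<phi>' * card (f ` E) + c'" .
qed

lemma size_bound_imp_tip_bound:
  assumes "size_bound f k \<mu> c m"
  shows "tip_bound f k i j \<mu> c m"
  unfolding tip_bound_def
proof (intro allI impI)
  fix E \<beta> assume E: "finite E" "blocked f \<beta> E" "alt_free f k E" "\<beta> ` E \<subseteq> {..<m}"
  have "card (tips f i j \<beta> E) \<le> card E" by (rule card_mono[OF E(1) tips_subset])
  also have "\<dots> \<le> \<mu> * card (f ` E) + c" by (rule size_boundD[OF assms E])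
  finally show "card (tips f i j \<beta> E) \<le> \<mu> * card (f ` E) + c" .
qed

section \<open>Tips in one step of the recursion\<close>

text \<open>Being a tip is relative to a sequence; here every interval of \<open>C\<close> is a
  sequence of its own, with block numbers modulo \<open>w\<close> as in the last clause of
  \<open>lab\<close>.\<close>

definition inner_tips :: "(nat \<Rightarrow> 'a) \<Rightarrow> nat \<Rightarrow> nat \<Rightarrow> (nat \<Rightarrow> nat) \<Rightarrow> nat \<Rightarrow> nat set \<Rightarrow> nat set" where
  "inner_tips f i j \<beta> w C =
     {p\<in>C. p \<in> tips f i j (\<lambda>r. \<beta> r mod w) {r\<in>C. \<beta> r div w = \<beta> p div w}}"

lemma card_inner_tips:
  fixes \<beta> :: "nat \<Rightarrow> nat"
  assumes "tip_bound f k i j \<phi> c w" "finite E" "blocked f \<beta> E" "\<beta> ` E \<subseteq> {..<w * M}" "0 < w" "C \<subseteq> E"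
    and "\<And>q. alt_free f k {p\<in>C. \<beta> p div w = q}"
  shows "card (inner_tips f i j \<beta> w C) \<le> \<phi> * card ((\<lambda>p. (f p, \<beta> p div w)) ` C) + M * c"
proof -
  let ?\<gamma> = "\<lambda>p. \<beta> p div w"
  let ?C = "\<lambda>q. {p\<in>C. ?\<gamma> p = q}"
  have fin: "finite C" using assms(2,6) finite_subset by blast
  have ran: "?\<gamma> ` C \<subseteq> {..<M}" using image_div_subset[OF assms(4,5)] assms(6) by blast
  have q: "card {p\<in>inner_tips f i j \<beta> w C. ?\<gamma> p = q} \<le> \<phi> * card (f ` ?C q) + c" for q
  proof -
    have "{p\<in>inner_tips f i j \<beta> w C. ?\<gamma> p = q} \<subseteq> tips f i j (\<lambda>r. \<beta> r mod w) (?C q)"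
      unfolding inner_tips_def by auto
    moreover have "finite (tips f i j (\<lambda>r. \<beta> r mod w) (?C q))"
      using fin by (intro finite_subset[OF tips_subset]) simp
    ultimately have "card {p\<in>inner_tips f i j \<beta> w C. ?\<gamma> p = q} \<le> card (tips f i j (\<lambda>r. \<beta> r mod w) (?C q))"
      by (intro card_mono)
    also have "\<dots> \<le> \<phi> * card (f ` ?C q) + c"
    proof (rule tip_boundD[OF assms(1)])
      show "blocked f (\<lambda>p. \<beta> p mod w) (?C q)"
        by (rule blocked_mod[OF blocked_mono[OF assms(3)]]) (use assms(6) in auto)
    qed (use fin assms(5,7) in auto)
    finally show ?thesis .
  qed
  have "card (inner_tips f i j \<beta> w C) \<le> \<phi> * card ((\<lambda>p. (f p, ?\<gamma> p)) ` C) + (\<Sum>q<M. c)"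
    by (rule card_subset_interval_sum[OF fin ran _ q]) (auto simp: inner_tips_def)
  then show ?thesis by simp
qed

text \<open>\<open>closed\<close> ensures that the label inside \<open>C\<close> is computed from
  all blocks of the symbol in this interval, as in \<open>lab\<close>.\<close>

lemma inner_tipI:
  fixes \<beta> :: "nat \<Rightarrow> nat"
  assumes "p \<in> C" "C \<subseteq> E"
    and closed: "\<And>r. r \<in> E \<Longrightarrow> f r = f p \<Longrightarrow> \<beta> r div w = \<beta> p div w \<Longrightarrow> r \<in> C"
    and "\<exists>r\<in>E. f r = f p \<and> \<beta> r div w = \<beta> p div w \<and> \<beta> r < \<beta> p"
    and "\<exists>r\<in>E. f r = f p \<and> \<beta> r div w = \<beta> p div w \<and> \<beta> p < \<beta> r"
    and "lab i j ((\<lambda>x. x mod w) ` {x\<in>bset f \<beta> E (f p). x div w = \<beta> p div w}) (\<beta> p mod w) \<in> {DoveTip, HawkTip}"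
  shows "p \<in> inner_tips f i j \<beta> w C"
proof -
  let ?D = "{r\<in>C. \<beta> r div w = \<beta> p div w}"
  have lt: "\<beta> r mod w < \<beta> s mod w" if "\<beta> r div w = \<beta> s div w" "\<beta> r < \<beta> s" for r s
    using that by (metis mult_div_mod_eq nat_add_left_cancel_less)
  have bs: "bset f (\<lambda>r. \<beta> r mod w) ?D (f p) = (\<lambda>x. x mod w) ` {x\<in>bset f \<beta> E (f p). x div w = \<beta> p div w}"
    unfolding bset_def using closed assms(2) by auto
  have "p \<in> middles f (\<lambda>r. \<beta> r mod w) ?D"
    using assms(1,4,5) closed lt unfolding middles_def has_before_def has_after_def by (auto; metis)
  then show ?thesis using assms(1,6) bs unfolding inner_tips_def tips_def by auto
qed

definition extremal :: "(nat \<Rightarrow> 'a) \<Rightarrow> (nat \<Rightarrow> nat) \<Rightarrow> nat \<Rightarrow> nat set \<Rightarrow> nat set \<Rightarrow> nat set" where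
  "extremal f \<beta> w E C = {p\<in>C. \<not> (\<exists>r\<in>E. f r = f p \<and> \<beta> r div w = \<beta> p div w \<and> \<beta> r < \<beta> p)
      \<or> \<not> (\<exists>r\<in>E. f r = f p \<and> \<beta> r div w = \<beta> p div w \<and> \<beta> p < \<beta> r)}"

text \<open>By \<open>one\<close>, each symbol is confined to a single interval, where it has one
  first and one last position.\<close>

lemma card_extremal:
  assumes "finite E" "blocked f \<beta> E" "C \<subseteq> globals f (\<lambda>p. \<beta> p div w) E"
    and one: "\<And>p r. p \<in> C \<Longrightarrow> r \<in> C \<Longrightarrow> f p = f r \<Longrightarrow> \<beta> p div w = \<beta> r div w"
  shows "card (extremal f \<beta> w E C) \<le> 2 * card (f ` globals f (\<lambda>p. \<beta> p div w) E)"
proof -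
  let ?G = "globals f (\<lambda>p. \<beta> p div w) E"
  define A where "A = {p\<in>C. \<not> (\<exists>r\<in>E. f r = f p \<and> \<beta> r div w = \<beta> p div w \<and> \<beta> r < \<beta> p)}"
  define B where "B = {p\<in>C. \<not> (\<exists>r\<in>E. f r = f p \<and> \<beta> r div w = \<beta> p div w \<and> \<beta> p < \<beta> r)}"
  have CE: "C \<subseteq> E" and fin: "finite ?G" using assms(1,3) by (auto simp: globals_def)
  have inj: "p = r" if "p \<in> E" "r \<in> E" "f p = f r" "\<beta> p = \<beta> r" for p r
    using that assms(2) unfolding blocked_def by blast
  have "inj_on f A"
  proof (rule inj_onI)
    fix p r assume pr: "p \<in> A" "r \<in> A" "f p = f r"
    then have "\<beta> p div w = \<beta> r div w" using one[of p r] by (auto simp: A_def)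
    moreover have "p \<in> E" "r \<in> E" using pr CE by (auto simp: A_def)
    ultimately have "\<not> \<beta> p < \<beta> r" "\<not> \<beta> r < \<beta> p" using pr unfolding A_def by force+
    then show "p = r" using inj[OF \<open>p \<in> E\<close> \<open>r \<in> E\<close> pr(3)] by simp
  qed
  then have "card A \<le> card (f ` ?G)" using assms(3) fin by (intro card_inj_on_le[of f]) (auto simp: A_def)
  moreover have "inj_on f B"
  proof (rule inj_onI)
    fix p r assume pr: "p \<in> B" "r \<in> B" "f p = f r"
    then have "\<beta> p div w = \<beta> r div w" using one[of p r] by (auto simp: B_def)
    moreover have "p \<in> E" "r \<in> E" using pr CE by (auto simp: B_def)
    ultimately have "\<not> \<beta> p < \<beta> r" "\<not> \<beta> r < \<beta> p" using pr unfolding B_def by force+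
    then show "p = r" using inj[OF \<open>p \<in> E\<close> \<open>r \<in> E\<close> pr(3)] by simp
  qed
  then have "card B \<le> card (f ` ?G)" using assms(3) fin by (intro card_inj_on_le[of f]) (auto simp: B_def)
  moreover have "extremal f \<beta> w E C = A \<union> B" by (auto simp: extremal_def A_def B_def)
  ultimately show ?thesis using card_Un_le[of A B] by simp
qed

text \<open>Outside the middle intervals \<open>lab\<close> either stops at an end of the symbol's
  interval or descends into it. A local tip is never at an end: it is a middle occurrence and its
  symbol has no other interval.\<close>

lemma tips_Suc_Suc:
  fixes \<beta> :: "nat \<Rightarrow> nat"
  assumes "blocked f \<beta> E" and w: "w = 8 ^ ack_exp (Suc i) j"
  defines "\<gamma> \<equiv> \<lambda>p. \<beta> p div w"
  assumes p: "p \<in> tips f (Suc i) (Suc j) \<beta> E" and nm: "p \<notin> middles f \<gamma> E"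
  shows "p \<in> inner_tips f (Suc i) j \<beta> w (locals f \<gamma> E)
    \<or> p \<in> inner_tips f (Suc i) j \<beta> w (firsts f \<gamma> E) \<or> p \<in> extremal f \<beta> w E (firsts f \<gamma> E)
    \<or> p \<in> inner_tips f (Suc i) j \<beta> w (lasts f \<gamma> E) \<or> p \<in> extremal f \<beta> w E (lasts f \<gamma> E)"
proof -
  let ?X = "bset f \<beta> E (f p)"
  have pE: "p \<in> E" using p tips_subset by blast
  define up where "up \<longleftrightarrow> (\<exists>r\<in>E. f r = f p \<and> \<beta> r div w = \<beta> p div w \<and> \<beta> p < \<beta> r)"
  define dn where "dn \<longleftrightarrow> (\<exists>r\<in>E. f r = f p \<and> \<beta> r div w = \<beta> p div w \<and> \<beta> r < \<beta> p)"
  have up: "(\<exists>y\<in>{x\<in>?X. x div w = \<beta> p div w}. \<beta> p < y) \<longleftrightarrow> up" unfolding up_def bset_def by blast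
  have dn: "(\<exists>y\<in>{x\<in>?X. x div w = \<beta> p div w}. y < \<beta> p) \<longleftrightarrow> dn" unfolding dn_def bset_def by blast
  have nmid: "\<not> ((\<exists>x\<in>?X. x div w < \<beta> p div w) \<and> (\<exists>x\<in>?X. \<beta> p div w < x div w))"
    using nm pE unfolding middles_def has_before_def has_after_def \<gamma>_def bset_def by auto
  have l: "lab (Suc i) (Suc j) ?X (\<beta> p) = (if \<not> up then DoveTip else if \<not> dn then HawkTip
      else lab (Suc i) j ((\<lambda>x. x mod w) ` {x\<in>?X. x div w = \<beta> p div w}) (\<beta> p mod w))"
    using nmid unfolding lab.simps Let_def w[symmetric] up[symmetric] dn[symmetric] by (simp only: if_False)
  have inner: "p \<in> inner_tips f (Suc i) j \<beta> w C"
    if "up" "dn" "p \<in> C" "C \<subseteq> E" "\<And>r. r \<in> E \<Longrightarrow> f r = f p \<Longrightarrow> \<gamma> r = \<gamma> p \<Longrightarrow> r \<in> C" for C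
  proof (rule inner_tipI[OF that(3,4)])
    show "lab (Suc i) j ((\<lambda>x. x mod w) ` {x \<in> bset f \<beta> E (f p). x div w = \<beta> p div w}) (\<beta> p mod w) \<in> {DoveTip, HawkTip}"
      using p l that(1,2) unfolding tips_def by simp
  qed (use that in \<open>auto simp: up_def dn_def \<gamma>_def\<close>)
  have mid: "\<exists>r\<in>E. f r = f p \<and> \<beta> r < \<beta> p" "\<exists>r\<in>E. f r = f p \<and> \<beta> p < \<beta> r"
    using p unfolding tips_def middles_def has_before_def has_after_def by blast+
  consider (l) "p \<in> locals f \<gamma> E" | (f) "p \<in> firsts f \<gamma> E" | (s) "p \<in> lasts f \<gamma> E"
    using nm pE unfolding class_defs by blast
  then show ?thesis
  proof cases
    case l
    have loc: "\<gamma> r = \<gamma> p" if "r \<in> E" "f r = f p" for r using locals_symbol[OF l that] by simp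
    have "up" "dn" using mid loc unfolding up_def dn_def \<gamma>_def by blast+
    then have "p \<in> inner_tips f (Suc i) j \<beta> w (locals f \<gamma> E)"
      by (rule inner) (use l locals_symbol[OF l] class_subset(1)[of f \<gamma> E] in auto)
    then show ?thesis by blast
  next
    case f
    show ?thesis
    proof (cases "up \<and> dn")
      case True
      have "p \<in> inner_tips f (Suc i) j \<beta> w (firsts f \<gamma> E)"
        by (rule inner) (use f True in \<open>auto simp: firsts_def has_before_def has_after_def\<close>)
      then show ?thesis by blast
    next
      case False
      then show ?thesis using f unfolding extremal_def up_def dn_def by blast
    qed
  next
    case s
    show ?thesis
    proof (cases "up \<and> dn")
      case True
      have "p \<in> inner_tips f (Suc i) j \<beta> w (lasts f \<gamma> E)"
        by (rule inner) (use s True in \<open>auto simp: lasts_def has_before_def has_after_def\<close>)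
      then show ?thesis by blast
    next
      case False
      then show ?thesis using s unfolding extremal_def up_def dn_def by blast
    qed
  qed
qed

lemma card_tips_middles:
  fixes \<beta> :: "nat \<Rightarrow> nat"
  assumes "finite E" "blocked f \<beta> E" and w: "w = 8 ^ k" "k = ack_exp (Suc i) j"
  defines "\<gamma> \<equiv> \<lambda>p. \<beta> p div w"
  shows "card (tips f (Suc i) (Suc j) \<beta> E \<inter> middles f \<gamma> E) \<le> card (tips f i k \<gamma> (contract f \<gamma> (globals f \<gamma> E)))"
proof -
  let ?T = "tips f (Suc i) (Suc j) \<beta> E \<inter> middles f \<gamma> E"
  have inj_E: "p = r" if "p \<in> E" "r \<in> E" "f p = f r" "\<beta> p = \<beta> r" for p r
    using that assms(2) unfolding blocked_def by blast
  have bs: "(\<lambda>x. x div w) ` bset f \<beta> E a = bset f \<gamma> E a" for a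
    unfolding bset_def \<gamma>_def by (simp add: image_image)
  define up where "up p \<longleftrightarrow> (\<exists>y\<in>{x\<in>bset f \<beta> E (f p). x div w = \<gamma> p}. \<beta> p < y)" for p
  define dn where "dn p \<longleftrightarrow> (\<exists>y\<in>{x\<in>bset f \<beta> E (f p). x div w = \<gamma> p}. y < \<beta> p)" for p
  have l: "lab (Suc i) (Suc j) (bset f \<beta> E (f p)) (\<beta> p) =
      (case lab i k (bset f \<gamma> E (f p)) (\<gamma> p) of
          Dove \<Rightarrow> Dove
        | Hawk \<Rightarrow> Hawk
        | DoveTip \<Rightarrow> (if up p then Dove else DoveTip)
        | HawkTip \<Rightarrow> (if dn p then Hawk else HawkTip))" if "p \<in> middles f \<gamma> E" for p
  proof -
    have "(\<exists>x\<in>bset f \<beta> E (f p). x div w < \<gamma> p) \<and> (\<exists>x\<in>bset f \<beta> E (f p). \<gamma> p < x div w)"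
      using that unfolding middles_iff bs[symmetric] by auto
    then show ?thesis
      unfolding lab.simps Let_def up_def dn_def w(2)[symmetric] w(1)[symmetric] bs \<gamma>_def by (simp only: if_True simp_thms)
  qed
  have tip: "lab i k (bset f \<gamma> E (f p)) (\<gamma> p) = DoveTip \<and> \<not> up p \<or>
      lab i k (bset f \<gamma> E (f p)) (\<gamma> p) = HawkTip \<and> \<not> dn p" if "p \<in> ?T" for p
    using l[of p] that unfolding tips_def by (auto split: label.splits if_splits)
  \<comment> \<open>Two tips with the same incidence get the same label from the contraction, so
    both are at the last or both at the first block of the symbol in the interval.\<close>
  have "inj_on (\<lambda>p. (f p, \<gamma> p)) ?T"
  proof (rule inj_onI)
    fix p r assume pr: "p \<in> ?T" "r \<in> ?T" "(f p, \<gamma> p) = (f r, \<gamma> r)"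
    have E: "p \<in> E" "r \<in> E" using pr tips_subset by blast+
    have eq: "f p = f r" "\<gamma> p = \<gamma> r" using pr(3) by auto
    have mem: "\<beta> p \<in> {x\<in>bset f \<beta> E (f p). x div w = \<gamma> p}" "\<beta> r \<in> {x\<in>bset f \<beta> E (f p). x div w = \<gamma> p}"
      using E eq unfolding bset_def \<gamma>_def by auto
    have "\<beta> p = \<beta> r"
      using tip[OF pr(1)] tip[OF pr(2)] mem unfolding up_def dn_def eq
      by (metis label.distinct(11) linorder_neqE_nat)
    then show "p = r" using inj_E[OF E eq(1)] by blast
  qed
  then have "card ?T = card ((\<lambda>p. (f p, \<gamma> p)) ` ?T)" by (simp only: card_image)
  also have "\<dots> \<le> card (tips f i k \<gamma> (contract f \<gamma> (globals f \<gamma> E)))"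
    by (rule card_pairs_tips[OF assms(1)]) (use tip in auto)
  finally show ?thesis .
qed


text \<open>Unlike in \<open>size_bound_rec\<close>, the factor of the contraction is not
  multiplied. The 4 counts two extremal positions per global symbol in its first interval and two in
  its last.\<close>

lemma tip_bound_rec:
  assumes loc: "tip_bound f (Suc (Suc k)) (Suc i) j \<phi> cl w"
    and fst: "tip_bound f (Suc k) (Suc i) j \<phi>f cf w"
    and ctr: "tip_bound f (Suc (Suc k)) i l \<phi>c cc M"
    and w: "w = 8 ^ l" "l = ack_exp (Suc i) j"
    and "2 * \<phi>f + \<phi>c + 4 \<le> \<phi>" "2 \<le> k"
  shows "tip_bound f (Suc (Suc k)) (Suc i) (Suc j) \<phi> (M * (cl + 2 * cf) + cc) (w * M)"
  unfolding tip_bound_def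
proof (intro allI impI)
  fix E \<beta> assume E: "finite E" "blocked f \<beta> E" "alt_free f (Suc (Suc k)) E" "\<beta> ` E \<subseteq> {..<w * M}"
  have "0 < w" using w by simp
  let ?\<gamma> = "\<lambda>p. \<beta> p div w"
  let ?G = "card (f ` globals f ?\<gamma> E)" and ?L = "card (f ` locals f ?\<gamma> E)"
  let ?in = "inner_tips f (Suc i) j \<beta> w" and ?ex = "extremal f \<beta> w E"
  let ?loc = "locals f ?\<gamma> E" and ?fst = "firsts f ?\<gamma> E" and ?lst = "lasts f ?\<gamma> E"
  let ?T = "tips f (Suc i) (Suc j) \<beta> E"
  have mono: "mono_blocks ?\<gamma> E" using E(2) mono_blocks_div unfolding blocked_def by blast
  have "card (?in ?loc) \<le> \<phi> * card ((\<lambda>p. (f p, ?\<gamma> p)) ` ?loc) + M * cl"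
    by (rule card_inner_tips[OF loc E(1,2,4) \<open>0 < w\<close> class_subset(1)])
      (rule alt_free_mono[OF E(3)], auto simp: locals_def)
  then have 1: "card (?in ?loc) \<le> \<phi> * ?L + M * cl"
    unfolding card_pairs_locals[of f ?\<gamma>] .
  have "card (?in ?fst) \<le> \<phi>f * card ((\<lambda>p. (f p, ?\<gamma> p)) ` ?fst) + M * cf"
    by (rule card_inner_tips[OF fst E(1,2,4) \<open>0 < w\<close> class_subset(2)])
      (rule alt_free_firsts[OF mono E(3)], use \<open>2 \<le> k\<close> in simp)
  also have "\<dots> \<le> \<phi>f * ?G + M * cf"
    using card_pairs_firsts[OF E(1), of f ?\<gamma>] by simp
  finally have 2: "card (?in ?fst) \<le> \<phi>f * ?G + M * cf" .
  have "card (?in ?lst) \<le> \<phi>f * card ((\<lambda>p. (f p, ?\<gamma> p)) ` ?lst) + M * cf"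
    by (rule card_inner_tips[OF fst E(1,2,4) \<open>0 < w\<close> class_subset(3)])
      (rule alt_free_lasts[OF mono E(3)], use \<open>2 \<le> k\<close> in simp)
  also have "\<dots> \<le> \<phi>f * ?G + M * cf"
    using card_pairs_lasts[OF E(1), of f ?\<gamma>] by simp
  finally have 3: "card (?in ?lst) \<le> \<phi>f * ?G + M * cf" .
  have 4: "card (?ex ?fst) \<le> 2 * ?G"
  proof (rule card_extremal[OF E(1,2) class_subset(6)])
    fix p r assume "p \<in> ?fst" "r \<in> ?fst" "f p = f r"
    then have "\<not> ?\<gamma> p < ?\<gamma> r" "\<not> ?\<gamma> r < ?\<gamma> p" unfolding firsts_def has_before_def by (blast, metis (mono_tags, lifting) mem_Collect_eq)
    then show "?\<gamma> p = ?\<gamma> r" by simp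
  qed
  have 5: "card (?ex ?lst) \<le> 2 * ?G"
  proof (rule card_extremal[OF E(1,2) class_subset(7)])
    fix p r assume "p \<in> ?lst" "r \<in> ?lst" "f p = f r"
    then have "\<not> ?\<gamma> p < ?\<gamma> r" "\<not> ?\<gamma> r < ?\<gamma> p" unfolding lasts_def has_after_def by (metis (mono_tags, lifting) mem_Collect_eq, blast)
    then show "?\<gamma> p = ?\<gamma> r" by simp
  qed
  let ?D = "contract f ?\<gamma> (globals f ?\<gamma> E)"
  have sub: "?D \<subseteq> E" using contract_subset[of f ?\<gamma> "globals f ?\<gamma> E"] class_subset(5)[of f ?\<gamma> E] by blast
  have "card (?T \<inter> middles f ?\<gamma> E) \<le> card (tips f i l ?\<gamma> ?D)"
    by (rule card_tips_middles[OF E(1,2) w])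
  also have "\<dots> \<le> \<phi>c * card (f ` ?D) + cc"
  proof (rule tip_boundD[OF ctr])
    show "finite ?D" using E(1) sub finite_subset by blast
    show "blocked f ?\<gamma> ?D" by (rule contract_blocked[OF mono_blocks_mono[OF mono class_subset(5)]])
    show "alt_free f (Suc (Suc k)) ?D" by (rule alt_free_mono[OF E(3) sub])
    show "?\<gamma> ` ?D \<subseteq> {..<M}" using image_div_subset[OF E(4) \<open>0 < w\<close>] sub by blast
  qed
  finally have 6: "card (?T \<inter> middles f ?\<gamma> E) \<le> \<phi>c * ?G + cc" by (simp add: contract_symbols)
  let ?U = "?in ?loc \<union> (?in ?fst \<union> (?in ?lst \<union> (?ex ?fst \<union> (?ex ?lst \<union> (?T \<inter> middles f ?\<gamma> E)))))"
  have "?T \<subseteq> ?U"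
    using tips_Suc_Suc[OF E(2), of w i j] w by blast
  moreover have "?U \<subseteq> E" unfolding inner_tips_def extremal_def using class_subset[of f ?\<gamma> E] by blast
  ultimately have "card ?T \<le> card ?U" using E(1) by (meson card_mono finite_subset)
  also have "\<dots> \<le> card (?in ?loc) + (card (?in ?fst) + (card (?in ?lst) + (card (?ex ?fst) + (card (?ex ?lst) + card (?T \<inter> middles f ?\<gamma> E)))))"
    by (intro order_trans[OF card_Un_le] add_left_mono order_refl)
  also have "\<dots> \<le> (\<phi> * ?L + M * cl) + ((\<phi>f * ?G + M * cf) + ((\<phi>f * ?G + M * cf) + (2 * ?G + (2 * ?G + (\<phi>c * ?G + cc)))))"
    using 1 2 3 4 5 6 by (intro add_mono)
  also have "\<dots> = \<phi> * ?L + (2 * \<phi>f + \<phi>c + 4) * ?G + (M * (cl + 2 * cf) + cc)"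
    by (simp add: algebra_simps)
  also have "\<dots> \<le> \<phi> * ?L + \<phi> * ?G + (M * (cl + 2 * cf) + cc)"
    using assms(6) by (intro add_mono mult_right_mono) auto
  also have "\<dots> = \<phi> * card (f ` E) + (M * (cl + 2 * cf) + cc)"
    unfolding card_symbols_split[OF E(1), of f ?\<gamma>] by (simp add: algebra_simps)
  finally show "card ?T \<le> \<phi> * card (f ` E) + (M * (cl + 2 * cf) + cc)" .
qed

text \<open>Labels, unlike lengths, depend on the column, so a sequence that already fits the
  smaller column needs this comparison: all its blocks lie in interval 0, and \<open>lab\<close>
  passes straight to column \<open>j\<close>.\<close>

lemma tips_Suc_small:
  fixes \<beta> :: "nat \<Rightarrow> nat"
  assumes "\<beta> ` E \<subseteq> {..<8 ^ ack_exp (Suc i) j}"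
  shows "tips f (Suc i) (Suc j) \<beta> E \<subseteq> tips f (Suc i) j \<beta> E"
proof
  fix p assume p: "p \<in> tips f (Suc i) (Suc j) \<beta> E"
  define w :: nat where w: "w = 8 ^ ack_exp (Suc i) j"
  let ?X = "bset f \<beta> E (f p)"
  have pm: "p \<in> middles f \<beta> E" using p unfolding tips_def by simp
  have z: "x div w = 0" "x mod w = x" if "x \<in> ?X" for x
    using that assms unfolding bset_def w by auto
  have pX: "\<beta> p \<in> ?X" using pm unfolding bset_def middles_def by blast
  have S: "{x\<in>?X. x div w = \<beta> p div w} = ?X" using z pX by auto
  have I: "(\<lambda>x. x mod w) ` ?X = ?X" using z by (auto simp: image_iff)
  have "\<not> ((\<exists>x\<in>?X. x div w < \<beta> p div w) \<and> (\<exists>x\<in>?X. \<beta> p div w < x div w))" using z pX by auto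
  moreover have "\<exists>y\<in>?X. \<beta> p < y" "\<exists>y\<in>?X. y < \<beta> p" using pm unfolding middles_iff by auto
  ultimately have "lab (Suc i) (Suc j) ?X (\<beta> p) = lab (Suc i) j ?X (\<beta> p)"
    unfolding lab.simps Let_def w[symmetric] S I z(2)[OF pX] by (simp only: if_False simp_thms)
  then show "p \<in> tips f (Suc i) j \<beta> E" using p unfolding tips_def by simp
qed

lemma tip_bound_ack_induct:
  assumes base: "\<And>i. 8 \<le> \<phi> i"
    and step: "\<And>i. 2 * \<phi>f (Suc i) + \<phi> i + 4 \<le> \<phi> (Suc i)"
    and fst: "\<And>i j m. m \<le> 8 ^ ack_exp i j \<Longrightarrow> tip_bound f (Suc k) i j (\<phi>f i) (\<phi>f i * 8 ^ j * m) m"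
    and k: "2 \<le> k"
  shows "m \<le> 8 ^ ack_exp i j \<Longrightarrow> tip_bound f (Suc (Suc k)) i j (\<phi> i) (\<phi> i * 8 ^ j * m) m"
proof (induction i j arbitrary: m rule: ack_exp.induct)
  case (1 j)
  then show ?case using base[of 0]
    by (intro tip_bound_weaken[OF size_bound_imp_tip_bound[OF size_bound_trivial[of f _ m]]]) auto
next
  case (2 i)
  then show ?case using base[of "Suc i"]
    by (intro tip_bound_weaken[OF size_bound_imp_tip_bound[OF size_bound_trivial[of f _ m]]]) auto
next
  case (3 i j)
  define l where "l = ack_exp (Suc i) j"
  define w :: nat where "w = 8 ^ l"
  have IH1: "tip_bound f (Suc (Suc k)) (Suc i) j (\<phi> (Suc i)) (\<phi> (Suc i) * 8 ^ j * m) m" if "m \<le> w" for m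
    using 3(1) that unfolding w_def l_def by blast
  show ?case
  proof (cases "m \<le> w")
    case True
    show ?thesis
      unfolding tip_bound_def
    proof (intro allI impI)
      fix E \<beta> assume E: "finite E" "blocked f \<beta> E" "alt_free f (Suc (Suc k)) E" "\<beta> ` E \<subseteq> {..<m}"
      have "finite (tips f (Suc i) j \<beta> E)" by (rule finite_subset[OF tips_subset E(1)])
      then have "card (tips f (Suc i) (Suc j) \<beta> E) \<le> card (tips f (Suc i) j \<beta> E)"
      proof (rule card_mono[OF _ tips_Suc_small])
        show "\<beta> ` E \<subseteq> {..<8 ^ ack_exp (Suc i) j}" using E(4) True unfolding w_def l_def by auto
      qed
      also have "\<dots> \<le> \<phi> (Suc i) * card (f ` E) + \<phi> (Suc i) * 8 ^ j * m"
        by (rule tip_boundD[OF IH1[OF True] E])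
      also have "\<dots> \<le> \<phi> (Suc i) * card (f ` E) + \<phi> (Suc i) * 8 ^ Suc j * m" by simp
      finally show "card (tips f (Suc i) (Suc j) \<beta> E) \<le> \<phi> (Suc i) * card (f ` E) + \<phi> (Suc i) * 8 ^ Suc j * m" .
    qed
  next
    case False
    obtain M where M: "m \<le> w * M" "w * M \<le> 2 * m" "M \<le> 8 ^ ack_exp i l"
      using False 3(4) obtain_intervals[of w m "8 ^ ack_exp i l"] by (auto simp: w_def l_def power_add)
    define c where "c = M * (\<phi> (Suc i) * 8 ^ j * w + 2 * (\<phi>f (Suc i) * 8 ^ j * w)) + \<phi> i * 8 ^ l * M"
    have "c = (\<phi> (Suc i) * 8 ^ j + 2 * \<phi>f (Suc i) * 8 ^ j + \<phi> i) * (w * M)"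
      by (simp add: c_def w_def algebra_simps)
    also have "\<dots> \<le> (\<phi> (Suc i) * 8 ^ j + 2 * \<phi>f (Suc i) * 8 ^ j + \<phi> i * 8 ^ j) * (2 * m)"
      by (rule mult_le_mono[OF _ M(2)]) simp
    also have "\<dots> = (\<phi> (Suc i) + (2 * \<phi>f (Suc i) + \<phi> i)) * (8 ^ j * 2 * m)" by (simp add: algebra_simps)
    also have "\<dots> \<le> (\<phi> (Suc i) + \<phi> (Suc i)) * (8 ^ j * 2 * m)"
      using step[of i] by (intro mult_right_mono add_left_mono) auto
    also have "\<dots> \<le> \<phi> (Suc i) * 8 ^ Suc j * m" by (simp add: algebra_simps)
    finally have c: "c \<le> \<phi> (Suc i) * 8 ^ Suc j * m" .
    have "tip_bound f (Suc (Suc k)) (Suc i) (Suc j) (\<phi> (Suc i)) c (w * M)"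
      unfolding c_def
    proof (rule tip_bound_rec[OF IH1 fst _ w_def l_def _ k])
      show "tip_bound f (Suc (Suc k)) i l (\<phi> i) (\<phi> i * 8 ^ l * M) M"
        using 3(3)[of M] M(3) unfolding l_def by blast
      show "2 * \<phi>f (Suc i) + \<phi> i + 4 \<le> \<phi> (Suc i)" by (rule step)
    qed (auto simp: w_def l_def)
    then show ?thesis by (rule tip_bound_weaken) (use c M in auto)
  qed
qed

text \<open>For length 5 all occurrences are counted, with the linear factor \<open>mu3\<close>;
  each further letter sums over the rows once more, so \<open>phi6\<close> has degree 2 and
  \<open>phi7\<close> degree 3.\<close>

fun phi6 :: "nat \<Rightarrow> nat" where
  "phi6 0 = 8"
| "phi6 (Suc i) = phi6 i + 2 * mu3 (Suc i) + 4"

fun phi7 :: "nat \<Rightarrow> nat" where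
  "phi7 0 = 8"
| "phi7 (Suc i) = phi7 i + 2 * phi6 (Suc i) + 4"

lemma tip_bound_6:
  assumes "m \<le> 8 ^ ack_exp i j"
  shows "tip_bound f 6 i j (phi6 i) (phi6 i * 8 ^ j * m) m"
proof -
  have "8 \<le> phi6 i" for i by (induction i) auto
  then have "tip_bound f (Suc (Suc 4)) i j (phi6 i) (phi6 i * 8 ^ j * m) m"
    by (intro tip_bound_ack_induct[where \<phi>f = mu3, OF _ _ _ _ assms])
      (use size_bound_imp_tip_bound[OF size_bound_5] in auto)
  then show ?thesis by (simp add: eval_nat_numeral)
qed

lemma tip_bound_7:
  assumes "m \<le> 8 ^ ack_exp i j"
  shows "tip_bound f 7 i j (phi7 i) (phi7 i * 8 ^ j * m) m"
proof -
  have "8 \<le> phi7 i" for i by (induction i) auto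
  then have "tip_bound f (Suc (Suc 5)) i j (phi7 i) (phi7 i * 8 ^ j * m) m"
    by (intro tip_bound_ack_induct[where \<phi>f = phi6, OF _ _ _ _ assms])
      (use tip_bound_6 in auto)
  then show ?thesis by (simp add: eval_nat_numeral)
qed

section \<open>The blocked bound for alternations of length 7\<close>

text \<open>The summands belong to the labelled incidences, the two sides, and the tips; the
  \<open>+ 1\<close> leaves room for the additive error of the middles.\<close>

fun mu5 :: "nat \<Rightarrow> nat" where
  "mu5 0 = 8"
| "mu5 (Suc i) = 2 * mu5 i + 2 * mu4 (Suc i) + mu3 (Suc i) * (phi7 i + 1)"

lemma size_bound_fibre:
  fixes \<beta> :: "nat \<Rightarrow> nat"
  assumes "size_bound f k \<mu> c w" "finite E" "blocked f \<beta> E" "0 < w"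
    and "C \<subseteq> {p\<in>E. \<beta> p div w = q}" "alt_free f k C"
  shows "card C \<le> \<mu> * card (f ` C) + c"
proof (rule size_boundD[OF assms(1)])
  show "blocked f (\<lambda>p. \<beta> p mod w) C"
    by (rule blocked_mod[OF blocked_mono[OF assms(3)], where q = q]) (use assms(5) in auto)
qed (use assms in \<open>auto intro: finite_subset\<close>)

lemma size_bound_7:
  "m \<le> 8 ^ ack_exp i j \<Longrightarrow> size_bound f 7 (mu5 i) (mu5 i * 8 ^ j * m) m"
proof (induction i j arbitrary: m rule: ack_exp.induct)
  case (1 j)
  then show ?case by (intro size_bound_weaken[OF size_bound_trivial[of f _ m]]) auto
next
  case (2 i)
  have "8 \<le> mu5 i" for i by (induction i) auto
  with 2 show ?case by (intro size_bound_weaken[OF size_bound_trivial[of f _ m]]) auto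
next
  case (3 i j)
  define l where "l = ack_exp (Suc i) j"
  define w :: nat where "w = 8 ^ l"
  have w0: "0 < w" by (simp add: w_def)
  have w: "w \<le> 8 ^ ack_exp (Suc i) j" by (simp add: w_def l_def)
  have IH1: "size_bound f 7 (mu5 (Suc i)) (mu5 (Suc i) * 8 ^ j * m) m" if "m \<le> w" for m
    using 3(1) that unfolding w_def l_def by blast
  show ?case
  proof (cases "m \<le> w")
    case True
    then show ?thesis by (intro size_bound_weaken[OF IH1[OF True]]) auto
  next
    case False
    obtain M where M: "m \<le> w * M" "w * M \<le> 2 * m" "M \<le> 8 ^ ack_exp i l"
      using False 3(4) obtain_intervals[of w m "8 ^ ack_exp i l"] by (auto simp: w_def l_def power_add)
    define \<kappa> where "\<kappa> = mu3 (Suc i)"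
    define \<mu> where "\<mu> = mu5 (Suc i)"
    \<comment> \<open>The errors of the locals, of the two sides, of the contraction (doubled by the
      labelled expansion), of the tip count (times \<open>\<kappa>\<close>), and of the expansions
      themselves.\<close>
    define c where "c = M * (\<mu> * 8 ^ j * w) + 2 * (M * (mu4 (Suc i) * 8 ^ j * w)) + 2 * (mu5 i * w * M)
       + \<kappa> * (phi7 i * w * M) + (2 * (M * w) + M * (\<kappa> * 8 ^ j * w))"
    have \<mu>: "\<mu> = 2 * mu5 i + 2 * mu4 (Suc i) + \<kappa> * (phi7 i + 1)" by (simp add: \<mu>_def \<kappa>_def)
    have \<kappa>8: "8 \<le> \<kappa>" by (simp add: \<kappa>_def)
    have "c = (\<mu> * 8 ^ j + 2 * mu4 (Suc i) * 8 ^ j + 2 * mu5 i + \<kappa> * phi7 i + 2 + \<kappa> * 8 ^ j) * (w * M)"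
      by (simp add: c_def algebra_simps)
    also have "\<dots> \<le> (\<mu> * 8 ^ j + 2 * mu4 (Suc i) * 8 ^ j + 2 * mu5 i * 8 ^ j + \<kappa> * phi7 i * 8 ^ j + \<kappa> * 8 ^ j + \<kappa> * 8 ^ j) * (2 * m)"
    proof (rule mult_le_mono[OF _ M(2)])
      have "x \<le> x * 8 ^ j" for x :: nat by simp
      from this[of "2 * mu5 i"] this[of "\<kappa> * phi7 i"] this[of \<kappa>] \<kappa>8
      show "\<mu> * 8 ^ j + 2 * mu4 (Suc i) * 8 ^ j + 2 * mu5 i + \<kappa> * phi7 i + 2 + \<kappa> * 8 ^ j
        \<le> \<mu> * 8 ^ j + 2 * mu4 (Suc i) * 8 ^ j + 2 * mu5 i * 8 ^ j + \<kappa> * phi7 i * 8 ^ j + \<kappa> * 8 ^ j + \<kappa> * 8 ^ j"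
        by linarith
    qed
    also have "\<dots> = (\<mu> + (2 * mu5 i + 2 * mu4 (Suc i) + \<kappa> * (phi7 i + 1)) + \<kappa>) * (8 ^ j * 2 * m)"
      by (simp add: algebra_simps)
    also have "\<dots> \<le> (\<mu> + \<mu> + \<mu>) * (8 ^ j * 2 * m)"
      unfolding \<mu>[symmetric] by (intro mult_right_mono add_left_mono) (simp_all add: \<mu>)
    also have "\<dots> \<le> \<mu> * 8 ^ Suc j * m" by (simp add: algebra_simps)
    finally have c: "c \<le> \<mu> * 8 ^ Suc j * m" .
    have "size_bound f 7 \<mu> c (w * M)"
      unfolding size_bound_def
    proof (intro allI impI)
      fix E \<beta> assume E: "finite E" "blocked f \<beta> E" "alt_free f 7 E" "\<beta> ` E \<subseteq> {..<w * M}"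
      let ?\<gamma> = "\<lambda>p. \<beta> p div w"
      let ?G = "card (f ` globals f ?\<gamma> E)" and ?L = "card (f ` locals f ?\<gamma> E)"
      let ?D = "contract f ?\<gamma> (globals f ?\<gamma> E)"
      have E3: "alt_free f (Suc (Suc 5)) E" using E(3) by simp
      have mono: "mono_blocks ?\<gamma> E" using E(2) mono_blocks_div unfolding blocked_def by blast
      have ran: "?\<gamma> ` E \<subseteq> {..<M}" by (rule image_div_subset[OF E(4) w0])
      have sb7: "size_bound f (Suc (Suc 5)) \<mu> (\<mu> * 8 ^ j * w) w" using IH1[of w] by (simp add: \<mu>_def)
      have sb6: "size_bound f (Suc 5) (mu4 (Suc i)) (mu4 (Suc i) * 8 ^ j * w) w" using size_bound_6[OF w] by simp
      have two: "2 \<le> (5::nat)" by simp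
      note cls = size_bound_classes[OF E(1,2) E3 E(4) w0 two sb7 sb6]
      have pairs: "card ((\<lambda>p. (f p, ?\<gamma> p)) ` globals f ?\<gamma> E) \<le> mu5 i * ?G + mu5 i * w * M"
      proof (rule card_pairs_globals[OF _ E(1) mono E(3) ran])
        show "size_bound f 7 (mu5 i) (mu5 i * w * M) M"
          using 3(3)[of M] M(3) by (simp add: w_def l_def)
      qed
      have sub: "?D \<subseteq> E" using contract_subset[of f ?\<gamma> "globals f ?\<gamma> E"] class_subset(5)[of f ?\<gamma> E] by blast
      \<comment> \<open>The labels of the middles are taken in row \<open>i\<close> and column
        \<open>l\<close>, the place of the contraction in the recursion, so this bound counts
        exactly those tips.\<close>
      have tb: "tip_bound f 7 i l (phi7 i) (phi7 i * w * M) M" using tip_bound_7[OF M(3)] by (simp add: w_def)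
      have "card (tips f i l ?\<gamma> ?D) \<le> phi7 i * card (f ` ?D) + phi7 i * w * M"
      proof (rule tip_boundD[OF tb])
        show "finite ?D" using E(1) sub finite_subset by blast
        show "blocked f ?\<gamma> ?D" by (rule contract_blocked[OF mono_blocks_mono[OF mono class_subset(5)]])
        show "alt_free f 7 ?D" by (rule alt_free_mono[OF E(3) sub])
        show "?\<gamma> ` ?D \<subseteq> {..<M}" using ran sub by blast
      qed
      then have tips: "card (tips f i l ?\<gamma> ?D) \<le> phi7 i * ?G + phi7 i * w * M" by (simp add: contract_symbols)
      have "card (middles f ?\<gamma> E) \<le> 2 * card ((\<lambda>p. (f p, ?\<gamma> p)) ` globals f ?\<gamma> E)
        + \<kappa> * card (tips f i l ?\<gamma> ?D) + (2 * (\<Sum>q<M. w) + (\<Sum>q<M. \<kappa> * 8 ^ j * w))"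
      proof (rule card_middles_7[OF E(1) mono E(3) ran])
        show "card C \<le> 2 * card (f ` C) + w" if "C \<subseteq> {p \<in> E. \<beta> p div w = q}" "alt_free f 4 C" for q C
          by (rule size_bound_fibre[OF size_bound_4 E(1,2) w0 that])
        show "card C \<le> \<kappa> * card (f ` C) + \<kappa> * 8 ^ j * w" if "C \<subseteq> {p \<in> E. \<beta> p div w = q}" "alt_free f 5 C" for q C
          unfolding \<kappa>_def by (rule size_bound_fibre[OF size_bound_5[OF w] E(1,2) w0 that])
      qed
      also have "\<dots> \<le> 2 * (mu5 i * ?G + mu5 i * w * M) + \<kappa> * (phi7 i * ?G + phi7 i * w * M) + (2 * (M * w) + M * (\<kappa> * 8 ^ j * w))"
        using pairs tips by (intro add_mono mult_left_mono) auto
      finally have mid: "card (middles f ?\<gamma> E) \<le> \<dots>" .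
      have "card E \<le> (\<mu> * ?L + M * (\<mu> * 8 ^ j * w)) + (mu4 (Suc i) * ?G + M * (mu4 (Suc i) * 8 ^ j * w))
          + (mu4 (Suc i) * ?G + M * (mu4 (Suc i) * 8 ^ j * w))
          + (2 * (mu5 i * ?G + mu5 i * w * M) + \<kappa> * (phi7 i * ?G + phi7 i * w * M) + (2 * (M * w) + M * (\<kappa> * 8 ^ j * w)))"
        using card_classes_le[of E f ?\<gamma>] cls mid by linarith
      also have "\<dots> = \<mu> * ?L + (2 * mu4 (Suc i) + 2 * mu5 i + \<kappa> * phi7 i) * ?G + c"
        unfolding c_def by (simp add: algebra_simps)
      also have "\<dots> \<le> \<mu> * ?L + \<mu> * ?G + c"
        by (intro add_mono mult_right_mono) (simp_all add: \<mu>)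
      also have "\<dots> = \<mu> * card (f ` E) + c"
        unfolding card_symbols_split[OF E(1), of f ?\<gamma>] by (simp add: algebra_simps)
      finally show "card E \<le> \<mu> * card (f ` E) + c" .
    qed
    then show ?thesis unfolding \<mu>_def by (rule size_bound_weaken) (use c M \<mu>_def in auto)
  qed
qed

section \<open>Sequences without adjacent equal symbols\<close>

definition no_adj :: "(nat \<Rightarrow> 'a) \<Rightarrow> nat set \<Rightarrow> bool" where
  "no_adj f E \<longleftrightarrow> (\<forall>x\<in>E. \<forall>y\<in>E. x < y \<and> (\<forall>z\<in>E. \<not> (x < z \<and> z < y)) \<longrightarrow> f x \<noteq> f y)"

text \<open>Intervals are extended as long as \<open>P\<close> holds, so each completed interval
  violates \<open>P\<close> together with the first position of the next one.\<close>

lemma greedy_partition: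
  assumes "finite E" and P0: "P {}" and P1: "\<And>p. P {p}"
  shows "\<exists>\<gamma> Q. mono_blocks \<gamma> E \<and> \<gamma> ` E \<subseteq> {..<Q} \<and> (\<forall>q. P {p\<in>E. \<gamma> p = q}) \<and>
    (\<forall>q. Suc q < Q \<longrightarrow> (\<exists>p\<in>E. \<gamma> p = Suc q \<and> (\<forall>r\<in>E. \<gamma> r = Suc q \<longrightarrow> p \<le> r) \<and> \<not> P (insert p {r\<in>E. \<gamma> r = q})))"
  using assms(1)
proof (induction E rule: finite_linorder_max_induct)
  case empty
  show ?case by (rule exI[of _ "\<lambda>_. 0"], rule exI[of _ 0]) (simp add: mono_blocks_def P0)
next
  case (insert b A)
  then obtain \<gamma> Q where IH: "mono_blocks \<gamma> A" "\<gamma> ` A \<subseteq> {..<Q}" "\<forall>q. P {p\<in>A. \<gamma> p = q}"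
    "\<And>q. Suc q < Q \<Longrightarrow> \<exists>p\<in>A. \<gamma> p = Suc q \<and> (\<forall>r\<in>A. \<gamma> r = Suc q \<longrightarrow> p \<le> r) \<and> \<not> P (insert p {r\<in>A. \<gamma> r = q})"
    by blast
  have bA: "b \<notin> A" using insert(2) by auto
  show ?case
  proof (cases "0 < Q \<and> P (insert b {r\<in>A. \<gamma> r = Q - 1})")
    case True
    let ?\<gamma> = "\<gamma>(b := Q - 1)"
    have cls: "{p\<in>insert b A. ?\<gamma> p = q} = (if q = Q - 1 then insert b {p\<in>A. \<gamma> p = q} else {p\<in>A. \<gamma> p = q})" for q
      using bA by auto
    show ?thesis
    proof (intro exI conjI allI impI)
      show "mono_blocks ?\<gamma> (insert b A)"
        using IH(1,2) insert(2) bA unfolding mono_blocks_def by fastforce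
      show "?\<gamma> ` insert b A \<subseteq> {..<Q}" using IH(2) True bA by auto
      show "P {p\<in>insert b A. ?\<gamma> p = q}" for q using True IH(3) unfolding cls by simp
      fix q assume q: "Suc q < Q"
      obtain p where p: "p \<in> A" "\<gamma> p = Suc q" "\<forall>r\<in>A. \<gamma> r = Suc q \<longrightarrow> p \<le> r" "\<not> P (insert p {r\<in>A. \<gamma> r = q})"
        using IH(4)[OF q] by blast
      have "q \<noteq> Q - 1" using q by simp
      then have "{r\<in>insert b A. ?\<gamma> r = q} = {r\<in>A. \<gamma> r = q}" unfolding cls by (simp only: if_False)
      moreover have "p \<noteq> b" "p < b" using p(1) bA insert(2) by auto
      ultimately show "\<exists>p\<in>insert b A. ?\<gamma> p = Suc q \<and> (\<forall>r\<in>insert b A. ?\<gamma> r = Suc q \<longrightarrow> p \<le> r)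
          \<and> \<not> P (insert p {r\<in>insert b A. ?\<gamma> r = q})"
        using p by (intro bexI[of _ p]) auto
    qed
  next
    case False
    let ?\<gamma> = "\<gamma>(b := Q)"
    have cls: "{p\<in>insert b A. ?\<gamma> p = q} = (if q = Q then insert b {p\<in>A. \<gamma> p = q} else {p\<in>A. \<gamma> p = q})" for q
      using bA by auto
    have eQ: "{p\<in>A. \<gamma> p = Q} = {}" using IH(2) by auto
    show ?thesis
    proof (intro exI conjI allI impI)
      show "mono_blocks ?\<gamma> (insert b A)"
        using IH(1,2) insert(2) bA unfolding mono_blocks_def by fastforce
      show "?\<gamma> ` insert b A \<subseteq> {..<Suc Q}" using IH(2) bA by auto
      show "P {p\<in>insert b A. ?\<gamma> p = q}" for q
      proof (cases "q = Q")
        case True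
        then show ?thesis using P1[of b] unfolding cls True eQ by simp
      next
        case False
        then show ?thesis using IH(3) unfolding cls by simp
      qed
      fix q assume q: "Suc q < Suc Q"
      have c1: "{r\<in>insert b A. ?\<gamma> r = q} = {r\<in>A. \<gamma> r = q}" using q unfolding cls by (simp only: less_Suc_eq) auto
      show "\<exists>p\<in>insert b A. ?\<gamma> p = Suc q \<and> (\<forall>r\<in>insert b A. ?\<gamma> r = Suc q \<longrightarrow> p \<le> r)
          \<and> \<not> P (insert p {r\<in>insert b A. ?\<gamma> r = q})"
      proof (cases "Suc q < Q")
        case True
        obtain p where p: "p \<in> A" "\<gamma> p = Suc q" "\<forall>r\<in>A. \<gamma> r = Suc q \<longrightarrow> p \<le> r" "\<not> P (insert p {r\<in>A. \<gamma> r = q})"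
          using IH(4)[OF True] by blast
        moreover have "p \<noteq> b" "p < b" using p(1) bA insert(2) by auto
        ultimately show ?thesis using c1 by (intro bexI[of _ p]) auto
      next
        case F: False
        then have "Q = Suc q" using q by simp
        then show ?thesis using c1 False eQ by (intro bexI[of _ b]) auto
      qed
    qed
  qed
qed

text \<open>Interval \<open>q\<close> is charged to the symbol of its chosen position. It is the
  first or the last interval of that symbol, so every symbol is charged at most twice.\<close>

lemma intervals_le:
  assumes "finite E"
    and "\<And>q. q < Q \<Longrightarrow> \<exists>p\<in>E. \<gamma> p = q \<and> (\<not> has_before f \<gamma> E p \<or> \<not> has_after f \<gamma> E p)"
  shows "Q \<le> 2 * card (f ` E)"
proof -
  obtain h where h: "\<And>q. q < Q \<Longrightarrow> h q \<in> E \<and> \<gamma> (h q) = q \<and> (\<not> has_before f \<gamma> E (h q) \<or> \<not> has_after f \<gamma> E (h q))"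
    using assms(2) by metis
  define A where "A = {q. q < Q \<and> \<not> has_before f \<gamma> E (h q)}"
  define B where "B = {q. q < Q \<and> \<not> has_after f \<gamma> E (h q)}"
  have *: "has_before f \<gamma> E (h r)" "has_after f \<gamma> E (h q)" if "q < r" "q < Q" "r < Q" "f (h q) = f (h r)" for q r
    using that h[of q] h[of r] unfolding has_before_def has_after_def by auto
  have "inj_on (\<lambda>q. f (h q)) A"
  proof (rule inj_onI)
    fix q r assume "q \<in> A" "r \<in> A" "f (h q) = f (h r)"
    then show "q = r" using *(1)[of q r] *(1)[of r q] unfolding A_def by (cases q r rule: linorder_cases) auto
  qed
  then have 1: "card A \<le> card (f ` E)" using assms(1) h by (intro card_inj_on_le[of "\<lambda>q. f (h q)"]) (auto simp: A_def)
  have "inj_on (\<lambda>q. f (h q)) B"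
  proof (rule inj_onI)
    fix q r assume "q \<in> B" "r \<in> B" "f (h q) = f (h r)"
    then show "q = r" using *(2)[of q r] *(2)[of r q] unfolding B_def by (cases q r rule: linorder_cases) auto
  qed
  then have 2: "card B \<le> card (f ` E)" using assms(1) h by (intro card_inj_on_le[of "\<lambda>q. f (h q)"]) (auto simp: B_def)
  have "{..<Q} = A \<union> B" using h unfolding A_def B_def by auto
  then have "Q \<le> card (A \<union> B)" by (metis card_lessThan order_refl)
  then show ?thesis using 1 2 card_Un_le[of A B] by simp
qed

text \<open>The maximum can only serve as the last letter, which is \<open>a\<close> for odd and
  \<open>b\<close> for even length.\<close>

lemma alt_insert_max:
  assumes "alt f k a b (insert p C)" "\<forall>r\<in>C. r < p" "f p \<noteq> (if odd k then a else b)"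
  shows "alt f k a b C"
  using assms
proof (induction k arbitrary: a b C)
  case (Suc k)
  obtain x where x: "x \<in> insert p C" "f x = a" "alt f k b a {r\<in>insert p C. x < r}" using Suc.prems(1) by auto
  show ?case
  proof (cases "x = p")
    case True
    then have e: "{r\<in>insert p C. x < r} = {}" using Suc.prems(2) by auto
    have "k = 0"
    proof (cases k)
      case (Suc k')
      then show ?thesis using x(3) unfolding e by simp
    qed
    then show ?thesis using Suc.prems(3) True x(2) by simp
  next
    case False
    then have xC: "x \<in> C" "x < p" using x(1) Suc.prems(2) by auto
    then have "{r\<in>insert p C. x < r} = insert p {r\<in>C. x < r}" by auto
    then have "alt f k b a (insert p {r\<in>C. x < r})" using x(3) by simp
    then have "alt f k b a {r\<in>C. x < r}"
      by (rule Suc.IH) (use Suc.prems in auto)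
    with xC(1) x(2) show ?thesis by (rule alt_SucI)
  qed
qed simp

lemma alt_free_empty: "alt_free f (Suc k) {}"
  unfolding alt_free_def by simp

lemma alt_free_singleton: "2 \<le> k \<Longrightarrow> alt_free f k {p}"
  unfolding alt_free_def using alt_both by fastforce

text \<open>The cut before \<open>p\<close> is caused by an a b a b a that ends in \<open>p\<close>.
  If \<open>b\<close> also occurred in an earlier and in a later interval, it could be added on both
  sides, giving length 7. So every interval but the last is the first or last one of some
  symbol.\<close>

lemma alt_free_5_intervals:
  assumes "finite E" "alt_free f 7 E"
  obtains \<gamma> M where "mono_blocks \<gamma> E" "\<gamma> ` E \<subseteq> {..<M}" "M \<le> 2 * card (f ` E) + 1"
    "\<And>q. alt_free f 5 {p\<in>E. \<gamma> p = q}"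
proof -
  have "alt_free f 5 {}" using alt_free_empty[of f 4] by simp
  then obtain \<gamma> Q where \<gamma>: "mono_blocks \<gamma> E" "\<gamma> ` E \<subseteq> {..<Q}" "\<forall>q. alt_free f 5 {p\<in>E. \<gamma> p = q}"
    and cut: "\<forall>q. Suc q < Q \<longrightarrow> (\<exists>p\<in>E. \<gamma> p = Suc q \<and> (\<forall>r\<in>E. \<gamma> r = Suc q \<longrightarrow> p \<le> r)
      \<and> \<not> alt_free f 5 (insert p {r\<in>E. \<gamma> r = q}))"
    using greedy_partition[OF assms(1), of "alt_free f 5"] alt_free_singleton[of 5 f] by auto
  have "Q - 1 \<le> 2 * card (f ` E)"
  proof (rule intervals_le[OF assms(1)])
    fix q assume "q < Q - 1"
    then obtain p where p: "p \<in> E" "\<gamma> p = Suc q" "\<forall>r\<in>E. \<gamma> r = Suc q \<longrightarrow> p \<le> r"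
      "\<not> alt_free f 5 (insert p {r\<in>E. \<gamma> r = q})" using cut by (metis Suc_eq_plus1 less_diff_conv)
    let ?C = "{r\<in>E. \<gamma> r = q}"
    obtain a b where ab: "a \<noteq> b" "alt f 5 a b (insert p ?C)" using p(4) unfolding alt_free_def by blast
    have max: "\<forall>r\<in>?C. r < p" using mono_blocksD[OF \<gamma>(1) _ p(1)] p(2) by auto
    have "\<not> alt f 5 a b ?C" using alt_freeD[OF spec[OF \<gamma>(3)] ab(1)] .
    then have fp: "f p = a" using alt_insert_max[OF ab(2) max] by auto
    obtain t where t: "t \<in> ?C" "f t = b" using alt_both[OF ab(2)] fp ab(1) by auto
    have "\<not> has_before f \<gamma> E t \<or> \<not> has_after f \<gamma> E t"
    proof (rule ccontr)
      assume "\<not> ?thesis"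
      then obtain y z where y: "y \<in> E" "f y = b" "\<gamma> y < q" and z: "z \<in> E" "f z = b" "q < \<gamma> z"
        using t unfolding has_before_def has_after_def by auto
      have lt: "s < t" if "s \<in> E" "t \<in> E" "\<gamma> s < \<gamma> t" for s t using mono_blocksD[OF \<gamma>(1) that] .
      have yC: "\<forall>r\<in>insert p ?C. y < r" using lt[OF y(1)] y(3) p(1,2) by auto
      have "p < z"
      \<comment> \<open>An occurrence of \<open>b\<close> in the next interval comes after
        \<open>p\<close>, because \<open>p\<close> is the first position there and carries
        \<open>a\<close>.\<close>
      proof (cases "\<gamma> z = Suc q")
        case True
        then have "p \<le> z" "p \<noteq> z" using p(3) z fp ab(1) by auto
        then show ?thesis by simp
      next
        case False
        then show ?thesis using lt[OF p(1) z(1)] z(3) p(2) by simp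
      qed
      then have zC: "\<forall>r\<in>insert y (insert p ?C). r < z" using lt[OF _ z(1)] z(3) y p by auto
      have 1: "alt f (Suc 5) b a (insert y (insert p ?C))"
        by (rule alt_cons[OF ab(2), where z = y]) (use yC y in auto)
      have "alt f (Suc (Suc 5)) b a E"
        by (rule alt_snoc[OF 1, where z = z]) (use zC z y p in auto)
      moreover have "alt_free f (Suc (Suc 5)) E" using assms(2) by simp
      ultimately show False using alt_freeD[of f "Suc (Suc 5)" E b a] ab(1) by metis
    qed
    then show "\<exists>p\<in>E. \<gamma> p = q \<and> (\<not> has_before f \<gamma> E p \<or> \<not> has_after f \<gamma> E p)" using t by blast
  qed
  then have "Q \<le> 2 * card (f ` E) + 1" by simp
  then show ?thesis using that[OF \<gamma>(1,2)] \<gamma>(3) by blast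
qed

text \<open>A cut before \<open>p\<close> is caused by an \<open>x\<close> with the symbol of
  \<open>p\<close>. The successor \<open>t\<close> of \<open>x\<close> has another symbol and lies
  between them; if that symbol occurred in an earlier and in a later block, it would alternate with
  \<open>x\<close> and \<open>p\<close> in length 5.\<close>

lemma alt_free_5_blocks:
  assumes "finite E" "alt_free f 5 E" "no_adj f E"
  obtains \<beta> M where "blocked f \<beta> E" "\<beta> ` E \<subseteq> {..<M}" "M \<le> 2 * card (f ` E) + 1"
proof -
  obtain \<gamma> Q where \<gamma>: "mono_blocks \<gamma> E" "\<gamma> ` E \<subseteq> {..<Q}" "\<forall>q. inj_on f {p\<in>E. \<gamma> p = q}"
    and cut: "\<forall>q. Suc q < Q \<longrightarrow> (\<exists>p\<in>E. \<gamma> p = Suc q \<and> (\<forall>r\<in>E. \<gamma> r = Suc q \<longrightarrow> p \<le> r)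
      \<and> \<not> inj_on f (insert p {r\<in>E. \<gamma> r = q}))"
    using greedy_partition[OF assms(1), of "inj_on f"] by auto
  have lt: "s < t" if "s \<in> E" "t \<in> E" "\<gamma> s < \<gamma> t" for s t using mono_blocksD[OF \<gamma>(1) that] .
  have le: "\<gamma> s \<le> \<gamma> t" if "s \<in> E" "t \<in> E" "s < t" for s t using \<gamma>(1) that unfolding mono_blocks_def by blast
  have "Q - 1 \<le> 2 * card (f ` E)"
  proof (rule intervals_le[OF assms(1)])
    fix q assume "q < Q - 1"
    then obtain p where p: "p \<in> E" "\<gamma> p = Suc q" "\<forall>r\<in>E. \<gamma> r = Suc q \<longrightarrow> p \<le> r"
      "\<not> inj_on f (insert p {r\<in>E. \<gamma> r = q})" using cut by (metis Suc_eq_plus1 less_diff_conv)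
    let ?C = "{r\<in>E. \<gamma> r = q}"
    have "f p \<in> f ` (?C - {p})" using p(4) spec[OF \<gamma>(3), of q] by (auto simp: inj_on_insert)
    then obtain x where "f p = f x" "x \<in> ?C - {p}" by (rule imageE)
    then have x: "x \<in> E" "\<gamma> x = q" "f x = f p" by simp_all
    have xp: "x < p" using lt[OF x(1) p(1)] x p by simp
    define t where "t = (LEAST t. t \<in> E \<and> x < t)"
    have t: "t \<in> E" "x < t" using LeastI[of "\<lambda>t. t \<in> E \<and> x < t" p] p(1) xp unfolding t_def by auto
    have tl: "t \<le> z" if "z \<in> E" "x < z" for z using that unfolding t_def by (intro Least_le) simp
    have "f x \<noteq> f t" using assms(3) x(1) t tl unfolding no_adj_def by (metis not_le)
    then have "t \<noteq> p" using x(3) by auto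
    then have tp: "t < p" using tl[OF p(1) xp] by simp
    have \<gamma>t: "\<gamma> t = q"
      using le[OF x(1) t] le[OF t(1) p(1) tp] x(2) p(2,3) tp t(1) by (metis le_SucE le_antisym not_le)
    have "\<not> has_before f \<gamma> E t \<or> \<not> has_after f \<gamma> E t"
    proof (rule ccontr)
      assume "\<not> ?thesis"
      then obtain y z where y: "y \<in> E" "f y = f t" "\<gamma> y < q" and z: "z \<in> E" "f z = f t" "q < \<gamma> z"
        using \<gamma>t unfolding has_before_def has_after_def by auto
      have "p < z"
      proof (cases "\<gamma> z = Suc q")
        case True
        then have "p \<le> z" "p \<noteq> z" using p(3) z x(3) \<open>f x \<noteq> f t\<close> by auto
        then show ?thesis by simp
      next
        case False
        then show ?thesis using lt[OF p(1) z(1)] z(3) p(2) by simp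
      qed
      moreover have "y < x" using lt[OF y(1) x(1)] y x by simp
      ultimately have "alt f 4 (f x) (f t) {r\<in>E. y < r}"
        by (intro alt_4I[where w = x and x = t and y = p and z = z]) (use x t tp p z in auto)
      with y(1,2) have "alt f (Suc 4) (f t) (f x) E" by (rule alt_SucI)
      moreover have "alt_free f (Suc 4) E" using assms(2) by simp
      ultimately show False using alt_freeD[of f "Suc 4" E "f t" "f x"] \<open>f x \<noteq> f t\<close> by metis
    qed
    then show "\<exists>p\<in>E. \<gamma> p = q \<and> (\<not> has_before f \<gamma> E p \<or> \<not> has_after f \<gamma> E p)" using t \<gamma>t by blast
  qed
  then have "Q \<le> 2 * card (f ` E) + 1" by simp
  moreover have "blocked f \<gamma> E"
    unfolding blocked_def using \<gamma>(1,3) by (auto simp: inj_on_def)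
  ultimately show ?thesis using that \<gamma>(2) by blast
qed

text \<open>Positions that repeat their predecessor are deleted. A block contains at most one: for
  the second, the predecessor would lie in the same block.\<close>

lemma obtain_no_adj_subset:
  assumes "finite E" "blocked f \<beta> E" "\<beta> ` E \<subseteq> {..<M}"
  obtains D where "D \<subseteq> E" "no_adj f D" "card E \<le> card D + M"
proof -
  define R where "R = {p\<in>E. \<exists>r\<in>E. r < p \<and> f r = f p \<and> (\<forall>z\<in>E. \<not> (r < z \<and> z < p))}"
  have "inj_on \<beta> R"
  proof (rule inj_onI)
    have *: False if pr: "p \<in> R" "r \<in> R" "\<beta> p = \<beta> r" "p < r" for p r
    proof -
      obtain s where s: "s \<in> E" "s < r" "f s = f r" "\<forall>z\<in>E. \<not> (s < z \<and> z < r)" using pr(2) unfolding R_def by blast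
      have E: "p \<in> E" "r \<in> E" using pr unfolding R_def by auto
      have "p \<le> s" using s(4) E(1) pr(4) by (metis not_le)
      then have "\<beta> p \<le> \<beta> s" using assms(2) E(1) s(1) unfolding blocked_def mono_blocks_def by (metis le_eq_less_or_eq)
      moreover have "\<beta> s \<le> \<beta> r" using assms(2) E(2) s(1,2) unfolding blocked_def mono_blocks_def by blast
      ultimately have "\<beta> s = \<beta> r" using pr(3) by simp
      then have "s = r" using assms(2) s E(2) unfolding blocked_def by blast
      then show False using s(2) by simp
    qed
    fix p r assume "p \<in> R" "r \<in> R" "\<beta> p = \<beta> r"
    then show "p = r" using *[of p r] *[of r p] by (cases p r rule: linorder_cases) auto
  qed
  moreover have RE: "R \<subseteq> E" unfolding R_def by auto
  ultimately have "card R \<le> card {..<M}" using assms(3) by (intro card_inj_on_le[of \<beta>]) auto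
  then have "card E \<le> card (E - R) + M"
    using assms(1) RE by (simp add: card_Diff_subset finite_subset)
  moreover have "no_adj f (E - R)"
    unfolding no_adj_def
  proof (intro ballI impI notI)
    fix x y assume x: "x \<in> E - R" and y: "y \<in> E - R" and xy: "x < y \<and> (\<forall>z\<in>E - R. \<not> (x < z \<and> z < y))"
      and eq: "f x = f y"
    \<comment> \<open>If \<open>t\<close> lies before \<open>y\<close>, it was deleted, so its
      predecessor has the same symbol and is a smaller candidate; otherwise only the symbol of
      \<open>x\<close> occurs up to \<open>y\<close>, and \<open>y\<close> itself was
      deleted.\<close>
    define t where "t = (LEAST t. t \<in> E \<and> x < t \<and> f t \<noteq> f x)"
    show False
    proof (cases "\<exists>t\<in>E. x < t \<and> t < y \<and> f t \<noteq> f x")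
      case True
      then obtain t0 where t0: "t0 \<in> E" "x < t0" "t0 < y" "f t0 \<noteq> f x" by blast
      have t: "t \<in> E \<and> x < t \<and> f t \<noteq> f x"
        unfolding t_def by (rule LeastI[of _ t0]) (use t0 in auto)
      have tl: "t \<le> z" if "z \<in> E" "x < z" "f z \<noteq> f x" for z using that unfolding t_def by (intro Least_le) simp
      have "t < y" using tl[OF t0(1,2,4)] t0(3) by simp
      then have "t \<in> R" using xy t by blast
      then obtain r where r: "r \<in> E" "r < t" "f r = f t" "\<forall>z\<in>E. \<not> (r < z \<and> z < t)" unfolding R_def by blast
      have "x \<le> r" using r(4) x t by (metis DiffD1 not_le)
      moreover have "x \<noteq> r" using r(3) t by auto
      ultimately have "t \<le> r" using tl[OF r(1)] r(3) t by simp
      then show False using r(2) by simp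
    next
      case False
      define s where "s = Max {s\<in>E. s < y}"
      have fin: "finite {s\<in>E. s < y}" using assms(1) by simp
      have xs: "x \<in> {s\<in>E. s < y}" using x xy by auto
      have s: "s \<in> {s\<in>E. s < y}" unfolding s_def using Max_in[OF fin] xs by blast
      have sm: "z \<le> s" if "z \<in> E" "z < y" for z unfolding s_def using that fin by simp
      have "x \<le> s" using sm xs by simp
      then have "f s = f y" using False s eq by (cases "x = s") auto
      then have "y \<in> R" unfolding R_def using s sm y by (force simp: not_le)
      then show False using y by simp
    qed
  qed
  ultimately show ?thesis using that[of "E - R"] by blast
qed

section \<open>Bounds in terms of the symbols alone\<close>

text \<open>\<open>M\<close> must have coefficient 1: in \<open>card_le_sparse\<close> the blocks of
  all intervals together are bounded only by order \<open>mu5 i * n\<close>, and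
  \<open>size_bound_5\<close> would multiply this by \<open>mu3 i\<close>. So the given blocks only
  pay for deleting repetitions; the rest is cut into at most \<open>2n + 1\<close>, hence
  \<open>3n\<close>, new blocks.\<close>

lemma card_le_alt_free_5:
  assumes "finite E" "blocked f \<beta> E" "\<beta> ` E \<subseteq> {..<M}" "alt_free f 5 E"
    and "2 * card (f ` E) + 1 \<le> 8 ^ ack_exp i j"
  shows "card E \<le> mu3 i * (1 + 3 * 8 ^ j) * card (f ` E) + M"
proof -
  obtain D where D: "D \<subseteq> E" "no_adj f D" "card E \<le> card D + M" using obtain_no_adj_subset[OF assms(1-3)] .
  have fin: "finite D" using D(1) assms(1) finite_subset by blast
  have nD: "card (f ` D) \<le> card (f ` E)" using D(1) assms(1) by (intro card_mono image_mono) auto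
  have free: "alt_free f 5 D" by (rule alt_free_mono[OF assms(4) D(1)])
  have "card D \<le> mu3 i * (1 + 3 * 8 ^ j) * card (f ` D)"
  proof (cases "D = {}")
    case False
    obtain \<delta> K where K: "blocked f \<delta> D" "\<delta> ` D \<subseteq> {..<K}" "K \<le> 2 * card (f ` D) + 1"
      using alt_free_5_blocks[OF fin free D(2)] .
    have n1: "1 \<le> card (f ` D)" using False fin by (simp add: Suc_le_eq card_gt_0_iff)
    have "K \<le> 8 ^ ack_exp i j" using K(3) nD assms(5) by simp
    then have "card D \<le> mu3 i * card (f ` D) + mu3 i * 8 ^ j * K"
      by (rule size_boundD[OF size_bound_5 fin K(1) free K(2)])
    also have "\<dots> \<le> mu3 i * card (f ` D) + mu3 i * 8 ^ j * (3 * card (f ` D))"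
      using K(3) n1 by (intro add_left_mono mult_left_mono) auto
    also have "\<dots> = mu3 i * (1 + 3 * 8 ^ j) * card (f ` D)" by (simp add: algebra_simps del: mu3.simps)
    finally show ?thesis .
  qed simp
  also have "\<dots> \<le> mu3 i * (1 + 3 * 8 ^ j) * card (f ` E)" by (rule mult_left_mono[OF nD]) simp
  finally show ?thesis using D(3) by simp
qed

text \<open>In \<open>card_le_sparse\<close> the total number of blocks \<open>S\<close> enters six
  times, once for each of three classes and three times for the middles. With
  \<open>S \<le> 2 * N + M\<close>, \<open>M \<le> 3 * n\<close> and another \<open>2 * N\<close>
  for labelled incidences this gives 14 and 18.\<close>

definition sparse_factor :: "nat \<Rightarrow> nat \<Rightarrow> nat" where
  "sparse_factor i j = (let t = 1 + 3 * 8 ^ j; \<kappa> = mu3 i * t in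
     2 * \<kappa> + 14 * (mu5 i * t) + 18 + \<kappa> * (phi7 i * t))"

lemma no_adj_interval:
  assumes "no_adj f E" "mono_blocks \<gamma> E"
  shows "no_adj f {p\<in>E. \<gamma> p = q}"
  unfolding no_adj_def
proof (intro ballI impI)
  fix x y assume xy: "x \<in> {p\<in>E. \<gamma> p = q}" "y \<in> {p\<in>E. \<gamma> p = q}"
    "x < y \<and> (\<forall>z\<in>{p\<in>E. \<gamma> p = q}. \<not> (x < z \<and> z < y))"
  have "\<not> (x < z \<and> z < y)" if "z \<in> E" for z
  proof
    assume z: "x < z \<and> z < y"
    then have "\<gamma> x \<le> \<gamma> z" "\<gamma> z \<le> \<gamma> y" using assms(2) xy that unfolding mono_blocks_def by blast+
    then show False using xy z that by auto
  qed
  then show "f x \<noteq> f y" using assms(1) xy unfolding no_adj_def by blast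
qed

lemma card_le_sparse:
  assumes "finite E" "no_adj f E" "alt_free f 7 E" and small: "2 * card (f ` E) + 1 \<le> 8 ^ ack_exp i j"
  shows "card E \<le> sparse_factor i j * card (f ` E)"
proof (cases "E = {}")
  case False
  define n where "n = card (f ` E)"
  have n1: "1 \<le> n" using False assms(1) by (simp add: n_def Suc_le_eq card_gt_0_iff)
  define t :: nat where "t = 1 + 3 * 8 ^ j"
  define \<kappa> where "\<kappa> = mu3 i * t"
  obtain \<gamma> M where \<gamma>: "mono_blocks \<gamma> E" "\<gamma> ` E \<subseteq> {..<M}" "M \<le> 2 * n + 1" "\<And>q. alt_free f 5 {p\<in>E. \<gamma> p = q}"
    using alt_free_5_intervals[OF assms(1,3)] unfolding n_def by metis
  have M3: "M \<le> 3 * n" using \<gamma>(3) n1 by simp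
  have M8: "M \<le> 8 ^ ack_exp i j" using \<gamma>(3) small unfolding n_def by simp
  let ?N = "\<lambda>q. card (f ` {p\<in>E. \<gamma> p = q})"
  have "\<forall>q. \<exists>\<beta>. \<exists>K. blocked f \<beta> {p\<in>E. \<gamma> p = q} \<and> \<beta> ` {p\<in>E. \<gamma> p = q} \<subseteq> {..<K} \<and> K \<le> 2 * ?N q + 1"
  proof
    fix q
    have "finite {p\<in>E. \<gamma> p = q}" using assms(1) by simp
    then obtain \<beta> K where "blocked f \<beta> {p\<in>E. \<gamma> p = q}" "\<beta> ` {p\<in>E. \<gamma> p = q} \<subseteq> {..<K}" "K \<le> 2 * ?N q + 1"
      by (rule alt_free_5_blocks[OF _ \<gamma>(4) no_adj_interval[OF assms(2) \<gamma>(1)]])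
    then show "\<exists>\<beta>. \<exists>K. blocked f \<beta> {p\<in>E. \<gamma> p = q} \<and> \<beta> ` {p\<in>E. \<gamma> p = q} \<subseteq> {..<K} \<and> K \<le> 2 * ?N q + 1"
      by (intro exI conjI)
  qed
  then obtain \<beta> where "\<forall>q. \<exists>K. blocked f (\<beta> q) {p\<in>E. \<gamma> p = q} \<and> \<beta> q ` {p\<in>E. \<gamma> p = q} \<subseteq> {..<K} \<and> K \<le> 2 * ?N q + 1"
    by (rule choice[THEN exE])
  then obtain K where "\<forall>q. blocked f (\<beta> q) {p\<in>E. \<gamma> p = q} \<and> \<beta> q ` {p\<in>E. \<gamma> p = q} \<subseteq> {..<K q} \<and> K q \<le> 2 * ?N q + 1"
    by (rule choice[THEN exE])
  then have \<beta>: "\<And>q. blocked f (\<beta> q) {p\<in>E. \<gamma> p = q}"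
    "\<And>q. \<beta> q ` {p\<in>E. \<gamma> p = q} \<subseteq> {..<K q}" "\<And>q. K q \<le> 2 * ?N q + 1"
    by simp_all
  define S where "S = (\<Sum>q<M. K q)"
  define N where "N = card ((\<lambda>p. (f p, \<gamma> p)) ` E)"
  have S: "S \<le> 2 * N + M"
  proof -
    have "S \<le> (\<Sum>q<M. 2 * ?N q + 1)" unfolding S_def by (intro sum_mono \<beta>(3))
    also have "\<dots> = 2 * (\<Sum>q<M. ?N q) + M" by (simp only: sum.distrib sum_distrib_left) simp
    finally show ?thesis unfolding N_def sum_card_symbols[OF assms(1) \<gamma>(2)] .
  qed
  have sub_n: "card (f ` C) \<le> n" if "C \<subseteq> E" for C
    unfolding n_def using that assms(1) by (intro card_mono image_mono) auto
  have four: "card C \<le> 2 * card (f ` C) + K q" if "C \<subseteq> {p\<in>E. \<gamma> p = q}" "alt_free f 4 C" for q C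
  proof (rule card_le_alt_free_4[OF _ _ that(2)])
    show "finite C" using that(1) assms(1) by (auto intro: finite_subset)
    show "blocked f (\<beta> q) C" by (rule blocked_mono[OF \<beta>(1) that(1)])
    show "\<beta> q ` C \<subseteq> {..<K q}" using \<beta>(2) that(1) by blast
  qed
  have five': "card C \<le> \<kappa> * card (f ` C) + K q" if "C \<subseteq> {p\<in>E. \<gamma> p = q}" "alt_free f 5 C" for q C
    unfolding \<kappa>_def t_def
  proof (rule card_le_alt_free_5[OF _ _ _ that(2)])
    show "finite C" using that(1) assms(1) by (auto intro: finite_subset)
    show "blocked f (\<beta> q) C" by (rule blocked_mono[OF \<beta>(1) that(1)])
    show "\<beta> q ` C \<subseteq> {..<K q}" using \<beta>(2) that(1) by blast
    show "2 * card (f ` C) + 1 \<le> 8 ^ ack_exp i j" proof -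
      have "C \<subseteq> E" using that(1) by blast
      from sub_n[OF this] small show ?thesis unfolding n_def by linarith
    qed
  qed
  have cls: "card C \<le> \<kappa> * card ((\<lambda>p. (f p, \<gamma> p)) ` C) + S" if "C \<subseteq> E" for C
    unfolding S_def
  proof (rule card_interval_sum)
    show "finite C" using that assms(1) by (auto intro: finite_subset)
    show "\<gamma> ` C \<subseteq> {..<M}" using that \<gamma>(2) by blast
    show "card {p\<in>C. \<gamma> p = q} \<le> \<kappa> * card (f ` {p\<in>C. \<gamma> p = q}) + K q" for q
      by (rule five') (use that in \<open>auto intro: alt_free_mono[OF \<gamma>(4)[of q]]\<close>)
  qed
  let ?G = "card (f ` globals f \<gamma> E)" and ?L = "card (f ` locals f \<gamma> E)"
  let ?D = "contract f \<gamma> (globals f \<gamma> E)"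
  have n: "n = ?L + ?G" unfolding n_def by (rule card_symbols_split[OF assms(1)])
  have 1: "card (locals f \<gamma> E) \<le> \<kappa> * ?L + S"
    using cls[OF class_subset(1)[of f \<gamma>]] unfolding card_pairs_locals[of f \<gamma>] .
  have 2: "card (firsts f \<gamma> E) \<le> \<kappa> * ?G + S"
    using cls[OF class_subset(2)[of f \<gamma>]] mult_le_mono2[OF card_pairs_firsts[OF assms(1), of f \<gamma>], of \<kappa>] by (meson add_le_mono1 le_trans)
  have 3: "card (lasts f \<gamma> E) \<le> \<kappa> * ?G + S"
    using cls[OF class_subset(3)[of f \<gamma>]] mult_le_mono2[OF card_pairs_lasts[OF assms(1), of f \<gamma>], of \<kappa>] by (meson add_le_mono1 le_trans)
  \<comment> \<open>The incidences form a blocked sequence with one block per interval, which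
    reduces the sparse case to \<open>size_bound_7\<close>.\<close>
  have N: "N \<le> mu5 i * t * n"
  proof -
    let ?E = "contract f \<gamma> E"
    have "card ?E \<le> mu5 i * card (f ` ?E) + mu5 i * 8 ^ j * M"
    proof (rule size_boundD[OF size_bound_7[OF M8]])
      show "finite ?E" by (rule finite_subset[OF contract_subset assms(1)])
      show "blocked f \<gamma> ?E" by (rule contract_blocked[OF \<gamma>(1)])
      show "alt_free f 7 ?E" by (rule alt_free_mono[OF assms(3) contract_subset])
      show "\<gamma> ` ?E \<subseteq> {..<M}" using \<gamma>(2) contract_subset[of f \<gamma> E] by blast
    qed
    then have "N \<le> mu5 i * n + mu5 i * 8 ^ j * M" unfolding N_def n_def card_contract contract_symbols .
    also have "\<dots> \<le> mu5 i * n + mu5 i * 8 ^ j * (3 * n)" using M3 by (intro add_left_mono mult_left_mono) auto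
    finally show ?thesis by (simp add: t_def algebra_simps)
  qed
  have T: "card (tips f i j \<gamma> ?D) \<le> phi7 i * t * n"
  proof -
    have sub: "?D \<subseteq> E" using contract_subset[of f \<gamma> "globals f \<gamma> E"] class_subset(5)[of f \<gamma> E] by blast
    have "card (tips f i j \<gamma> ?D) \<le> phi7 i * card (f ` ?D) + phi7 i * 8 ^ j * M"
    proof (rule tip_boundD[OF tip_bound_7[OF M8]])
      show "finite ?D" by (rule finite_subset[OF sub assms(1)])
      show "blocked f \<gamma> ?D" by (rule contract_blocked[OF mono_blocks_mono[OF \<gamma>(1) class_subset(5)]])
      show "alt_free f 7 ?D" by (rule alt_free_mono[OF assms(3) sub])
      show "\<gamma> ` ?D \<subseteq> {..<M}" using \<gamma>(2) sub by blast
    qed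
    also have "\<dots> \<le> phi7 i * n + phi7 i * 8 ^ j * (3 * n)"
      using M3 sub_n[OF sub] by (intro add_mono mult_left_mono) auto
    finally show ?thesis by (simp add: t_def algebra_simps)
  qed
  have "card (middles f \<gamma> E) \<le> 2 * card ((\<lambda>p. (f p, \<gamma> p)) ` globals f \<gamma> E)
      + \<kappa> * card (tips f i j \<gamma> ?D) + (2 * (\<Sum>q<M. K q) + (\<Sum>q<M. K q))"
    by (rule card_middles_7[OF assms(1) \<gamma>(1) assms(3) \<gamma>(2) four five'])
  also have "card ((\<lambda>p. (f p, \<gamma> p)) ` globals f \<gamma> E) \<le> N"
    unfolding N_def using assms(1) class_subset(5)[of f \<gamma> E] by (intro card_mono image_mono) auto
  finally have 4: "card (middles f \<gamma> E) \<le> 2 * N + \<kappa> * (phi7 i * t * n) + 3 * S"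
    using mult_le_mono2[OF T, of \<kappa>] unfolding S_def by linarith
  have "card E \<le> \<kappa> * ?L + 2 * (\<kappa> * ?G) + 6 * S + 2 * N + \<kappa> * (phi7 i * t * n)"
    using card_classes_le[of E f \<gamma>] 1 2 3 4 by linarith
  also have "\<dots> \<le> 2 * (\<kappa> * n) + 14 * N + 18 * n + \<kappa> * (phi7 i * t * n)"
    using S M3 unfolding n by (simp add: algebra_simps)
  also have "\<dots> \<le> 2 * (\<kappa> * n) + 14 * (mu5 i * t * n) + 18 * n + \<kappa> * (phi7 i * t * n)"
    using N by simp
  also have "\<dots> = sparse_factor i j * n"
    unfolding sparse_factor_def Let_def t_def[symmetric] \<kappa>_def[symmetric] by (simp add: algebra_simps)
  finally show ?thesis unfolding n_def .
qed simp

section \<open>Growth of the factors\<close>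

lemma mu4_le: "mu4 i \<le> 40 * 2 ^ i"
proof -
  have "mu4 i + 8 * i + 32 = 40 * 2 ^ i" by (induction i) auto
  then show ?thesis by simp
qed

lemma phi6_le: "phi6 i \<le> 8 * (i + 2) ^ 2"
  by (induction i) (auto simp: power2_eq_square)

lemma phi7_le: "phi7 i \<le> 16 * (i + 3) ^ 3"
proof (induction i)
  case (Suc i)
  define x where "x = i + 3"
  have "(x + 1) ^ 3 = x ^ 3 + 3 * x ^ 2 + 3 * x + 1"
    by (simp add: power3_eq_cube power2_eq_square algebra_simps)
  moreover have "phi6 (Suc i) \<le> 8 * x ^ 2" using phi6_le[of "Suc i"] by (simp add: x_def eval_nat_numeral del: phi6.simps)
  moreover have "phi7 i \<le> 16 * x ^ 3" using Suc by (simp add: x_def)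
  ultimately have "phi7 (Suc i) \<le> 16 * (x + 1) ^ 3" unfolding phi7.simps by linarith
  then show ?case by (simp add: x_def del: phi7.simps)
qed simp

text \<open>The quotient of \<open>(i + 3) ^ 4\<close> and \<open>2 ^ i\<close> is largest at 3,
  where it is 1296 / 8 = 162; from there on a step at most doubles the fourth power.\<close>

lemma fourth_power_le: "(i + 3) ^ 4 \<le> 162 * 2 ^ (i::nat)"
proof (cases "i < 3")
  case True
  then consider "i = 0" | "i = 1" | "i = 2" by linarith
  then show ?thesis by cases auto
next
  case False
  have *: "(k + 6) ^ 4 \<le> 162 * 2 ^ (k + 3)" for k :: nat
  proof (induction k)
    case (Suc k)
    define x where "x = k + 6"
    have x6: "6 \<le> x" by (simp add: x_def)
    have "(x + 1) ^ 4 = x ^ 4 + 4 * x ^ 3 + 6 * x ^ 2 + 4 * x + 1"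
      by (simp add: power4_eq_xxxx power3_eq_cube power2_eq_square algebra_simps)
    moreover have "6 * x ^ 3 \<le> x ^ 4" "6 * x ^ 2 \<le> x ^ 3" "6 * x \<le> x ^ 2"
      using mult_right_mono[OF x6, of "x ^ 3"] mult_right_mono[OF x6, of "x ^ 2"] mult_right_mono[OF x6, of x]
      by (simp_all add: power4_eq_xxxx power3_eq_cube power2_eq_square)
    ultimately have "(x + 1) ^ 4 \<le> 2 * x ^ 4" using x6 by linarith
    then have "(Suc k + 6) ^ 4 \<le> 2 * (k + 6) ^ 4" by (simp add: x_def)
    moreover have "162 * 2 ^ (Suc k + 3) = 2 * (162 * 2 ^ (k + 3) :: nat)" by (simp add: power_add)
    ultimately show ?case using Suc by linarith
  qed simp
  from *[of "i - 3"] False show ?thesis by (simp add: add.commute)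
qed

lemma mu3_phi7_le: "mu3 (Suc i) * (phi7 i + 1) \<le> 136 * (162 * 2 ^ i)"
proof -
  have "mu3 (Suc i) \<le> 8 * (i + 3)" by simp
  moreover have "phi7 i + 1 \<le> 17 * (i + 3) ^ 3" using phi7_le[of i] one_le_power[of "i + 3" 3] by linarith
  ultimately have "mu3 (Suc i) * (phi7 i + 1) \<le> (8 * (i + 3)) * (17 * (i + 3) ^ 3)" by (rule mult_le_mono)
  also have "\<dots> = 136 * (i + 3) ^ 4" by (simp add: power4_eq_xxxx power3_eq_cube algebra_simps)
  also have "\<dots> \<le> 136 * (162 * 2 ^ i)" using fourth_power_le[of i] by simp
  finally show ?thesis .
qed

text \<open>Relative to \<open>2 ^ i\<close>, a new row adds 160 from the sides and at most 136 *
  162 = 22032 from the tips, together 2 * 11096; summing over the rows yields the factor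
  \<open>i + 1\<close>.\<close>

lemma mu5_le: "mu5 i \<le> 11096 * (i + 1) * 2 ^ i"
proof (induction i)
  case (Suc i)
  have "mu5 (Suc i) \<le> 2 * (11096 * (i + 1) * 2 ^ i) + 2 * (40 * 2 ^ Suc i) + 136 * (162 * 2 ^ i)"
    unfolding mu5.simps using Suc mu4_le[of "Suc i"] mu3_phi7_le[of i] by linarith
  also have "\<dots> = 11096 * (Suc i + 1) * 2 ^ Suc i" by (simp add: algebra_simps)
  finally show ?case .
qed simp

lemma sparse_factor_le:
  obtains A :: nat where "\<And>i. sparse_factor i j \<le> A * ((i + 1) * 2 ^ i)"
proof
  define t :: nat where "t = 1 + 3 * 8 ^ j"
  define B where "B i = (i + 1) * 2 ^ i" for i :: nat
  fix i
  have "(i + 1) * 1 \<le> (i + 1) * 2 ^ i" by (rule mult_le_mono2) simp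
  moreover have "1 * 2 ^ i \<le> (i + 1) * 2 ^ i" by (rule mult_le_mono1) simp
  ultimately have B1: "i + 1 \<le> B i" "2 ^ i \<le> B i" unfolding B_def by (simp_all only: mult_1_right mult_1_left)
  have 1: "mu3 i * t \<le> 8 * t * B i"
  proof -
    have "mu3 i * t \<le> 8 * (i + 1) * t" by (intro mult_right_mono) auto
    also have "\<dots> \<le> 8 * t * B i" using B1(1) by simp
    finally show ?thesis .
  qed
  have 2: "mu5 i * t \<le> 11096 * t * B i"
    using mult_right_mono[OF mu5_le[of i], of t] unfolding B_def by (simp add: algebra_simps)
  have 3: "18 \<le> 18 * B i" using B1(1) by simp
  have 4: "mu3 i * t * (phi7 i * t) \<le> 128 * 162 * t * t * B i"
  proof -
    have "mu3 i * phi7 i \<le> (8 * (i + 3)) * (16 * (i + 3) ^ 3)" using phi7_le[of i] by (intro mult_le_mono) auto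
    also have "\<dots> = 128 * (i + 3) ^ 4" by (simp add: power4_eq_xxxx power3_eq_cube algebra_simps)
    also have "\<dots> \<le> 128 * (162 * 2 ^ i)" using fourth_power_le[of i] by simp
    also have "\<dots> \<le> 128 * (162 * B i)" using B1(2) by simp
    finally have "mu3 i * phi7 i * (t * t) \<le> 128 * (162 * B i) * (t * t)" by (rule mult_right_mono) simp
    then show ?thesis by (simp add: algebra_simps del: mu3.simps)
  qed
  have "sparse_factor i j = 2 * (mu3 i * t) + 14 * (mu5 i * t) + 18 + mu3 i * t * (phi7 i * t)"
    unfolding sparse_factor_def Let_def t_def ..
  also have "\<dots> \<le> 2 * (8 * t * B i) + 14 * (11096 * t * B i) + 18 * B i + 128 * 162 * t * t * B i"
    using 1 2 3 4 by linarith
  also have "\<dots> = (16 * t + 14 * 11096 * t + 18 + 128 * 162 * t * t) * B i" by (simp add: algebra_simps)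
  finally show "sparse_factor i j \<le> (16 * t + 14 * 11096 * t + 18 + 128 * 162 * t * t) * ((i + 1) * 2 ^ i)"
    unfolding B_def .
qed

section \<open>Comparison with Ackermann's function\<close>

lemma ack_exp_less: "ack_exp (Suc i) j < ack_exp (Suc i) (Suc j)"
proof -
  have "1 \<le> ack_exp i j" for i j by (induction i j rule: ack_exp.induct) auto
  then show ?thesis by (simp add: Suc_le_eq)
qed

lemma ack_exp_mono: "j \<le> k \<Longrightarrow> ack_exp i j \<le> ack_exp i k"
proof (cases i)
  case (Suc i')
  have "incseq (ack_exp (Suc i'))"
    by (rule incseq_SucI) (rule less_imp_le[OF ack_exp_less])
  then show "j \<le> k \<Longrightarrow> ack_exp i j \<le> ack_exp i k" unfolding Suc incseq_def by blast
qed simp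

lemma ack_exp_gt: "j < ack_exp (Suc i) j"
proof (induction j)
  case (Suc j)
  then show ?case using ack_exp_less[of i j] by linarith
qed simp

lemma ack_exp_row_Suc: "ack_exp i j \<le> ack_exp (Suc i) j"
proof (induction i arbitrary: j)
  case 0
  show ?case using ack_exp_gt[of j 0] by simp
next
  case (Suc i)
  note IH = Suc.IH
  show ?case
  proof (induction j)
    case (Suc j)
    have "ack_exp i (ack_exp (Suc i) j) \<le> ack_exp (Suc i) (ack_exp (Suc i) j)" by (rule IH)
    also have "\<dots> \<le> ack_exp (Suc i) (ack_exp (Suc (Suc i)) j)" by (rule ack_exp_mono[OF Suc])
    finally show ?case using Suc by simp
  qed simp
qed

lemma ack_exp_row_mono: "i \<le> k \<Longrightarrow> ack_exp i j \<le> ack_exp k j"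
  by (induction k rule: dec_induct) (auto intro: order_trans[OF _ ack_exp_row_Suc])

lemma ack_exp_1: "ack_exp (Suc 0) j = j + 1"
  by (induction j) auto

lemma ack_exp_2: "ack_exp (Suc (Suc 0)) j + 1 = 2 ^ Suc j"
  by (induction j) (auto simp: ack_exp_1)

lemma power2_gt_square: "y * y < 2 ^ Suc (y::nat)"
proof (induction y rule: less_induct)
  case (less y)
  show ?case
  proof (cases "y \<le> 3")
    case True
    then consider "y = 0" | "y = 1" | "y = 2" | "y = 3" by linarith
    then show ?thesis by cases auto
  next
    case False
    then obtain z where z: "y = Suc z" "3 \<le> z" by (cases y) auto
    have "3 * z \<le> z * z" by (rule mult_le_mono1[OF z(2)])
    moreover have "z * z < 2 ^ Suc z" using less[of z] z(1) by simp
    moreover have "Suc z * Suc z = z * z + 2 * z + 1" "2 ^ Suc (Suc z) = 2 * (2 ^ Suc z :: nat)" by simp_all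
    ultimately show ?thesis unfolding z(1) using z(2) by linarith
  qed
qed

text \<open>The product in Ackermann's recursion is absorbed by a squaring, hence by row 2, hence by
  one more column of row \<open>i + 3\<close> in the last case. That column is available because
  \<open>w < x\<close>.\<close>

lemma acker_less_ack_exp: "1 \<le> i \<Longrightarrow> 1 \<le> j \<Longrightarrow> acker i j < ack_exp (Suc (Suc i)) j"
proof (induction i j rule: acker.induct)
  case (2 j)
  have "2 ^ 1 \<le> (2::nat) ^ j" using 2 by (intro power_increasing) auto
  then have "2 ^ j < ack_exp (Suc (Suc 0)) j" using ack_exp_2[of j] by simp
  also have "\<dots> \<le> ack_exp (Suc (Suc (Suc 0))) j" by (rule ack_exp_row_Suc)
  finally show ?case by simp
next
  case (4 i)
  have "acker (Suc (Suc i)) (Suc 0) < ack_exp (Suc (Suc (Suc 0))) (Suc 0)" by (simp add: eval_nat_numeral)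
  also have "\<dots> \<le> ack_exp (Suc (Suc (Suc (Suc i)))) (Suc 0)" by (rule ack_exp_row_mono) simp
  finally show ?case .
next
  case (5 i j)
  define w where "w = acker (Suc (Suc i)) (Suc j)"
  define x where "x = ack_exp (Suc (Suc (Suc (Suc i)))) (Suc j)"
  define y where "y = ack_exp (Suc (Suc (Suc i))) w"
  have wx: "w < x" unfolding w_def x_def using 5(1) by simp
  have eq: "acker (Suc (Suc i)) (Suc (Suc j)) = w * acker (Suc i) w" by (simp add: w_def Let_def)
  have wy: "w < y" unfolding y_def by (rule ack_exp_gt)
  have "acker (Suc i) w \<le> y"
  proof (cases "w = 0")
    case True
    then show ?thesis unfolding y_def by (cases i) (auto simp: ack_exp_gt Suc_le_eq)
  next
    case False
    then show ?thesis using 5(2) unfolding w_def y_def by (auto simp: less_imp_le)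
  qed
  then have "w * acker (Suc i) w \<le> y * y" using wy by (intro mult_le_mono) auto
  also have "\<dots> \<le> ack_exp (Suc (Suc 0)) y" using ack_exp_2[of y] power2_gt_square[of y] by simp
  also have "\<dots> \<le> ack_exp (Suc (Suc i)) y" by (rule ack_exp_row_mono) simp
  also have "\<dots> \<le> ack_exp (Suc (Suc (Suc i))) (Suc w)" unfolding y_def by simp
  also have "\<dots> \<le> ack_exp (Suc (Suc (Suc i))) x" using wx by (intro ack_exp_mono) simp
  also have "\<dots> < ack_exp (Suc (Suc (Suc (Suc i)))) (Suc (Suc j))"
    using wx unfolding ack_exp.simps(3)[of _ "Suc j"] x_def[symmetric] by simp
  finally show ?case unfolding eq .
qed auto

lemma ack_exp_3_ge: "8 ^ Suc t \<le> ack_exp 3 (t + 2)"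
proof (induction t)
  case 0
  show ?case by (simp add: eval_nat_numeral)
next
  case (Suc t)
  define x where "x = ack_exp 3 (t + 2)"
  have "8 * 8 ^ t \<le> x" "8 * 1 \<le> 8 * (8::nat) ^ t" using Suc by (auto simp: x_def)
  then have x8: "8 \<le> x" by linarith
  have "8 * x \<le> x * x" using x8 by simp
  also have "\<dots> \<le> ack_exp (Suc (Suc 0)) x" using ack_exp_2[of x] power2_gt_square[of x] by simp
  also have "\<dots> \<le> ack_exp 3 (Suc t + 2)" by (simp add: x_def eval_nat_numeral)
  finally have "8 * x \<le> ack_exp 3 (Suc t + 2)" .
  moreover have "8 ^ Suc (Suc t) \<le> 8 * x" using Suc by (simp add: x_def)
  ultimately show ?case by linarith
qed

text \<open>The bounds carry an error \<open>8 ^ column\<close>, affordable only if this is of order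
  \<open>j\<close>. One additional row makes a column of logarithmic size enough, since row 3
  already exceeds powers of 8.\<close>

lemma acker_column_log:
  assumes "1 \<le> i" "1 \<le> j"
  obtains t where "8 ^ t \<le> j" "acker i j < ack_exp (i + 3) (t + 3)"
proof -
  obtain t where t: "8 ^ t \<le> j" "j < 8 ^ Suc t"
    using ex_power_ivl1[of 8 j] assms(2) by auto
  have "acker i j < ack_exp (Suc (Suc i)) j" by (rule acker_less_ack_exp[OF assms])
  also have "\<dots> \<le> ack_exp (Suc (Suc i)) (ack_exp (i + 3) (t + 2))"
  proof (rule ack_exp_mono)
    have "j \<le> ack_exp 3 (t + 2)" using t(2) ack_exp_3_ge[of t] by linarith
    also have "\<dots> \<le> ack_exp (i + 3) (t + 2)" by (rule ack_exp_row_mono) simp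
    finally show "j \<le> ack_exp (i + 3) (t + 2)" .
  qed
  also have "\<dots> \<le> ack_exp (i + 3) (t + 3)" by (simp add: eval_nat_numeral)
  finally show ?thesis using that t(1) by blast
qed

lemma acker_ge_2: "1 \<le> i \<Longrightarrow> 1 \<le> j \<Longrightarrow> 2 \<le> acker i j"
proof (induction i j rule: acker.induct)
  case (2 j)
  then show ?case using power_increasing[of 1 j "2::nat"] by simp
next
  case (5 i j)
  define w where "w = acker (Suc (Suc i)) (Suc j)"
  have "2 \<le> w" using 5(1) unfolding w_def by simp
  moreover from this have "2 \<le> acker (Suc i) w" using 5(2) unfolding w_def by simp
  ultimately have "2 * 2 \<le> w * acker (Suc i) w" by (rule mult_le_mono)
  then show ?case by (simp add: w_def Let_def)
qed auto

lemma acker_ge_row: "1 \<le> i \<Longrightarrow> 2 \<le> j \<Longrightarrow> i \<le> acker i j"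
proof (induction i arbitrary: j rule: nat_induct_at_least)
  case (Suc i)
  obtain i' where i': "i = Suc i'" using Suc.hyps by (cases i) auto
  obtain j' where j': "j = Suc (Suc j')" using le_Suc_ex[OF Suc.prems] by auto
  note eq = i' j'
  define w where "w = acker (Suc i) (Suc j')"
  have "2 \<le> w" unfolding w_def by (rule acker_ge_2) auto
  moreover from this have "i \<le> acker i w" by (rule Suc.IH)
  ultimately have "2 * i \<le> w * acker i w" by (rule mult_le_mono)
  then show ?case using Suc.hyps by (simp add: w_def eq Let_def)
qed simp

lemma alpha2_spec:
  assumes "j = max (nat \<lceil>real n / real m\<rceil>) 3"
  shows "1 \<le> alpha2 n m" "m \<le> acker (alpha2 n m) j"
proof -
  have "alpha2 n m = (LEAST i. i \<ge> 1 \<and> acker i j \<ge> m)" unfolding alpha2_def assms Let_def ..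
  moreover have "\<exists>i. i \<ge> 1 \<and> acker i j \<ge> m"
    \<comment> \<open>From column 2 on, every value is at least its row number, so row
      \<open>m\<close> suffices; existence makes the \<open>LEAST\<close> meaningful.\<close>
    by (rule exI[of _ "max 1 m"], use acker_ge_row[of "max 1 m" j] assms in auto)
  ultimately have "1 \<le> alpha2 n m \<and> m \<le> acker (alpha2 n m) j" using LeastI_ex[of "\<lambda>i. i \<ge> 1 \<and> acker i j \<ge> m"] by simp
  then show "1 \<le> alpha2 n m" "m \<le> acker (alpha2 n m) j" by auto
qed

section \<open>Lists\<close>

primrec alt_list :: "nat \<Rightarrow> 'a \<Rightarrow> 'a \<Rightarrow> 'a list" where
  "alt_list 0 a b = []"
| "alt_list (Suc k) a b = a # alt_list k b a"

text \<open>Stated for suffixes, as \<open>alt\<close> continues behind the position just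
  found.\<close>

lemma alt_imp_subseq:
  "alt (\<lambda>p. s ! p) k a b {p. l \<le> p \<and> p < length s} \<Longrightarrow> subseq (alt_list k a b) (drop l s)"
proof (induction k arbitrary: a b l)
  case (Suc k)
  then obtain p where p: "l \<le> p" "p < length s" "s ! p = a"
    "alt (\<lambda>p. s ! p) k b a {r\<in>{p. l \<le> p \<and> p < length s}. p < r}" by auto
  have "{r\<in>{p. l \<le> p \<and> p < length s}. p < r} = {r. Suc p \<le> r \<and> r < length s}" using p(1) by auto
  then have "alt (\<lambda>p. s ! p) k b a {r. Suc p \<le> r \<and> r < length s}" using p(4) by simp
  then have "subseq (alt_list k b a) (drop (Suc p) s)" by (rule Suc.IH)
  then have "subseq (alt_list (Suc k) a b) (drop p s)"
    using Cons_nth_drop_Suc[OF p(2)] p(3) by (metis alt_list.simps(2) subseq_Cons2)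
  moreover have "drop p s = drop (p - l) (drop l s)" using p(1) by simp
  ultimately show ?case by (metis subseq_drop_many subseq_order.order_trans subseq_order.refl list_emb_append2 append_take_drop_id)
qed simp

lemma alt_free_7_of_list:
  assumes "\<not> has_alt7 s"
  shows "alt_free (\<lambda>p. s ! p) 7 {..<length s}"
  unfolding alt_free_def
proof (intro allI impI notI)
  fix a b assume ab: "a \<noteq> b" and alt: "alt (\<lambda>p. s ! p) 7 a b {..<length s}"
  have "{..<length s} = {p. 0 \<le> p \<and> p < length s}" by auto
  then have "subseq (alt_list 7 a b) s" using alt_imp_subseq[of s 7 a b 0] alt by simp
  then have "subseq [a,b,a,b,a,b,a] s" by (simp add: eval_nat_numeral)
  then show False using assms ab unfolding has_alt7_def by blast
qed

lemma no_adj_of_list: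
  assumes "no_adj_eq s"
  shows "no_adj (\<lambda>p. s ! p) {..<length s}"
  unfolding no_adj_def
proof (intro ballI impI)
  fix x y assume xy: "x \<in> {..<length s}" "y \<in> {..<length s}" "x < y \<and> (\<forall>z\<in>{..<length s}. \<not> (x < z \<and> z < y))"
  then have "\<not> Suc x < y" by auto
  then have "y = Suc x" using xy by simp
  then show "s ! x \<noteq> s ! y" using assms xy unfolding no_adj_eq_def by simp
qed

lemma symbols_of_list: "(\<lambda>p. s ! p) ` {..<length s} = set s"
  by (auto simp: set_conv_nth)

lemma blocked_of_list:
  "\<forall>b\<in>set bs. distinct b \<Longrightarrow>
   \<exists>\<beta>. blocked (\<lambda>p. concat bs ! p) \<beta> {..<length (concat bs)} \<and> \<beta> ` {..<length (concat bs)} \<subseteq> {..<length bs}"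
proof (induction bs rule: rev_induct)
  case Nil
  then show ?case by (auto simp: blocked_def mono_blocks_def)
next
  case (snoc b bs)
  let ?c = "concat bs"
  obtain \<beta> where \<beta>: "blocked (\<lambda>p. ?c ! p) \<beta> {..<length ?c}" "\<beta> ` {..<length ?c} \<subseteq> {..<length bs}"
    using snoc by auto
  define \<gamma> where "\<gamma> p = (if p < length ?c then \<beta> p else length bs)" for p
  have lt: "\<beta> p < length bs" if "p < length ?c" for p using \<beta>(2) that by auto
  have mono: "\<beta> p \<le> \<beta> r" if "p < length ?c" "r < length ?c" "p < r" for p r
    using \<beta>(1) that unfolding blocked_def mono_blocks_def by auto
  have inj: "p = r" if "p < length ?c" "r < length ?c" "?c ! p = ?c ! r" "\<beta> p = \<beta> r" for p r
    using \<beta>(1) that unfolding blocked_def by auto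
  have injb: "p = r" if "length ?c \<le> p" "length ?c \<le> r" "p < length ?c + length b" "r < length ?c + length b"
      "b ! (p - length ?c) = b ! (r - length ?c)" for p r
  proof -
    have "distinct b" using snoc.prems by simp
    then have "p - length ?c = r - length ?c" using that nth_eq_iff_index_eq[of b "p - length ?c" "r - length ?c"] by auto
    then show ?thesis using that by simp
  qed
  have "blocked (\<lambda>p. concat (bs @ [b]) ! p) \<gamma> {..<length (concat (bs @ [b]))}"
    unfolding blocked_def mono_blocks_def
  proof (intro conjI ballI impI)
    fix p r assume pr: "p \<in> {..<length (concat (bs @ [b]))}" "r \<in> {..<length (concat (bs @ [b]))}"
    show "\<gamma> p \<le> \<gamma> r" if "p < r"
      using that mono[of p r] lt[of p] by (auto simp: \<gamma>_def)
    assume "concat (bs @ [b]) ! p = concat (bs @ [b]) ! r \<and> \<gamma> p = \<gamma> r"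
    then show "p = r"
      using pr inj[of p r] injb[of p r] lt[of p] lt[of r]
      by (auto simp: \<gamma>_def nth_append split: if_splits)
  qed
  moreover have "\<gamma> ` {..<length (concat (bs @ [b]))} \<subseteq> {..<length (bs @ [b])}"
    using lt by (auto simp: \<gamma>_def less_Suc_eq)
  ultimately show ?case by blast
qed

lemma two_mult_add_1_le_power_8: "n < k \<Longrightarrow> 2 * n + 1 \<le> (8::nat) ^ k"
proof -
  assume "n < k"
  have "Suc k \<le> 2 ^ k" for k :: nat by (induction k) auto
  then have "2 * Suc n \<le> 2 * 2 ^ n" by (rule mult_le_mono2)
  also have "\<dots> = 2 ^ Suc n" by simp
  also have "\<dots> \<le> 8 ^ Suc n" by (rule power_mono) auto
  also have "\<dots> \<le> 8 ^ k" using \<open>n < k\<close> by (intro power_increasing) auto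
  finally show ?thesis by simp
qed

lemma less_power_8: "n < (8::nat) ^ n"
  by (induction n) auto

lemma card_le_sparse_acker:
  assumes "finite E" "no_adj f E" "alt_free f 7 E" "card (f ` E) \<le> n" "n \<le> acker i 3" "1 \<le> i"
  shows "card E \<le> sparse_factor (i + 3) 3 * n"
proof -
  obtain t where t: "8 ^ t \<le> (3::nat)" "acker i 3 < ack_exp (i + 3) (t + 3)"
    using acker_column_log[of i 3] assms(6) by auto
  \<comment> \<open>Ackermann's column 3 leaves only \<open>t = 0\<close>, so the column of
    \<open>sparse_factor\<close> is the constant 3 and its power of 8 is a constant.\<close>
  have "t = 0"
  proof (cases t)
    case (Suc t')
    have "8 * 1 \<le> (8::nat) ^ t" unfolding Suc power_Suc by (rule mult_le_mono2) simp
    then show ?thesis using t(1) by simp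
  qed
  then have "n < ack_exp (i + 3) 3" using t(2) assms(5) by simp
  then have n8: "2 * n + 1 \<le> 8 ^ ack_exp (i + 3) 3" by (rule two_mult_add_1_le_power_8)
  have "card E \<le> sparse_factor (i + 3) 3 * card (f ` E)"
    by (rule card_le_sparse[OF assms(1-3)]) (use n8 assms(4) in linarith)
  also have "\<dots> \<le> sparse_factor (i + 3) 3 * n" using assms(4) by simp
  finally show ?thesis .
qed

section \<open>Bounds for the two extremal functions\<close>

lemma lambda5_le:
  assumes "1 \<le> n"
  shows "lambda5 n \<le> sparse_factor (alpha1 n + 3) 3 * n"
  unfolding lambda5_def
proof (rule cSup_least)
  have "card (set ([]::nat list)) \<le> n \<and> no_adj_eq [] \<and> \<not> has_alt7 []"
    by (simp add: no_adj_eq_def has_alt7_def)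
  then show "{length s |s. card (set s) \<le> n \<and> no_adj_eq s \<and> \<not> has_alt7 s} \<noteq> {}" by blast
  fix x assume "x \<in> {length s |s. card (set s) \<le> n \<and> no_adj_eq s \<and> \<not> has_alt7 s}"
  then obtain s where s: "x = length s" "card (set s) \<le> n" "no_adj_eq s" "\<not> has_alt7 s" by blast
  have "(3::nat) = max (nat \<lceil>real n / real n\<rceil>) 3" using assms by simp
  note \<alpha> = alpha2_spec[OF this]
  have "card {..<length s} \<le> sparse_factor (alpha1 n + 3) 3 * n"
    unfolding alpha1_def
    by (rule card_le_sparse_acker[OF _ no_adj_of_list[OF s(3)] alt_free_7_of_list[OF s(4)] _ \<alpha>(2,1)])
      (use s(2) in \<open>auto simp: symbols_of_list\<close>)
  then show "x \<le> sparse_factor (alpha1 n + 3) 3 * n" using s(1) by simp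
qed

text \<open>For \<open>n \<le> m\<close> a multiple of \<open>m\<close> would be too much, so at
  most \<open>m\<close> repetitions are deleted and the sparse bound is applied. For
  \<open>m < n\<close> the blocked bound has an error of order \<open>m * j\<close>, thus of order
  \<open>n\<close>; 1537 is 1 + 512 * 3 with 512 from the three extra columns.\<close>

lemma length_le_blocks:
  assumes s: "card (set s) \<le> n" "is_m_block m s" "\<not> has_alt7 s" and "1 \<le> n" "1 \<le> m"
  shows "length s \<le> m + (sparse_factor (alpha2 n m + 3) 3 + 1537 * mu5 (alpha2 n m + 3)) * n"
proof -
  let ?f = "\<lambda>p. s ! p" and ?E = "{..<length s}"
  define i where "i = alpha2 n m"
  obtain bs where bs: "length bs \<le> m" "s = concat bs" "\<forall>b\<in>set bs. distinct b"
    using s(2) unfolding is_m_block_def by blast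
  obtain \<beta> where "blocked ?f \<beta> ?E" "\<beta> ` ?E \<subseteq> {..<length bs}"
    using blocked_of_list[OF bs(3)] unfolding bs(2)[symmetric] by blast
  then have \<beta>: "blocked ?f \<beta> ?E" "\<beta> ` ?E \<subseteq> {..<m}" using bs(1) by auto
  have free: "alt_free ?f 7 ?E" by (rule alt_free_7_of_list[OF s(3)])
  have sym: "card (?f ` ?E) \<le> n" using s(1) by (simp add: symbols_of_list)
  define j where "j = max (nat \<lceil>real n / real m\<rceil>) 3"
  have i: "1 \<le> i" "m \<le> acker i j" unfolding i_def using alpha2_spec[OF j_def] by auto
  show ?thesis
  proof (cases "n \<le> m")
    case True
    have "real n / real m \<le> 1" using True assms(5) by simp
    then have "j = 3" unfolding j_def by (simp add: ceiling_le_iff nat_le_iff)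
    obtain D where D: "D \<subseteq> ?E" "no_adj ?f D" "card ?E \<le> card D + m"
      using obtain_no_adj_subset[OF _ \<beta>] by blast
    have "card D \<le> sparse_factor (i + 3) 3 * n"
    proof (rule card_le_sparse_acker[OF _ D(2) alt_free_mono[OF free D(1)]])
      show "finite D" using D(1) finite_subset by blast
      have "card (?f ` D) \<le> card (?f ` ?E)" using D(1) by (intro card_mono image_mono) auto
      then show "card (?f ` D) \<le> n" using sym by simp
      show "n \<le> acker i 3" using i(2) True \<open>j = 3\<close> by simp
    qed (rule i(1))
    also have "\<dots> \<le> (sparse_factor (i + 3) 3 + 1537 * mu5 (i + 3)) * n" by simp
    finally show ?thesis using D(3) unfolding i_def by simp
  next
    case False
    \<comment> \<open>The rounded quotient gives less than \<open>2 * n\<close> because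
      \<open>m < n\<close>; the lower limit 3 in \<open>j\<close> gives at most
      \<open>3 * n\<close>.\<close>
    have mj: "m * j \<le> 3 * n"
    proof -
      have "real (nat \<lceil>real n / real m\<rceil>) \<le> real n / real m + 1"
        using of_nat_ceiling by (simp add: of_nat_nat)
      then have "real m * real (nat \<lceil>real n / real m\<rceil>) \<le> real m * (real n / real m + 1)"
        by (intro mult_left_mono) auto
      also have "\<dots> = real (n + m)" using assms(5) by (simp add: field_simps)
      finally have "m * nat \<lceil>real n / real m\<rceil> \<le> n + m" by (metis of_nat_le_iff of_nat_mult)
      then show ?thesis using False unfolding j_def by (simp add: max_def)
    qed
    have "1 \<le> j" unfolding j_def by simp
    then obtain t where t: "8 ^ t \<le> j" "acker i j < ack_exp (i + 3) (t + 3)"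
      using acker_column_log[OF i(1)] by blast
    have "m < 8 ^ m" by (rule less_power_8)
    also have "\<dots> \<le> 8 ^ ack_exp (i + 3) (t + 3)" using t(2) i(2) by (intro power_increasing) auto
    finally have "m \<le> 8 ^ ack_exp (i + 3) (t + 3)" by simp
    then have "card ?E \<le> mu5 (i + 3) * card (?f ` ?E) + mu5 (i + 3) * 8 ^ (t + 3) * m"
      by (rule size_boundD[OF size_bound_7 _ \<beta>(1) free \<beta>(2)]) simp
    also have "\<dots> \<le> mu5 (i + 3) * n + mu5 (i + 3) * (1536 * n)"
    proof (rule add_mono)
      show "mu5 (i + 3) * card (?f ` ?E) \<le> mu5 (i + 3) * n" using sym by simp
      have "8 ^ (t + 3) * m = 512 * (m * 8 ^ t)" by (simp add: power_add)
      also have "\<dots> \<le> 512 * (m * j)" using t(1) by simp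
      also have "\<dots> \<le> 1536 * n" using mj by linarith
      finally have "mu5 (i + 3) * (8 ^ (t + 3) * m) \<le> mu5 (i + 3) * (1536 * n)" by (rule mult_le_mono2)
      then show "mu5 (i + 3) * 8 ^ (t + 3) * m \<le> mu5 (i + 3) * (1536 * n)" by (simp only: mult.assoc)
    qed
    also have "\<dots> \<le> m + (sparse_factor (i + 3) 3 + 1537 * mu5 (i + 3)) * n" by (simp add: algebra_simps)
    finally show ?thesis unfolding i_def by simp
  qed
qed

text \<open>The lower bound is attained by \<open>m\<close> blocks consisting of one and the same
  symbol; the upper bound also provides the boundedness that \<open>Sup\<close> requires.\<close>

lemma lambda5m_bounds:
  assumes "1 \<le> n" "1 \<le> m"
  shows "m \<le> lambda5m n m"
    and "lambda5m n m \<le> m + (sparse_factor (alpha2 n m + 3) 3 + 1537 * mu5 (alpha2 n m + 3)) * n"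
proof -
  let ?S = "{length s |s. card (set s) \<le> n \<and> is_m_block m s \<and> \<not> has_alt7 s}"
  let ?s = "replicate m (0::nat)"
  have le: "x \<le> m + (sparse_factor (alpha2 n m + 3) 3 + 1537 * mu5 (alpha2 n m + 3)) * n" if "x \<in> ?S" for x
    using that length_le_blocks assms by blast
  have "is_m_block m ?s"
    unfolding is_m_block_def by (rule exI[of _ "replicate m [0]"]) (simp add: concat_replicate_single)
  moreover have "\<not> has_alt7 ?s"
  proof
    assume "has_alt7 ?s"
    then obtain a b where ab: "a \<noteq> b" "subseq [a,b,a,b,a,b,a] ?s" unfolding has_alt7_def by blast
    have "c = 0" if "c \<in> set [a,b,a,b,a,b,a]" for c
      using list_emb_set[OF ab(2) that] by (metis in_set_replicate)
    from this[of a] this[of b] ab(1) show False by simp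
  qed
  moreover have "card (set ?s) \<le> n" using assms by (simp add: set_replicate_conv_if)
  ultimately have mem: "m \<in> ?S" by (intro CollectI exI[of _ ?s]) simp
  show "m \<le> lambda5m n m" unfolding lambda5m_def
    by (rule cSup_upper[OF mem]) (rule bdd_aboveI[OF le])
  show "lambda5m n m \<le> m + (sparse_factor (alpha2 n m + 3) 3 + 1537 * mu5 (alpha2 n m + 3)) * n"
    unfolding lambda5m_def by (rule cSup_least) (use mem le in blast)+
qed

text \<open>The shift by three rows from Ackermann's function costs only the constant 5 * 8, as
  \<open>i + 4 \<le> 5 * i\<close> for positive \<open>i\<close>.\<close>

lemma mult_shift_le:
  assumes "1 \<le> i"
  shows "real ((i + 3 + 1) * 2 ^ (i + 3)) \<le> 40 * (real i * 2 ^ i)"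
proof -
  have "(i + 3 + 1) * 2 ^ (i + 3) \<le> (5 * i) * 2 ^ (i + 3)" using assms by (intro mult_right_mono) auto
  also have "\<dots> = 40 * (i * 2 ^ i)" by (simp add: power_add)
  finally have "real ((i + 3 + 1) * 2 ^ (i + 3)) \<le> real (40 * (i * 2 ^ i))" by (rule of_nat_mono)
  then show ?thesis by simp
qed

theorem mainTheorem11:
  shows "(\<exists>C::real. \<forall>n\<ge>1. real (lambda5 n) \<le> C * real n * real (alpha1 n) * 2 ^ alpha1 n)
       \<and> (\<exists>C::real. \<forall>n\<ge>1. \<forall>m\<ge>1.
            \<bar>real (lambda5m n m) - real m\<bar> \<le> C * real n * real (alpha2 n m) * 2 ^ alpha2 n m)"
proof -
  obtain A where A: "\<And>i. sparse_factor i 3 \<le> A * ((i + 1) * 2 ^ i)" using sparse_factor_le[of 3] by blast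
  define B where "B = A + 1537 * 11096"
  have B: "sparse_factor (i + 3) 3 + 1537 * mu5 (i + 3) \<le> B * ((i + 3 + 1) * 2 ^ (i + 3))" for i
  proof -
    have "sparse_factor (i + 3) 3 + 1537 * mu5 (i + 3)
        \<le> A * ((i + 3 + 1) * 2 ^ (i + 3)) + 1537 * (11096 * (i + 3 + 1) * 2 ^ (i + 3))"
      by (intro add_mono mult_le_mono2 A mu5_le)
    then show ?thesis unfolding B_def by (simp only: add_mult_distrib mult.assoc)
  qed
  have bound: "real X \<le> 40 * real B * real n * real i * 2 ^ i"
    if "X \<le> (sparse_factor (i + 3) 3 + 1537 * mu5 (i + 3)) * n" "1 \<le> i" for X n i
  proof -
    have "X \<le> B * ((i + 3 + 1) * 2 ^ (i + 3)) * n" using that(1) mult_le_mono1[OF B[of i], of n] by linarith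
    then have "real X \<le> real (B * ((i + 3 + 1) * 2 ^ (i + 3)) * n)" by (rule of_nat_mono)
    also have "\<dots> = real B * real n * real ((i + 3 + 1) * 2 ^ (i + 3))" by (simp only: of_nat_mult mult_ac)
    also have "\<dots> \<le> real B * real n * (40 * (real i * 2 ^ i))"
      by (rule mult_left_mono[OF mult_shift_le[OF that(2)]]) simp
    finally show ?thesis by (simp add: mult_ac)
  qed
  have \<alpha>: "1 \<le> alpha2 n m" for n m by (rule alpha2_spec(1)[OF refl])
  show ?thesis
  proof (intro conjI exI[of _ "40 * real B"] allI impI)
    fix n :: nat assume n: "1 \<le> n"
    have "lambda5 n \<le> (sparse_factor (alpha1 n + 3) 3 + 1537 * mu5 (alpha1 n + 3)) * n"
      using lambda5_le[OF n] by (simp add: add_mult_distrib)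
    then show "real (lambda5 n) \<le> 40 * real B * real n * real (alpha1 n) * 2 ^ alpha1 n"
      by (rule bound) (simp only: alpha1_def \<alpha>)
    fix m :: nat assume m: "1 \<le> m"
    note lb = lambda5m_bounds[OF n m]
    have "lambda5m n m - m \<le> (sparse_factor (alpha2 n m + 3) 3 + 1537 * mu5 (alpha2 n m + 3)) * n"
      using lb(2) by simp
    then have "real (lambda5m n m - m) \<le> 40 * real B * real n * real (alpha2 n m) * 2 ^ alpha2 n m"
      by (rule bound) (rule \<alpha>)
    then show "\<bar>real (lambda5m n m) - real m\<bar> \<le> 40 * real B * real n * real (alpha2 n m) * 2 ^ alpha2 n m"
      using lb(1) by (simp add: of_nat_diff)
  qed
qed

end
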